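(* For every integer $k\geq 1$, with $\omega(N)=\log N/\log\log N$, the following holds. For every set $A$ of $N$ positive integers there exists a maximal $(2k,4k)$-sum-free set $\Omega(2k,4k)\subseteq\mathbb{R}/\mathbb{Z}$ such that \[ \max_{x\in\mathbb{R}/\mathbb{Z}}\sum_{n\in A}\Big(\mathbbm{1}_{\Omega(2k,4k)}-\frac{1}{6k}\Big)(nx)\gg \omega(N). \] In particular, there is an absolute constant $c>0$ such that \[ \mathscr{M}_{(2k,4k)}(N)\geq \frac{N}{6k}+c\,\omega(N). \]
   Context: For positive integers $k<\ell$, a set $X$ (of positive integers, or a subset of $\mathbb{R}/\mathbb{Z}$) is $(k,\ell)$-sum-free if there are no elements $x_1,\dots,x_k,y_1,\dots,y_\ell\in X$ (repetitions allowed) with $x_1+\dots+x_k=y_1+\dots+y_\ell$. A maximal $(k,\ell)$-sum-free set in $\mathbb{R}/\mathbb{Z}$ means a $(k,\ell)$-sum-free subset of $\mathbb{R}/\mathbb{Z}$ of maximum possible measure, which is $1/(k+\ell)$. $\mathbbm{1}_\Omega$ denotes the indicator function of $\Omega$. For a finite set $A$ of positive integers, $\mathscr{M}_{(k,\ell)}(A)$ is the size of the largest $(k,\ell)$-sum-free subset of $A$, and $\mathscr{M}_{(k,\ell)}(N)=\inf\{\mathscr{M}_{(k,\ell)}(A): A\subseteq\mathbb{Z}^{>0},\ |A|=N\}$. The notation $f\gg g$ means $g=O(f)$ (for $N$ large).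
   Formalization: The constants (in ≫ and the "absolute constant" c) may depend on k, though not on N or A; one uniform in k and N is impossible: for A={1,2,4,…,2^(N-1)} and 2k divisible by all differences of elements of A, the largest (2k,4k)-sum-free subset has size 1. *)

theory Defs
  imports "HOL-Analysis.Analysis"
begin

definition int_cong :: "real \<Rightarrow> real \<Rightarrow> bool"
  where "int_cong x y \<longleftrightarrow> x - y \<in> \<int>"

lemma equivp_int_cong: "equivp int_cong"
proof (rule equivpI)
  show "reflp int_cong"
    by (simp add: reflp_def int_cong_def)
  show "symp int_cong"
    unfolding symp_def int_cong_def by (metis Ints_minus minus_diff_eq)
  show "transp int_cong"
  proof (rule transpI)
    fix x y z assume "int_cong x y" "int_cong y z"
    then have "(x - y) + (y - z) \<in> \<int>"
      unfolding int_cong_def by (rule Ints_add)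
    then show "int_cong x z"
      by (simp add: int_cong_def)
  qed
qed

text \<open>The group \<open>\<real>/\<int>\<close>.\<close>

quotient_type circle = real / int_cong
  by (rule equivp_int_cong)

instantiation circle :: ab_group_add
begin

lift_definition zero_circle :: circle is "0" .

lift_definition plus_circle :: "circle \<Rightarrow> circle \<Rightarrow> circle" is "(+)"
  unfolding int_cong_def by (metis Ints_add add_diff_add)

lift_definition uminus_circle :: "circle \<Rightarrow> circle" is "uminus"
  unfolding int_cong_def by (metis Ints_minus minus_diff_minus)

lift_definition minus_circle :: "circle \<Rightarrow> circle \<Rightarrow> circle" is "(-)"
proof -
  fix a b c d :: real
  assume "int_cong a b" "int_cong c d"
  then have "(a - b) - (c - d) \<in> \<int>"
    unfolding int_cong_def by (rule Ints_diff)
  then show "int_cong (a - c) (b - d)"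
    by (simp add: int_cong_def algebra_simps)
qed

instance
  by standard (transfer; simp add: int_cong_def algebra_simps)+

end

lift_definition to_circle :: "real \<Rightarrow> circle" is "\<lambda>x. x" .

lift_definition circle_nmult :: "nat \<Rightarrow> circle \<Rightarrow> circle" is "\<lambda>n x. real n * x"
proof -
  fix n :: nat and x y :: real
  assume "int_cong x y"
  then have "real n * (x - y) \<in> \<int>"
    unfolding int_cong_def by (intro Ints_mult) simp_all
  then show "int_cong (real n * x) (real n * y)"
    by (simp add: int_cong_def algebra_simps)
qed

text \<open>
  Normalised Haar measure on \<open>\<real>/\<int>\<close>, defined on the Lebesgue measurable sets: it is carried over
  from the fundamental domain \<open>[0,1)\<close>, on which \<^const>\<open>to_circle\<close> is a bijection.
\<close>

definition circle_measure :: "circle measure"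
  where "circle_measure = embed_measure (lebesgue_on {0..<1}) to_circle"

text \<open>
  The following is used both for sets of positive integers (as subsets of \<^typ>\<open>nat\<close>) and for
  subsets of \<open>\<real>/\<int>\<close>.
\<close>

definition sum_free :: "nat \<Rightarrow> nat \<Rightarrow> 'a::comm_monoid_add set \<Rightarrow> bool"
  where "sum_free k l X \<longleftrightarrow>
    \<not> (\<exists>x y. (\<forall>i<k. x i \<in> X) \<and> (\<forall>j<l. y j \<in> X) \<and> (\<Sum>i<k. x i) = (\<Sum>j<l. y j))"

text \<open>
  Maximality refers to the measure, not to inclusion.
\<close>

definition maximal_sum_free :: "nat \<Rightarrow> nat \<Rightarrow> circle set \<Rightarrow> bool"
  where "maximal_sum_free k l \<Omega> \<longleftrightarrow>
    \<Omega> \<in> sets circle_measure \<and> sum_free k l \<Omega> \<and>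
    (\<forall>X \<in> sets circle_measure. sum_free k l X \<longrightarrow>
       measure circle_measure X \<le> measure circle_measure \<Omega>)"

definition max_sum_free_size :: "nat \<Rightarrow> nat \<Rightarrow> nat set \<Rightarrow> nat"
  where "max_sum_free_size k l A = Max (card ` {B. B \<subseteq> A \<and> sum_free k l B})"

definition pos_int_sets :: "nat \<Rightarrow> nat set set"
  where "pos_int_sets N = {A. finite A \<and> card A = N \<and> (\<forall>n\<in>A. 0 < n)}"

definition min_max_sum_free_size :: "nat \<Rightarrow> nat \<Rightarrow> nat \<Rightarrow> nat"
  where "min_max_sum_free_size k l N = (INF A\<in>pos_int_sets N. max_sum_free_size k l A)"

definition omega :: "nat \<Rightarrow> real"
  where "omega N = ln (real N) / ln (ln (real N))"

end

theory Submission
  imports Defs "HOL-Computational_Algebra.Polynomial" "HOL-Computational_Algebra.Primes"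
begin

text \<open>
  For \<open>m < 2k\<close> the arc \<open>\<Omega>\<^sub>m = [(1 + 3m)/6k, (2 + 3m)/6k)\<close> is \<open>(2k, 4k)\<close>-sum-free, and by Raikov's
  inequality its measure \<open>1/6k\<close> is maximal. If the sums \<open>f\<^sub>m(x) = \<Sum>\<^bsub>n\<in>A\<^esub> (1\<^bsub>\<Omega>\<^sub>m\<^esub> - 1/6k)(nx)\<close> are all
  at most \<open>K\<close>, then, having mean zero, they have \<open>L\<^sup>1\<close> norm at most \<open>2K\<close>. The combinations
  \<open>\<Sum> f\<^sub>m\<close> and \<open>\<Sum> (-1)\<^sup>m f\<^sub>m\<close> are dilates of a cosine series with coefficients \<open>\<chi>\<^sub>3(r)/r\<close> and of
  \<open>(q(x) - q(3x))/2\<close>, where the square wave \<open>q\<close> is a sine series with coefficients \<open>1/r\<close>, \<open>r\<close> odd.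
  Sieving both by the primes \<open>p \<le> P = (log N)\<^sup>C\<close>, which costs a factor \<open>log P\<close>, and adding the sine
  series to the cosine series produces \<open>\<Sum>\<^bsub>n\<in>S\<^esub> \<plusminus>e(nx)\<close> plus frequencies \<open>\<plusminus>mn\<close> with \<open>m\<close> free of
  primes \<open>\<le> P\<close>, where \<open>S\<close> is the symmetric difference of \<open>A\<close> and \<open>3A\<close>. The McGehee--Pigno--Smith test
  function, with a Fejer mean taken at each step so that its negative frequencies stay above \<open>-P\<close>
  times the largest frequency used so far, does not see the negative frequencies of the tail that
  could harm it; the others are controlled by a large values estimate for rough numbers. This gives
  \<open>log |S| \<le> C K log log N\<close>. If \<open>S\<close> is smaller than a power of \<open>N\<close>, then \<open>A\<close> meets many
  3-adic levels, each in few elements, and comparing the second and fourth moments of the cosine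
  sum over these orthogonal levels gives a power of \<open>N\<close> instead.
\<close>

section \<open>Periodic functions and Fourier coefficients\<close>

text \<open>A single real wave, even or odd, has the frequencies n and -n with weights of equal
  size, and the test function is not controlled at -n. This is why both a cosine and a sine series
  are needed: normalised to \<open>chi3 r / (2 r)\<close> and \<open>1 / (2 r)\<close> at odd r,
  their coefficients add up to 1 at r = 1 and to 0 at r = -1, so after sieving every frequency n r
  other than n itself has |r| > P. The sine series comes only as q(x) - q(3x), so the cosine sum is
  differenced in the same way, for both to run over the same set S. Hence the bound sees |S| and not
  |A|, and a separate argument is needed when S is tiny, as for a geometric progression of ratio 3.
  The loss of log log N is the price of sieving: the large values estimate uses a moment of order q
  of size log N and asks for \<open>q\<^sup>2 \<le> P\<close>, so P is of order (log N)^2 and the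
  product of 1 + 1/p over p up to P is of order log P. For bounded N the asymptotic bound gives
  nothing; there the excess over N/6k is positive, and integrality turns this into a gain of at
  least 1/6k.\<close>

definition circ_fun :: "(real \<Rightarrow> 'a::{banach,second_countable_topology}) \<Rightarrow> bool" where
  "circ_fun g \<longleftrightarrow> g \<in> borel_measurable borel \<and> bounded (range g) \<and> (\<forall>x. g (x + 1) = g x)"

text \<open>Integrating over a half-open period lets it be cut at a point, and its pieces be
  translated by integers, with no null sets to discard.\<close>

definition mean :: "(real \<Rightarrow> 'a::{banach,second_countable_topology}) \<Rightarrow> 'a" where
  "mean g = (LINT x:{0..<1}|lborel. g x)"

lemma circ_funI:
  assumes "g \<in> borel_measurable borel" "\<And>x. norm (g x) \<le> C" "\<And>x. g (x + 1) = g x"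
  shows "circ_fun g"
  using assms unfolding circ_fun_def bounded_iff by blast

lemma circ_fun_measurable [measurable_dest]: "circ_fun g \<Longrightarrow> g \<in> borel_measurable borel"
  by (simp add: circ_fun_def)

lemma circ_fun_bound:
  assumes "circ_fun g" obtains C where "C > 0" "\<And>x. norm (g x) \<le> C"
proof -
  from assms obtain C where "\<And>x. norm (g x) \<le> C" unfolding circ_fun_def bounded_iff by blast
  then have "\<And>x. norm (g x) \<le> max C 1" by (meson max.coboundedI1)
  then show ?thesis using that[of "max C 1"] by auto
qed

lemma circ_fun_period: "circ_fun g \<Longrightarrow> g (x + 1) = g x"
  by (simp add: circ_fun_def)

lemma circ_fun_period_nat: "circ_fun g \<Longrightarrow> g (x + real n) = g x"
proof (induction n)
  case (Suc n)
  then show ?case using circ_fun_period[of g "x + real n"] by (simp add: algebra_simps)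
qed simp

lemma circ_fun_period_int:
  assumes "circ_fun g" shows "g (x + real_of_int n) = g x"
proof (cases "n \<ge> 0")
  case True
  then show ?thesis using circ_fun_period_nat[OF assms, of x "nat n"] by simp
next
  case False
  then show ?thesis using circ_fun_period_nat[OF assms, of "x + real_of_int n" "nat (- n)"] by simp
qed

lemma circ_fun_const [intro]: "circ_fun (\<lambda>x. c)"
  by (rule circ_funI[where C="norm c"]) auto

lemma circ_fun_add [intro]:
  assumes "circ_fun f" "circ_fun g" shows "circ_fun (\<lambda>x. f x + g x)"
proof -
  obtain C D where "\<And>x. norm (f x) \<le> C" "\<And>x. norm (g x) \<le> D"
    using circ_fun_bound[OF assms(1)] circ_fun_bound[OF assms(2)] by metis
  then have "norm (f x + g x) \<le> C + D" for x by (meson add_mono norm_triangle_le)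
  then show ?thesis
    using assms by (intro circ_funI) (auto simp: circ_fun_period intro: circ_fun_measurable)
qed

lemma circ_fun_mult [intro]:
  fixes f g :: "real \<Rightarrow> 'a::{banach,second_countable_topology,real_normed_algebra}"
  assumes "circ_fun f" "circ_fun g" shows "circ_fun (\<lambda>x. f x * g x)"
proof -
  obtain C D where *: "C > 0" "\<And>x. norm (f x) \<le> C" "\<And>x. norm (g x) \<le> D"
    using circ_fun_bound[OF assms(1)] circ_fun_bound[OF assms(2)] by metis
  then have "norm (f x * g x) \<le> C * D" for x
    by (smt (verit) mult_mono norm_ge_zero norm_mult_ineq)
  then show ?thesis
    using assms by (intro circ_funI) (auto simp: circ_fun_period intro!: borel_measurable_times circ_fun_measurable)
qed

lemma circ_fun_norm [intro]:
  assumes "circ_fun f" shows "circ_fun (\<lambda>x. norm (f x))"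
proof -
  obtain C where "\<And>x. norm (f x) \<le> C" using circ_fun_bound[OF assms] by blast
  then show ?thesis
    using circ_fun_measurable[OF assms] assms by (intro circ_funI[where C=C]) (auto simp: circ_fun_period)
qed

lemma circ_fun_of_real [intro]:
  assumes "circ_fun f" shows "circ_fun (\<lambda>x. complex_of_real (f x))"
proof -
  obtain C where "\<And>x. norm (f x) \<le> C" using circ_fun_bound[OF assms] by blast
  then show ?thesis
    using circ_fun_measurable[OF assms] assms by (intro circ_funI[where C=C]) (auto simp: circ_fun_period)
qed

lemma circ_fun_cnj [intro]: "circ_fun f \<Longrightarrow> circ_fun (\<lambda>x. cnj (f x))"
proof -
  assume f: "circ_fun f"
  obtain C where "\<And>x. norm (f x) \<le> C" using circ_fun_bound[OF f] by blast
  moreover have "cnj \<in> borel_measurable borel"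
    by (intro borel_measurable_continuous_onI continuous_intros)
  ultimately show ?thesis
    using f circ_fun_measurable[OF f] by (intro circ_funI[where C=C]) (auto simp: circ_fun_period)
qed

lemma circ_fun_cmult [intro]:
  fixes f :: "real \<Rightarrow> 'a::{banach,second_countable_topology,real_normed_algebra}"
  shows "circ_fun f \<Longrightarrow> circ_fun (\<lambda>x. c * f x)"
  by (intro circ_fun_mult circ_fun_const)

lemma circ_fun_diff [intro]:
  fixes f g :: "real \<Rightarrow> 'a::{banach,second_countable_topology,real_normed_algebra_1}"
  assumes "circ_fun f" "circ_fun g" shows "circ_fun (\<lambda>x. f x - g x)"
  using circ_fun_add[OF assms(1) circ_fun_cmult[OF assms(2), of "-1"]] by simp

lemma circ_fun_power [intro]:
  fixes f :: "real \<Rightarrow> 'a::{banach,second_countable_topology,real_normed_algebra_1}"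
  shows "circ_fun f \<Longrightarrow> circ_fun (\<lambda>x. f x ^ n)"
  by (induction n) auto

lemma circ_fun_sum [intro]:
  "(\<And>i. i \<in> A \<Longrightarrow> circ_fun (f i)) \<Longrightarrow> circ_fun (\<lambda>x. \<Sum>i\<in>A. f i x)"
  by (induction A rule: infinite_finite_induct) auto

lemma circ_fun_dilate:
  assumes "circ_fun g" shows "circ_fun (\<lambda>x. g (real n * x))"
proof -
  obtain C where "\<And>x. norm (g x) \<le> C" using circ_fun_bound[OF assms] by blast
  moreover have "g (real n * (x + 1)) = g (real n * x)" for x
    using circ_fun_period_nat[OF assms, of "real n * x" n] by (simp add: algebra_simps)
  ultimately show ?thesis
    using circ_fun_measurable[OF assms] by (intro circ_funI[where C=C]) auto
qed

lemma circ_fun_translate: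
  assumes "circ_fun g" shows "circ_fun (\<lambda>x. g (x + t))"
proof -
  obtain C where "\<And>x. norm (g x) \<le> C" using circ_fun_bound[OF assms] by blast
  moreover have "g ((x + 1) + t) = g (x + t)" for x
    using circ_fun_period[OF assms, of "x + t"] by (simp add: algebra_simps)
  ultimately show ?thesis
    using circ_fun_measurable[OF assms] by (intro circ_funI[where C=C]) auto
qed

lemma circ_fun_set_integrable:
  assumes "circ_fun g" shows "set_integrable lborel {a..<b} g"
proof -
  obtain C where C: "\<And>x. norm (g x) \<le> C" using circ_fun_bound[OF assms] by blast
  have "set_integrable lborel {a..<b} (\<lambda>x. C)"
    by (cases "a \<le> b") (simp_all add: set_integrable_def)
  then show ?thesis
    using circ_fun_measurable[OF assms] order_trans[OF C abs_ge_self]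
    by (rule_tac set_integrable_bound[where f="\<lambda>x. C"])
       (auto simp: set_borel_measurable_def)
qed

lemma mean_add:
  assumes "circ_fun f" "circ_fun g" shows "mean (\<lambda>x. f x + g x) = mean f + mean g"
  using assms by (simp add: mean_def set_integral_add circ_fun_set_integrable)

lemma mean_diff:
  assumes "circ_fun f" "circ_fun g" shows "mean (\<lambda>x. f x - g x) = mean f - mean g"
  using assms by (simp add: mean_def set_integral_diff circ_fun_set_integrable)

lemma mean_cmult:
  fixes f :: "real \<Rightarrow> 'a::{real_normed_field,banach,second_countable_topology}"
  shows "mean (\<lambda>x. c * f x) = c * mean f"
  by (simp add: mean_def)

lemma mean_multc:
  fixes f :: "real \<Rightarrow> 'a::{real_normed_field,banach,second_countable_topology}"
  shows "mean (\<lambda>x. f x * c) = mean f * c"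
  by (simp add: mean_def)

lemma mean_const [simp]: "mean (\<lambda>x. c) = c"
  by (simp add: mean_def set_lebesgue_integral_def)

lemma mean_sum:
  "(\<And>i. i \<in> A \<Longrightarrow> circ_fun (f i)) \<Longrightarrow> mean (\<lambda>x. \<Sum>i\<in>A. f i x) = (\<Sum>i\<in>A. mean (f i))"
  by (induction A rule: infinite_finite_induct) (auto simp: mean_add circ_fun_sum)

lemma mean_mono:
  fixes f g :: "real \<Rightarrow> real"
  assumes "circ_fun f" "circ_fun g" "\<And>x. f x \<le> g x" shows "mean f \<le> mean g"
  unfolding mean_def using assms by (intro set_integral_mono circ_fun_set_integrable) auto

lemma mean_nonneg:
  fixes f :: "real \<Rightarrow> real"
  assumes "circ_fun f" "\<And>x. 0 \<le> f x" shows "0 \<le> mean f"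
  using mean_mono[OF circ_fun_const[of 0] assms] by simp

lemma mean_of_real: "mean (\<lambda>x. complex_of_real (f x)) = complex_of_real (mean f)"
  by (simp add: mean_def set_integral_complex_of_real)

lemma norm_mean_le: "norm (mean f) \<le> mean (\<lambda>x. norm (f x))"
proof -
  have "norm (mean f) \<le> (LINT x|lborel. norm (indicator {0..<1} x *\<^sub>R f x))"
    unfolding mean_def set_lebesgue_integral_def by (rule integral_norm_bound)
  also have "\<dots> = mean (\<lambda>x. norm (f x))"
    by (simp add: mean_def set_lebesgue_integral_def)
  finally show ?thesis .
qed

lemma mean_cnj: "mean (\<lambda>x. cnj (f x)) = cnj (mean f)"
proof -
  have "mean (\<lambda>x. cnj (f x)) = (LINT x|lborel. cnj (indicator {0..<1} x *\<^sub>R f x))"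
    by (simp add: mean_def set_lebesgue_integral_def)
  also have "\<dots> = cnj (mean f)"
    unfolding mean_def set_lebesgue_integral_def by (rule Bochner_Integration.integral_cnj)
  finally show ?thesis .
qed

section \<open>Invariance of the mean under translation and dilation\<close>

lemma set_integral_Ico_split:
  assumes "circ_fun g" "a \<le> b" "b \<le> c"
  shows "(LINT x:{a..<c}|lborel. g x) = (LINT x:{a..<b}|lborel. g x) + (LINT x:{b..<c}|lborel. g x)"
proof -
  have "{a..<c} = {a..<b} \<union> {b..<c}" using assms by auto
  then show ?thesis using assms by (simp add: set_integral_Un circ_fun_set_integrable)
qed

lemma set_integral_Ico_translate:
  fixes g :: "real \<Rightarrow> 'a::{banach,second_countable_topology}"
  shows "(LINT x:{a + t..<b + t}|lborel. g x) = (LINT x:{a..<b}|lborel. g (x + t))"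
  unfolding set_lebesgue_integral_def
  by (subst lborel_integral_real_affine[where c=1 and t=t])
     (auto intro!: Bochner_Integration.integral_cong simp: indicator_def algebra_simps)

lemma mean_translate:
  assumes "circ_fun g" "0 \<le> t" "t \<le> 1" shows "mean (\<lambda>x. g (x + t)) = mean g"
proof -
  have "mean (\<lambda>x. g (x + t)) = (LINT x:{t..<1 + t}|lborel. g x)"
    using set_integral_Ico_translate[of 0 t 1 g] by (simp add: mean_def)
  also have "\<dots> = (LINT x:{t..<1}|lborel. g x) + (LINT x:{0 + 1..<t + 1}|lborel. g x)"
    using set_integral_Ico_split[OF assms(1), of t 1 "1 + t"] assms by (simp add: algebra_simps)
  also have "(LINT x:{0 + 1..<t + 1}|lborel. g x) = (LINT x:{0..<t}|lborel. g x)"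
    by (subst set_integral_Ico_translate) (simp add: circ_fun_period[OF assms(1)])
  also have "(LINT x:{t..<1}|lborel. g x) + (LINT x:{0..<t}|lborel. g x) = mean g"
    using set_integral_Ico_split[OF assms(1), of 0 t 1] assms by (simp add: mean_def)
  finally show ?thesis .
qed

text \<open>The integral over [0, n) is computed twice, as n periods and by the substitution y = n
  x. Because dilation preserves the mean, subtracting a dilate of a function from it costs only a
  constant factor in L^1.\<close>

lemma mean_dilate:
  assumes g: "circ_fun g" and n: "n > 0" shows "mean (\<lambda>x. g (real n * x)) = mean g"
proof -
  have *: "(LINT x:{0..<real m}|lborel. g x) = real m *\<^sub>R mean g" for m
  proof (induction m)
    case 0
    then show ?case by (simp add: set_lebesgue_integral_def)
  next
    case (Suc m)
    have "(LINT x:{real m..<real (Suc m)}|lborel. g x) = mean g"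
      using set_integral_Ico_translate[of 0 "real m" 1 g]
      by (simp add: mean_def circ_fun_period_nat[OF g] add.commute)
    then show ?case using Suc set_integral_Ico_split[OF g, of 0 "real m" "real (Suc m)"]
      by (simp add: scaleR_add_left)
  qed
  have "real n *\<^sub>R mean g = (LINT x|lborel. indicator {0..<real n} x *\<^sub>R g x)"
    using *[of n] by (simp add: set_lebesgue_integral_def)
  also have "\<dots> = real n *\<^sub>R (LINT x|lborel. indicator {0..<real n} (0 + real n * x) *\<^sub>R g (0 + real n * x))"
    by (subst lborel_integral_real_affine[where c="real n" and t=0]) (use n in auto)
  also have "(LINT x|lborel. indicator {0..<real n} (0 + real n * x) *\<^sub>R g (0 + real n * x))
      = mean (\<lambda>x. g (real n * x))"
    unfolding mean_def set_lebesgue_integral_def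
    using n by (intro Bochner_Integration.integral_cong) (auto simp: indicator_def zero_le_mult_iff)
  finally show ?thesis using n by simp
qed

section \<open>Characters and Fourier coefficients\<close>

definition echar :: "int \<Rightarrow> real \<Rightarrow> complex" where
  "echar k x = cis (2 * pi * of_int k * x)"

lemma norm_echar [simp]: "norm (echar k x) = 1" by (simp add: echar_def)
lemma echar_0 [simp]: "echar 0 x = 1" by (simp add: echar_def)
lemma echar_add: "echar (j + k) x = echar j x * echar k x"
  by (simp add: echar_def cis_mult algebra_simps)
lemma echar_add_arg: "echar k (x + y) = echar k x * echar k y"
  by (simp add: echar_def cis_mult algebra_simps)
lemma cnj_echar [simp]: "cnj (echar k x) = echar (- k) x" by (simp add: echar_def cis_cnj)
lemma echar_mult_arg: "echar k (real n * x) = echar (k * int n) x"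
  by (simp add: echar_def algebra_simps)
lemma echar_nonzero [simp]: "echar k x \<noteq> 0"
  using norm_echar[of k x] by (metis norm_zero zero_neq_one)

lemma echar_of_int: "echar k (of_int m) = 1"
proof -
  have "echar k (of_int m) = cis (2 * pi * of_int (k * m))" by (simp add: echar_def algebra_simps)
  then show ?thesis by (metis Ints_of_int cis_multiple_2pi)
qed

lemma continuous_echar [continuous_intros]: "continuous_on A (echar k)"
  unfolding echar_def by (intro continuous_intros)

lemma circ_fun_echar [intro]: "circ_fun (echar k)"
  using echar_of_int[of k 1]
  by (intro circ_funI[where C=1]) (auto simp: echar_add_arg intro!: borel_measurable_continuous_onI continuous_intros)

definition fcoeff :: "(real \<Rightarrow> complex) \<Rightarrow> int \<Rightarrow> complex" where
  "fcoeff g k = mean (\<lambda>x. g x * echar (- k) x)"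

lemma set_integral_echar:
  assumes "k \<noteq> 0" "a \<le> b"
  shows "(LINT x:{a..<b}|lborel. echar k x) = (echar k b - echar k a) / (2 * pi * \<i> * of_int k)"
proof -
  define c where "c = 2 * pi * \<i> * of_int k"
  have c: "c \<noteq> 0" using assms by (simp add: c_def)
  have echar_exp: "echar k x = exp (c * of_real x)" for x
    by (simp add: echar_def cis_conv_exp c_def mult_ac)
  have "((\<lambda>z. exp (c * z) / c) has_field_derivative exp (c * z)) (at z)" for z
    using c by (auto intro!: derivative_eq_intros)
  from has_vector_derivative_real_field[OF this]
  have d: "((\<lambda>x. echar k x / c) has_vector_derivative echar k x) (at x within X)" for x X
    by (simp add: echar_exp)
  have ecm: "echar k \<in> borel_measurable borel" by (intro circ_fun_measurable circ_fun_echar)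
  have "(LINT x:{a..<b}|lborel. echar k x) = (LINT x|lborel. indicator {a..b} x *\<^sub>R echar k x)"
    unfolding set_lebesgue_integral_def
    by (rule integral_cong_AE)
       (use AE_lborel_singleton[of b] ecm in \<open>auto elim!: eventually_mono simp: indicator_def\<close>)
  also have "\<dots> = echar k b / c - echar k a / c"
    by (rule integral_FTC_Icc[OF assms(2)]) (auto intro: d continuous_intros)
  finally show ?thesis by (simp add: c_def diff_divide_distrib)
qed

lemma mean_echar: "mean (echar k) = (if k = 0 then 1 else 0)"
proof (cases "k = 0")
  case True
  then have "echar k = (\<lambda>x. 1)" by auto
  then show ?thesis using True by simp
next
  case False
  then show ?thesis using set_integral_echar[of k 0 1] echar_of_int[of k 0] echar_of_int[of k 1] by (simp add: mean_def)
qed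

lemma fcoeff_echar: "fcoeff (echar j) k = (if j = k then 1 else 0)"
  by (simp add: fcoeff_def mean_echar flip: echar_add)

lemma fcoeff_add: "circ_fun f \<Longrightarrow> circ_fun g \<Longrightarrow> fcoeff (\<lambda>x. f x + g x) k = fcoeff f k + fcoeff g k"
  unfolding fcoeff_def by (simp add: distrib_right mean_add circ_fun_mult circ_fun_echar)

lemma fcoeff_diff: "circ_fun f \<Longrightarrow> circ_fun g \<Longrightarrow> fcoeff (\<lambda>x. f x - g x) k = fcoeff f k - fcoeff g k"
  unfolding fcoeff_def by (simp add: left_diff_distrib mean_diff circ_fun_mult circ_fun_echar)

lemma fcoeff_cmult: "fcoeff (\<lambda>x. c * f x) k = c * fcoeff f k"
  unfolding fcoeff_def by (simp add: mean_cmult mult.assoc)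

lemma fcoeff_sum:
  "(\<And>i. i \<in> A \<Longrightarrow> circ_fun (f i)) \<Longrightarrow> fcoeff (\<lambda>x. \<Sum>i\<in>A. f i x) k = (\<Sum>i\<in>A. fcoeff (f i) k)"
  unfolding fcoeff_def by (simp add: sum_distrib_right mean_sum circ_fun_mult circ_fun_echar)

lemma fcoeff_mult_echar: "fcoeff (\<lambda>x. echar j x * g x) k = fcoeff g (k - j)"
proof -
  have "echar j x * g x * echar (- k) x = g x * echar (- (k - j)) x" for x
    using echar_add[of j "-k" x] by (simp add: algebra_simps)
  then show ?thesis unfolding fcoeff_def by (simp only:)
qed

text \<open>If n does not divide k, translation by 1/n leaves g(nx) unchanged but multiplies the
  character by a nontrivial root of unity, so the mean of the product is zero.\<close>

lemma fcoeff_dilate: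
  assumes g: "circ_fun g" and n: "n > 0"
  shows "fcoeff (\<lambda>x. g (real n * x)) k = (if int n dvd k then fcoeff g (k div int n) else 0)"
proof (cases "int n dvd k")
  case True
  then obtain j where j: "k = int n * j" by (elim dvdE)
  have "fcoeff (\<lambda>x. g (real n * x)) k = mean (\<lambda>x. (\<lambda>y. g y * echar (- j) y) (real n * x))"
    by (simp add: fcoeff_def j echar_mult_arg mult.commute[of j])
  also have "\<dots> = fcoeff g j"
    unfolding fcoeff_def by (rule mean_dilate[OF _ n]) (intro circ_fun_mult g circ_fun_echar)
  finally show ?thesis using True n by (simp add: j)
next
  case False
  define h where "h = (\<lambda>x. g (real n * x) * echar (- k) x)"
  have h: "circ_fun h" unfolding h_def by (intro circ_fun_mult circ_fun_dilate g circ_fun_echar)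
  have "mean (\<lambda>x. h (x + 1 / real n)) = mean h"
    by (rule mean_translate[OF h]) (use n in auto)
  moreover have "h (x + 1 / real n) = h x * echar (- k) (1 / real n)" for x
    using n circ_fun_period[OF g, of "real n * x"] by (simp add: h_def echar_add_arg distrib_left)
  ultimately have "mean h * echar (- k) (1 / real n) = mean h" by (simp add: mean_multc)
  moreover have "echar (- k) (1 / real n) \<noteq> 1"
  proof
    assume "echar (- k) (1 / real n) = 1"
    then have "Re (cis (2 * pi * of_int (- k) * (1 / real n))) = 1" by (simp add: echar_def)
    then have "cos (2 * pi * of_int (- k) * (1 / real n)) = 1" by simp
    then obtain m :: int where "2 * pi * of_int (- k) * (1 / real n) = of_int m * 2 * pi"
      unfolding cos_one_2pi_int by blast
    then have "(2 * pi) * (- real_of_int k) = (2 * pi) * (of_int m * real n)"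
      using n by (simp add: field_simps)
    then have "- real_of_int k = of_int m * real n" unfolding mult_cancel_left by simp
    then have "of_int (- k) = (of_int (m * int n) :: real)" by simp
    then have "- k = m * int n" using of_int_eq_iff by blast
    then have "int n dvd k" by (metis dvd_minus_iff dvd_triv_right)
    then show False using False by blast
  qed
  ultimately have "mean h = 0" by (metis mult_cancel_left mult.right_neutral)
  then show ?thesis using False by (simp add: fcoeff_def h_def)
qed

lemma norm_fcoeff_le: "circ_fun g \<Longrightarrow> norm (fcoeff g k) \<le> mean (\<lambda>x. norm (g x))"
  unfolding fcoeff_def using norm_mean_le[of "\<lambda>x. g x * echar (- k) x"] by (simp add: norm_mult)

section \<open>Trigonometric polynomials and Fejer means\<close>

definition spectrum :: "(real \<Rightarrow> complex) \<Rightarrow> int set" where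
  "spectrum g = {k. fcoeff g k \<noteq> 0}"

text \<open>A polynomial is identified with its own finite Fourier expansion, so no coefficient
  family has to be carried along. The set \<open>K\<close> only says where the spectrum may lie;
  \<open>{..0}\<close> expresses that no frequency is positive.\<close>

definition trigpoly :: "int set \<Rightarrow> (real \<Rightarrow> complex) \<Rightarrow> bool" where
  "trigpoly K g \<longleftrightarrow> finite (spectrum g) \<and> spectrum g \<subseteq> K \<and> (\<forall>x. g x = (\<Sum>k\<in>spectrum g. fcoeff g k * echar k x))"

lemma fcoeff_trig_sum:
  assumes "finite F"
  shows "fcoeff (\<lambda>x. \<Sum>j\<in>F. c j * echar j x) k = (if k \<in> F then c k else 0)"
proof -
  have "fcoeff (\<lambda>x. \<Sum>j\<in>F. c j * echar j x) k = (\<Sum>j\<in>F. c j * (if j = k then 1 else 0))"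
    by (subst fcoeff_sum) (auto simp: fcoeff_cmult fcoeff_echar intro!: circ_fun_cmult circ_fun_echar)
  also have "\<dots> = (\<Sum>j\<in>F. if j = k then c j else 0)"
    by (rule sum.cong) auto
  also have "\<dots> = (if k \<in> F then c k else 0)"
    using assms by simp
  finally show ?thesis .
qed

lemma trigpolyI:
  assumes "finite F" "F \<subseteq> K" and g: "\<And>x. g x = (\<Sum>k\<in>F. c k * echar k x)"
  shows "trigpoly K g"
proof -
  have coeff: "fcoeff g k = (if k \<in> F then c k else 0)" for k
    using fcoeff_trig_sum[OF assms(1), of c k] g by (metis (no_types, lifting) ext)
  have F: "spectrum g \<subseteq> F" by (auto simp: spectrum_def coeff split: if_splits)
  have "g x = (\<Sum>k\<in>spectrum g. fcoeff g k * echar k x)" for x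
  proof -
    have "(\<Sum>k\<in>F. c k * echar k x) = (\<Sum>k\<in>spectrum g. fcoeff g k * echar k x)"
      by (rule sum.mono_neutral_cong_right) (use assms(1) F coeff in \<open>auto simp: spectrum_def\<close>)
    then show ?thesis using g by metis
  qed
  then show ?thesis
    using F assms finite_subset unfolding trigpoly_def by blast
qed

lemma trigpoly_expand:
  assumes "trigpoly K g" "finite F" "spectrum g \<subseteq> F"
  shows "g x = (\<Sum>k\<in>F. fcoeff g k * echar k x)"
proof -
  have "g x = (\<Sum>k\<in>spectrum g. fcoeff g k * echar k x)" using assms by (simp add: trigpoly_def)
  also have "\<dots> = (\<Sum>k\<in>F. fcoeff g k * echar k x)"
    using assms by (intro sum.mono_neutral_left) (auto simp: spectrum_def)
  finally show ?thesis .
qed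

lemma trigpoly_spectrum: "trigpoly K g \<Longrightarrow> finite (spectrum g)" "trigpoly K g \<Longrightarrow> spectrum g \<subseteq> K"
  by (auto simp: trigpoly_def)

lemma trigpoly_eq: "trigpoly K g \<Longrightarrow> g = (\<lambda>x. \<Sum>k\<in>spectrum g. fcoeff g k * echar k x)"
  by (auto simp: trigpoly_def)

lemma trigpoly_fcoeff: "trigpoly K g \<Longrightarrow> k \<notin> K \<Longrightarrow> fcoeff g k = 0"
  by (auto simp: trigpoly_def spectrum_def)

lemma trigpoly_circ_fun: "trigpoly K g \<Longrightarrow> circ_fun g"
  by (subst trigpoly_eq[of K g], assumption) (intro circ_fun_sum circ_fun_cmult circ_fun_echar)

lemma trigpoly_mono: "trigpoly K g \<Longrightarrow> K \<subseteq> L \<Longrightarrow> trigpoly L g"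
  by (auto simp: trigpoly_def)

lemma trigpoly_const: "0 \<in> K \<Longrightarrow> trigpoly K (\<lambda>x. c)"
  by (rule trigpolyI[of "{0}" _ _ "\<lambda>_. c"]) auto

lemma trigpoly_zero: "trigpoly K (\<lambda>x. 0)"
  by (rule trigpolyI[of "{}"]) auto

lemma trigpoly_echar: "k \<in> K \<Longrightarrow> trigpoly K (echar k)"
  by (rule trigpolyI[of "{k}" _ _ "\<lambda>_. 1"]) auto

lemma trigpoly_add:
  assumes "trigpoly K f" "trigpoly K g" shows "trigpoly K (\<lambda>x. f x + g x)"
proof (rule trigpolyI)
  show "finite (spectrum f \<union> spectrum g)" "spectrum f \<union> spectrum g \<subseteq> K"
    using assms trigpoly_spectrum by auto
  show "f x + g x = (\<Sum>k\<in>spectrum f \<union> spectrum g. (fcoeff f k + fcoeff g k) * echar k x)" for x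
    using trigpoly_expand[OF assms(1), of "spectrum f \<union> spectrum g" x]
      trigpoly_expand[OF assms(2), of "spectrum f \<union> spectrum g" x] assms
    by (simp add: trigpoly_spectrum distrib_right sum.distrib)
qed

lemma trigpoly_cmult:
  assumes "trigpoly K f" shows "trigpoly K (\<lambda>x. c * f x)"
proof (rule trigpolyI)
  show "finite (spectrum f)" "spectrum f \<subseteq> K" using assms trigpoly_spectrum by auto
  show "c * f x = (\<Sum>k\<in>spectrum f. (c * fcoeff f k) * echar k x)" for x
    using trigpoly_expand[OF assms, of "spectrum f" x] assms
    by (simp add: trigpoly_spectrum sum_distrib_left mult.assoc)
qed

lemma trigpoly_diff:
  assumes "trigpoly K f" "trigpoly K g" shows "trigpoly K (\<lambda>x. f x - g x)"
  using trigpoly_add[OF assms(1) trigpoly_cmult[OF assms(2), of "-1"]] by simp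

lemma trigpoly_sum:
  "(\<And>i. i \<in> A \<Longrightarrow> trigpoly K (f i)) \<Longrightarrow> trigpoly K (\<lambda>x. \<Sum>i\<in>A. f i x)"
  by (induction A rule: infinite_finite_induct) (auto intro: trigpoly_add trigpoly_zero)

lemma trigpoly_mult:
  assumes f: "trigpoly K f" and g: "trigpoly L g" and KL: "\<And>k l. k \<in> K \<Longrightarrow> l \<in> L \<Longrightarrow> k + l \<in> M"
  shows "trigpoly M (\<lambda>x. f x * g x)"
proof -
  have "f x * g x = (\<Sum>k\<in>spectrum f. \<Sum>l\<in>spectrum g. fcoeff f k * fcoeff g l * echar (k + l) x)" for x
    using trigpoly_expand[OF f, of "spectrum f" x] trigpoly_expand[OF g, of "spectrum g" x] f g
    by (simp add: trigpoly_spectrum sum_product echar_add mult_ac)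
  moreover have "trigpoly M (\<lambda>x. \<Sum>k\<in>spectrum f. \<Sum>l\<in>spectrum g. fcoeff f k * fcoeff g l * echar (k + l) x)"
    using trigpoly_spectrum(2)[OF f] trigpoly_spectrum(2)[OF g] KL
    by (intro trigpoly_sum trigpoly_cmult trigpoly_echar) blast
  ultimately show ?thesis by presburger
qed

lemma trigpoly_power:
  assumes f: "trigpoly K f" and K: "\<And>k l. k \<in> K \<Longrightarrow> l \<in> K \<Longrightarrow> k + l \<in> K" "0 \<in> K"
  shows "trigpoly K (\<lambda>x. f x ^ n)"
proof (induction n)
  case 0
  then show ?case using trigpoly_const[OF K(2), of 1] by simp
next
  case (Suc n)
  then show ?case using trigpoly_mult[OF f Suc, of K] K by simp
qed

lemma trigpoly_cnj:
  assumes f: "trigpoly UNIV f" shows "trigpoly UNIV (\<lambda>x. cnj (f x))"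
proof -
  have "cnj (f x) = (\<Sum>k\<in>spectrum f. cnj (fcoeff f k) * echar (- k) x)" for x
    using trigpoly_expand[OF f, of "spectrum f" x] f by (simp add: trigpoly_spectrum)
  moreover have "trigpoly UNIV (\<lambda>x. \<Sum>k\<in>spectrum f. cnj (fcoeff f k) * echar (- k) x)"
    by (intro trigpoly_sum trigpoly_cmult trigpoly_echar) auto
  ultimately show ?thesis by presburger
qed

section \<open>Products, Parseval and Bessel\<close>

lemma fcoeff_mult:
  assumes g: "trigpoly K g" and h: "circ_fun h"
  shows "fcoeff (\<lambda>x. g x * h x) n = (\<Sum>k\<in>spectrum g. fcoeff g k * fcoeff h (n - k))"
proof -
  have "g x * h x = (\<Sum>k\<in>spectrum g. fcoeff g k * (echar k x * h x))" for x
    using trigpoly_expand[OF g, of "spectrum g" x] g by (simp add: trigpoly_spectrum sum_distrib_right mult.assoc)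
  then have "fcoeff (\<lambda>x. g x * h x) n = fcoeff (\<lambda>x. \<Sum>k\<in>spectrum g. fcoeff g k * (echar k x * h x)) n" by presburger
  also have "\<dots> = (\<Sum>k\<in>spectrum g. fcoeff g k * fcoeff h (n - k))"
    by (subst fcoeff_sum) (auto simp: fcoeff_cmult fcoeff_mult_echar intro!: circ_fun_cmult circ_fun_mult circ_fun_echar h)
  finally show ?thesis .
qed

lemma mean_mult_cnj:
  assumes g: "trigpoly K g" and h: "circ_fun h"
  shows "mean (\<lambda>x. h x * cnj (g x)) = (\<Sum>k\<in>spectrum g. fcoeff h k * cnj (fcoeff g k))"
proof -
  have "h x * cnj (g x) = (\<Sum>k\<in>spectrum g. cnj (fcoeff g k) * (h x * echar (- k) x))" for x
    using trigpoly_expand[OF g, of "spectrum g" x] g by (simp add: trigpoly_spectrum sum_distrib_left mult_ac)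
  then have "mean (\<lambda>x. h x * cnj (g x)) = mean (\<lambda>x. \<Sum>k\<in>spectrum g. cnj (fcoeff g k) * (h x * echar (- k) x))" by presburger
  also have "\<dots> = (\<Sum>k\<in>spectrum g. cnj (fcoeff g k) * fcoeff h k)"
    by (subst mean_sum) (auto simp: mean_cmult fcoeff_def intro!: circ_fun_cmult circ_fun_mult circ_fun_echar h)
  finally show ?thesis by (simp add: mult.commute)
qed

lemma parseval:
  assumes g: "trigpoly K g"
  shows "mean (\<lambda>x. (cmod (g x))\<^sup>2) = (\<Sum>k\<in>spectrum g. (cmod (fcoeff g k))\<^sup>2)"
proof -
  have "complex_of_real (mean (\<lambda>x. (cmod (g x))\<^sup>2)) = mean (\<lambda>x. g x * cnj (g x))"
    by (simp only: mean_of_real[symmetric] complex_norm_square)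
  also have "\<dots> = (\<Sum>k\<in>spectrum g. fcoeff g k * cnj (fcoeff g k))"
    by (rule mean_mult_cnj[OF g trigpoly_circ_fun[OF g]])
  also have "\<dots> = complex_of_real (\<Sum>k\<in>spectrum g. (cmod (fcoeff g k))\<^sup>2)"
    by (simp only: of_real_sum complex_norm_square)
  finally show ?thesis using of_real_eq_iff by blast
qed

lemma bessel_trigpoly:
  assumes g: "trigpoly K g" and F: "finite F"
  shows "(\<Sum>k\<in>F. (cmod (fcoeff g k))\<^sup>2) \<le> mean (\<lambda>x. (cmod (g x))\<^sup>2)"
proof -
  have "(\<Sum>k\<in>F. (cmod (fcoeff g k))\<^sup>2) \<le> (\<Sum>k\<in>F \<union> spectrum g. (cmod (fcoeff g k))\<^sup>2)"
    using F trigpoly_spectrum(1)[OF g] by (intro sum_mono2) auto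
  also have "\<dots> = (\<Sum>k\<in>spectrum g. (cmod (fcoeff g k))\<^sup>2)"
    using F trigpoly_spectrum(1)[OF g] by (intro sum.mono_neutral_right) (auto simp: spectrum_def)
  finally show ?thesis using parseval[OF g] by simp
qed

lemma norm_sum_mult_le:
  fixes a b :: "'i \<Rightarrow> complex"
  shows "cmod (\<Sum>i\<in>A. a i * b i) \<le> sqrt (\<Sum>i\<in>A. (cmod (a i))\<^sup>2) * sqrt (\<Sum>i\<in>A. (cmod (b i))\<^sup>2)"
proof -
  have "cmod (\<Sum>i\<in>A. a i * b i) \<le> (\<Sum>i\<in>A. \<bar>cmod (a i)\<bar> * \<bar>cmod (b i)\<bar>)"
    by (rule order_trans[OF norm_sum]) (simp add: norm_mult)
  also have "\<dots> \<le> L2_set (\<lambda>i. cmod (a i)) A * L2_set (\<lambda>i. cmod (b i)) A"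
    by (rule L2_set_mult_ineq)
  finally show ?thesis by (simp add: L2_set_def)
qed

text \<open>The triangular weight max(0, 1 - |k|/M), kept as a count of pairs because that is how it
  arises from the squared modulus of a sum of M characters.\<close>

definition fejer_weight :: "nat \<Rightarrow> int \<Rightarrow> real" where
  "fejer_weight M k = real (card {(a, b). a < M \<and> b < M \<and> int a - int b = k}) / real M"

definition fejer :: "nat \<Rightarrow> (real \<Rightarrow> complex) \<Rightarrow> real \<Rightarrow> complex" where
  "fejer M g x = (\<Sum>a<M. \<Sum>b<M. fcoeff g (int a - int b) * echar (int a - int b) x) / of_nat M"

lemma fejer_weight_bounds:
  assumes "M > 0"
  shows "0 \<le> fejer_weight M k" "fejer_weight M k \<le> 1"
    "1 - \<bar>real_of_int k\<bar> / real M \<le> fejer_weight M k"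
    "\<bar>k\<bar> \<ge> int M \<Longrightarrow> fejer_weight M k = 0"
proof -
  let ?A = "{(a, b). a < M \<and> b < M \<and> int a - int b = k}"
  have fin: "finite ?A" by (rule finite_subset[of _ "{..<M} \<times> {..<M}"]) auto
  show "0 \<le> fejer_weight M k" by (simp add: fejer_weight_def)
  have "card ?A \<le> card {..<M}"
    by (rule card_inj_on_le[of fst]) (auto simp: inj_on_def)
  then show "fejer_weight M k \<le> 1" using assms by (simp add: fejer_weight_def)
  show "fejer_weight M k = 0" if "\<bar>k\<bar> \<ge> int M"
  proof -
    have "?A = {}" using that by auto
    then show ?thesis unfolding fejer_weight_def by (subst \<open>?A = {}\<close>) simp
  qed
  have "card {..<nat (int M - \<bar>k\<bar>)} \<le> card ?A"
    by (rule card_inj_on_le[of "\<lambda>b. (b + nat k, b + nat (- k))"]) (auto simp: inj_on_def fin)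
  then have "real_of_int (int M - \<bar>k\<bar>) \<le> real (card ?A)" by simp
  then have "(real M - \<bar>real_of_int k\<bar>) / real M \<le> fejer_weight M k"
    unfolding fejer_weight_def using assms by (intro divide_right_mono) auto
  then show "1 - \<bar>real_of_int k\<bar> / real M \<le> fejer_weight M k"
    using assms by (simp add: diff_divide_distrib)
qed

lemma trigpoly_fejer: "trigpoly {- int M<..<int M} (fejer M g)"
proof -
  have "fejer M g = (\<lambda>x. 1 / of_nat M * (\<Sum>a<M. \<Sum>b<M. fcoeff g (int a - int b) * echar (int a - int b) x))"
    by (auto simp: fejer_def)
  moreover have "trigpoly {- int M<..<int M} \<dots>"
    by (intro trigpoly_cmult trigpoly_sum trigpoly_echar) auto
  ultimately show ?thesis by presburger
qed

lemma fcoeff_fejer: "fcoeff (fejer M g) k = of_real (fejer_weight M k) * fcoeff g k"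
proof -
  have "fejer M g = (\<lambda>x. 1 / of_nat M * (\<Sum>p\<in>{..<M}\<times>{..<M}. fcoeff g (int (fst p) - int (snd p)) * echar (int (fst p) - int (snd p)) x))"
    by (auto simp: fejer_def sum.cartesian_product case_prod_unfold)
  then have "fcoeff (fejer M g) k = 1 / of_nat M * (\<Sum>p\<in>{..<M}\<times>{..<M}. fcoeff g (int (fst p) - int (snd p)) * (if int (fst p) - int (snd p) = k then 1 else 0))"
    by (simp only: fcoeff_cmult) (subst fcoeff_sum, auto simp: fcoeff_cmult fcoeff_echar intro!: circ_fun_cmult circ_fun_echar)
  also have "(\<Sum>p\<in>{..<M}\<times>{..<M}. fcoeff g (int (fst p) - int (snd p)) * (if int (fst p) - int (snd p) = k then 1 else 0))
     = (\<Sum>p\<in>{(a, b). a < M \<and> b < M \<and> int a - int b = k}. fcoeff g k)"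
    by (rule sum.mono_neutral_cong_right) auto
  finally show ?thesis by (simp add: fejer_weight_def)
qed

text \<open>\<open>fejer M g x\<close> is the average of g against |D|^2 / M, where D is a sum of M
  characters centred at x. This kernel is nonnegative, and by Parseval it has mean one.\<close>

lemma norm_fejer_le:
  assumes g: "circ_fun g" and C: "\<And>x. cmod (g x) \<le> C" and M: "M > 0"
  shows "cmod (fejer M g x) \<le> C"
proof -
  define D where "D = (\<lambda>y. \<Sum>a<M. echar (- int a) x * echar (int a) y)"
  have D: "trigpoly UNIV D" unfolding D_def by (intro trigpoly_sum trigpoly_cmult trigpoly_echar) auto
  have Dc: "circ_fun D" by (rule trigpoly_circ_fun[OF D])
  have "D = (\<lambda>y. \<Sum>k\<in>int ` {..<M}. echar (- k) x * echar k y)"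
    by (simp add: D_def sum.reindex)
  then have fcD: "fcoeff D k = (if k \<in> int ` {..<M} then echar (- k) x else 0)" for k
    by (simp add: fcoeff_trig_sum)
  then have "spectrum D = int ` {..<M}" by (auto simp: spectrum_def)
  then have PD: "mean (\<lambda>y. (cmod (D y))\<^sup>2) = real M"
    by (simp add: parseval[OF D] fcD card_image)
  have "g y * (D y * cnj (D y)) =
      (\<Sum>a<M. \<Sum>b<M. echar (int a - int b) x * (g y * echar (- (int a - int b)) y))" for y
  proof -
    have "D y * cnj (D y) = cnj (D y) * D y" by simp
    also have "\<dots> = (\<Sum>a<M. \<Sum>b<M. (echar (int a) x * echar (- int a) y) * (echar (- int b) x * echar (int b) y))"
      by (simp add: D_def sum_product)
    also have "\<dots> = (\<Sum>a<M. \<Sum>b<M. echar (int a - int b) x * echar (- (int a - int b)) y)"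
    proof (intro sum.cong refl)
      fix a b
      have "echar (int a - int b) x = echar (int a) x * echar (- int b) x" "echar (- (int a - int b)) y = echar (- int a) y * echar (int b) y"
        using echar_add[of "int a" "- int b" x] echar_add[of "- int a" "int b" y] by simp_all
      then show "(echar (int a) x * echar (- int a) y) * (echar (- int b) x * echar (int b) y) = echar (int a - int b) x * echar (- (int a - int b)) y"
        by simp
    qed
    finally show ?thesis by (simp add: sum_distrib_left mult_ac)
  qed
  then have "mean (\<lambda>y. g y * (D y * cnj (D y))) =
      mean (\<lambda>y. \<Sum>a<M. \<Sum>b<M. echar (int a - int b) x * (g y * echar (- (int a - int b)) y))" by presburger
  also have "\<dots> = (\<Sum>a<M. mean (\<lambda>y. \<Sum>b<M. echar (int a - int b) x * (g y * echar (- (int a - int b)) y)))"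
    by (rule mean_sum) (intro circ_fun_sum circ_fun_cmult circ_fun_mult circ_fun_echar g)
  also have "\<dots> = (\<Sum>a<M. \<Sum>b<M. mean (\<lambda>y. echar (int a - int b) x * (g y * echar (- (int a - int b)) y)))"
    by (intro sum.cong refl mean_sum circ_fun_cmult circ_fun_mult circ_fun_echar g)
  also have "\<dots> = (\<Sum>a<M. \<Sum>b<M. fcoeff g (int a - int b) * echar (int a - int b) x)"
    unfolding mean_cmult fcoeff_def by (simp add: mult.commute)
  finally have *: "fejer M g x = mean (\<lambda>y. g y * (D y * cnj (D y))) / of_nat M"
    by (simp add: fejer_def)
  have "cmod (mean (\<lambda>y. g y * (D y * cnj (D y)))) \<le> mean (\<lambda>y. cmod (g y * (D y * cnj (D y))))"
    by (rule norm_mean_le)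
  also have "\<dots> \<le> mean (\<lambda>y. C * (cmod (D y))\<^sup>2)"
    by (rule mean_mono)
       (auto simp: norm_mult power2_eq_square intro!: circ_fun_norm circ_fun_mult circ_fun_cnj circ_fun_const Dc g mult_right_mono C)
  also have "\<dots> = C * real M" by (simp only: mean_cmult PD)
  finally show ?thesis using M by (simp add: * norm_divide field_simps)
qed

section \<open>Outer damping factors\<close>

lemma fcoeff_cnj_real:
  assumes "\<And>x. g x = complex_of_real (q x)"
  shows "fcoeff g (- k) = cnj (fcoeff g k)"
proof -
  have "cnj (fcoeff g k) = mean (\<lambda>x. cnj (g x * echar (- k) x))"
    unfolding fcoeff_def by (rule mean_cnj[symmetric])
  also have "\<dots> = fcoeff g (- k)"
    unfolding fcoeff_def by (simp add: assms)
  finally show ?thesis by simp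
qed

text \<open>Keep the constant term and double the negative frequencies: since q is real, the
  discarded positive half is conjugate to the kept one. Doubling alone would give the factor 4 in
  the norm; only one of k and -k survives, and averaging the two forms of the norm brings it down to
  2.\<close>

lemma analytic_completion:
  assumes Q: "trigpoly UNIV Q" and q: "\<And>x. Q x = complex_of_real (q x)"
  obtains H where "trigpoly {..0} H" "\<And>x. Re (H x) = q x"
    "mean (\<lambda>x. (cmod (H x))\<^sup>2) \<le> 2 * mean (\<lambda>x. (q x)\<^sup>2)"
proof -
  define w :: "int \<Rightarrow> real" where "w k = (if k = 0 then 1 else if k < 0 then 2 else 0)" for k
  define H where "H x = (\<Sum>k\<in>spectrum Q. (of_real (w k) * fcoeff Q k) * echar k x)" for x
  have fin: "finite (spectrum Q)" by (rule trigpoly_spectrum[OF Q])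
  have sym: "uminus ` spectrum Q = spectrum Q"
  proof
    show 1: "uminus ` spectrum Q \<subseteq> spectrum Q"
      by (auto simp: spectrum_def fcoeff_cnj_real[OF q])
    then have "uminus ` (uminus ` spectrum Q) \<subseteq> uminus ` spectrum Q" by (rule image_mono)
    then show "spectrum Q \<subseteq> uminus ` spectrum Q" by (simp add: image_image)
  qed
  have reidx: "(\<Sum>k\<in>spectrum Q. f k) = (\<Sum>k\<in>spectrum Q. f (- k))" for f :: "int \<Rightarrow> 'b::comm_monoid_add"
    using sum.reindex[of uminus "spectrum Q" f] sym by simp
  have "H x = (\<Sum>k\<in>spectrum Q \<inter> {..0}. (of_real (w k) * fcoeff Q k) * echar k x)" for x
    unfolding H_def using fin by (intro sum.mono_neutral_right) (auto simp: w_def)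
  then have tH: "trigpoly {..0} H"
    using fin by (intro trigpolyI[of "spectrum Q \<inter> {..0}"]) auto
  have "H x + cnj (H x) = 2 * Q x" for x
  proof -
    have "cnj (H x) = (\<Sum>k\<in>spectrum Q. (of_real (w k) * cnj (fcoeff Q k)) * echar (- k) x)"
      by (simp add: H_def)
    also have "\<dots> = (\<Sum>k\<in>spectrum Q. (of_real (w (- k)) * fcoeff Q k) * echar k x)"
      by (subst reidx) (simp add: fcoeff_cnj_real[OF q])
    finally have "H x + cnj (H x) = (\<Sum>k\<in>spectrum Q. (of_real (w k + w (- k)) * fcoeff Q k) * echar k x)"
      by (simp add: H_def sum.distrib[symmetric] algebra_simps)
    also have "\<dots> = (\<Sum>k\<in>spectrum Q. 2 * (fcoeff Q k * echar k x))"
      by (intro sum.cong) (auto simp: w_def)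
    also have "\<dots> = 2 * Q x"
      using trigpoly_expand[OF Q fin, of x] by (simp add: sum_distrib_left)
    finally show ?thesis .
  qed
  then have "complex_of_real (2 * Re (H x)) = complex_of_real (2 * q x)" for x
    by (metis complex_add_cnj of_real_mult of_real_numeral q)
  then have re: "Re (H x) = q x" for x using of_real_eq_iff by fastforce
  have fcH: "fcoeff H k = of_real (w k) * fcoeff Q k" for k
  proof -
    have "fcoeff H k = (if k \<in> spectrum Q then of_real (w k) * fcoeff Q k else 0)"
      unfolding H_def by (rule fcoeff_trig_sum[OF fin])
    then show ?thesis by (auto simp: spectrum_def)
  qed
  have "mean (\<lambda>x. (cmod (H x))\<^sup>2) = (\<Sum>k\<in>spectrum H. (cmod (fcoeff H k))\<^sup>2)" by (rule parseval[OF tH])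
  also have "\<dots> = (\<Sum>k\<in>spectrum Q. (cmod (fcoeff H k))\<^sup>2)"
    using fin by (intro sum.mono_neutral_left) (auto simp: spectrum_def fcH)
  also have "\<dots> = (\<Sum>k\<in>spectrum Q. (w k)\<^sup>2 * (cmod (fcoeff Q k))\<^sup>2)"
    by (simp add: fcH norm_mult power_mult_distrib)
  finally have m: "mean (\<lambda>x. (cmod (H x))\<^sup>2) = (\<Sum>k\<in>spectrum Q. (w k)\<^sup>2 * (cmod (fcoeff Q k))\<^sup>2)" .
  also have "\<dots> = (\<Sum>k\<in>spectrum Q. (w (- k))\<^sup>2 * (cmod (fcoeff Q k))\<^sup>2)"
    by (subst reidx) (simp add: fcoeff_cnj_real[OF q])
  finally have m': "mean (\<lambda>x. (cmod (H x))\<^sup>2) = (\<Sum>k\<in>spectrum Q. (w (- k))\<^sup>2 * (cmod (fcoeff Q k))\<^sup>2)" .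
  have "2 * mean (\<lambda>x. (cmod (H x))\<^sup>2) = (\<Sum>k\<in>spectrum Q. ((w k)\<^sup>2 + (w (- k))\<^sup>2) * (cmod (fcoeff Q k))\<^sup>2)"
    using m m' by (simp add: distrib_right sum.distrib)
  also have "\<dots> \<le> (\<Sum>k\<in>spectrum Q. 4 * (cmod (fcoeff Q k))\<^sup>2)"
    by (intro sum_mono mult_right_mono) (auto simp: w_def)
  also have "\<dots> = 4 * mean (\<lambda>x. (cmod (Q x))\<^sup>2)" by (simp add: parseval[OF Q] sum_distrib_left)
  also have "\<dots> = 4 * mean (\<lambda>x. (q x)\<^sup>2)" by (simp add: q)
  finally show ?thesis using that[OF tH re] by simp
qed

text \<open>To be used at t = |f|^2, where it replaces |f| by a polynomial in f and its conjugate,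
  hence by a trigonometric polynomial. Aiming at sqrt t + \<delta>/2 with error \<delta>/4 leaves a
  margin above sqrt t that later absorbs a second-order term.\<close>

lemma sqrt_poly_approx:
  assumes "\<delta> > 0"
  obtains a :: "nat \<Rightarrow> real" and n where
    "\<And>t. 0 \<le> t \<Longrightarrow> t \<le> 1 \<Longrightarrow> sqrt t + \<delta> / 4 \<le> (\<Sum>i\<le>n. a i * t ^ i)"
    "\<And>t. 0 \<le> t \<Longrightarrow> t \<le> 1 \<Longrightarrow> (\<Sum>i\<le>n. a i * t ^ i) \<le> sqrt t + \<delta>"
proof -
  have "continuous_on {0..1::real} (\<lambda>t. sqrt t + \<delta> / 2)" by (intro continuous_intros)
  then obtain p where p: "real_polynomial_function p"
    and P: "\<And>t. t \<in> {0..1} \<Longrightarrow> \<bar>sqrt t + \<delta> / 2 - p t\<bar> < \<delta> / 4"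
    using Stone_Weierstrass_real_polynomial_function[of "{0..1}" "\<lambda>t. sqrt t + \<delta> / 2" "\<delta> / 4"] assms
    by auto
  obtain a n where "p = (\<lambda>t. \<Sum>i\<le>n. a i * t ^ i)"
    using p unfolding real_polynomial_function_iff_sum by blast
  moreover have "sqrt t + \<delta> / 4 \<le> p t \<and> p t \<le> sqrt t + \<delta>" if "0 \<le> t" "t \<le> 1" for t
  proof -
    have "\<bar>sqrt t + \<delta> / 2 - p t\<bar> < \<delta> / 4" using P that by simp
    then show ?thesis by linarith
  qed
  ultimately show ?thesis using that[of a n] by simp
qed

text \<open>The model is exp(-\<epsilon> H), where H has no positive frequencies and Re H is at
  least |f|: its modulus is exp(-\<epsilon> Re H). To remain a trigonometric polynomial it is
  replaced by (1 - \<epsilon> H / n)^n with n large.\<close>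

lemma damping_factor:
  assumes f: "trigpoly UNIV f" and f1: "\<And>x. cmod (f x) \<le> 1"
    and pos: "mean (\<lambda>x. (cmod (f x))\<^sup>2) > 0" and eps: "\<epsilon> > 0"
  obtains B where "trigpoly {..0} B" "\<And>x. cmod (B x) \<le> exp (- \<epsilon> * cmod (f x))"
    "mean (\<lambda>x. (cmod (B x - 1))\<^sup>2) \<le> 4 * \<epsilon>\<^sup>2 * mean (\<lambda>x. (cmod (f x))\<^sup>2)"
proof -
  define m where "m = mean (\<lambda>x. (cmod (f x))\<^sup>2)"
  \<comment> \<open>With \<delta> at most 1, (|f| + \<delta>)^2 is at most |f|^2 + 3 \<delta>; with
    3 \<delta> at most m its mean is at most 2 m.\<close>
  define \<delta> where "\<delta> = min 1 (m / 3)"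
  have m: "m > 0" using pos by (simp only: m_def)
  have \<delta>: "\<delta> > 0" "\<delta> \<le> 1" "3 * \<delta> \<le> m" using m by (auto simp: \<delta>_def)
  obtain a n where a: "\<And>t. 0 \<le> t \<Longrightarrow> t \<le> 1 \<Longrightarrow> sqrt t + \<delta> / 4 \<le> (\<Sum>i\<le>n. a i * t ^ i)"
    "\<And>t. 0 \<le> t \<Longrightarrow> t \<le> 1 \<Longrightarrow> (\<Sum>i\<le>n. a i * t ^ i) \<le> sqrt t + \<delta>"
    using sqrt_poly_approx[OF \<delta>(1)] by blast
  define q where "q x = (\<Sum>i\<le>n. a i * ((cmod (f x))\<^sup>2) ^ i)" for x
  define Q where "Q x = (\<Sum>i\<le>n. complex_of_real (a i) * (f x * cnj (f x)) ^ i)" for x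
  have Qq: "Q x = complex_of_real (q x)" for x
    unfolding Q_def q_def
    by (simp only: complex_norm_square[symmetric] of_real_sum of_real_mult of_real_power)
  have Q: "trigpoly UNIV Q"
    unfolding Q_def
    by (intro trigpoly_sum trigpoly_cmult trigpoly_power trigpoly_mult[OF f trigpoly_cnj[OF f]]) auto
  have t: "0 \<le> (cmod (f x))\<^sup>2" "(cmod (f x))\<^sup>2 \<le> 1" for x using f1[of x] by (auto simp: power_le_one)
  have q1: "cmod (f x) + \<delta> / 4 \<le> q x" and q2: "q x \<le> cmod (f x) + \<delta>" for x
    using a(1)[OF t[of x]] a(2)[OF t[of x]] by (simp_all add: q_def)
  obtain H where H: "trigpoly {..0} H" "\<And>x. Re (H x) = q x"
    and H2: "mean (\<lambda>x. (cmod (H x))\<^sup>2) \<le> 2 * mean (\<lambda>x. (q x)\<^sup>2)"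
    using analytic_completion[OF Q Qq] by metis
  have f_circ: "circ_fun f" and Hc: "circ_fun H" using f H trigpoly_circ_fun by auto
  have qc: "circ_fun q"
    unfolding q_def by (intro circ_fun_sum circ_fun_cmult circ_fun_power circ_fun_norm f_circ)
  have "mean (\<lambda>x. (q x)\<^sup>2) \<le> mean (\<lambda>x. (cmod (f x))\<^sup>2 + 3 * \<delta>)"
  proof (rule mean_mono)
    fix x
    have "(q x)\<^sup>2 \<le> (cmod (f x) + \<delta>)\<^sup>2"
      using q1[of x] q2[of x] \<delta> norm_ge_zero[of "f x"] by (intro power_mono) (linarith | simp)+
    also have "\<dots> = (cmod (f x))\<^sup>2 + (2 * cmod (f x) + \<delta>) * \<delta>"
      by (simp add: power2_eq_square algebra_simps)
    also have "\<dots> \<le> (cmod (f x))\<^sup>2 + 3 * \<delta>"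
      using f1[of x] \<delta> by (intro add_left_mono mult_right_mono) auto
    finally show "(q x)\<^sup>2 \<le> (cmod (f x))\<^sup>2 + 3 * \<delta>" .
  qed (intro circ_fun_power circ_fun_add circ_fun_norm circ_fun_const qc f_circ)+
  also have "\<dots> = m + 3 * \<delta>"
    unfolding m_def by (subst mean_add) (auto intro!: circ_fun_power circ_fun_norm f_circ)
  finally have q2m: "mean (\<lambda>x. (q x)\<^sup>2) \<le> 2 * m" using \<delta> by linarith
  obtain D where D: "D > 0" "\<And>x. cmod (H x) \<le> D" using circ_fun_bound[OF Hc] by metis
  \<comment> \<open>Large enough for the quadratic term (\<epsilon>/n)^2 D^2 of |W|^2 to be covered
    by the margin 2 (\<epsilon>/n) \<delta>/4 that q keeps above |f|.\<close>
  define n where "n = nat \<lceil>2 * \<epsilon> * D\<^sup>2 / \<delta>\<rceil> + 1"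
  have n: "n > 0" "2 * \<epsilon> * D\<^sup>2 / \<delta> \<le> real n" by (auto simp: n_def) linarith
  define W where "W x = 1 - complex_of_real (\<epsilon> / n) * H x" for x
  define B where "B x = W x ^ n" for x
  have gen: "(1 - c * a)\<^sup>2 + (c * b)\<^sup>2 = 1 - 2 * c * a + c\<^sup>2 * (a\<^sup>2 + b\<^sup>2)" for a b c :: real
    by (simp add: power2_eq_square algebra_simps)
  have W2: "(cmod (W x))\<^sup>2 \<le> 1 - 2 * \<epsilon> * cmod (f x) / n" for x
  proof -
    have "(cmod (W x))\<^sup>2 = (1 - \<epsilon> / n * Re (H x))\<^sup>2 + (\<epsilon> / n * Im (H x))\<^sup>2"
      by (simp add: cmod_power2 W_def)
    also have "\<dots> = 1 - 2 * (\<epsilon> / n) * q x + (\<epsilon> / n)\<^sup>2 * (cmod (H x))\<^sup>2"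
      unfolding cmod_power2 H(2) by (rule gen)
    also have "\<dots> \<le> 1 - 2 * (\<epsilon> / n) * (cmod (f x) + \<delta> / 4) + (\<epsilon> / n)\<^sup>2 * D\<^sup>2"
      using q1[of x] eps n D(2)[of x]
      by (intro add_mono diff_mono mult_left_mono power_mono) auto
    also have "(\<epsilon> / n)\<^sup>2 * D\<^sup>2 \<le> \<epsilon> / n * (\<delta> / 2)"
    proof -
      have "2 * \<epsilon> * D\<^sup>2 \<le> real n * \<delta>" using n(2) \<delta>(1) by (simp add: divide_le_eq)
      then have "\<epsilon> * D\<^sup>2 / n \<le> \<delta> / 2" using n by (simp add: field_simps)
      then have "\<epsilon> / n * (\<epsilon> * D\<^sup>2 / n) \<le> \<epsilon> / n * (\<delta> / 2)" using eps by (intro mult_left_mono) auto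
      then show ?thesis by (simp add: power2_eq_square)
    qed
    finally show ?thesis by (simp add: algebra_simps add_divide_distrib)
  qed
  have W1: "cmod (W x) \<le> 1" for x
  proof -
    have "(cmod (W x))\<^sup>2 \<le> 1" using W2[of x] eps by (smt (verit) divide_nonneg_nonneg mult_nonneg_nonneg norm_ge_zero of_nat_0_le_iff)
    then show ?thesis by (simp add: power_le_one_iff abs_square_le_1)
  qed
  have tW: "trigpoly {..0} W"
    unfolding W_def by (intro trigpoly_diff trigpoly_const trigpoly_cmult H) auto
  have tB: "trigpoly {..0} B"
    unfolding B_def by (rule trigpoly_power[OF tW]) auto
  have B1: "cmod (B x) \<le> exp (- \<epsilon> * cmod (f x))" for x
  proof -
    have "(cmod (B x))\<^sup>2 = ((cmod (W x))\<^sup>2) ^ n" by (simp add: B_def norm_power flip: power_mult) (simp add: mult.commute)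
    also have "\<dots> \<le> (1 - 2 * \<epsilon> * cmod (f x) / n) ^ n" using W2 by (intro power_mono) auto
    also have "\<dots> \<le> (exp (- (2 * \<epsilon> * cmod (f x) / n))) ^ n"
    proof (rule power_mono)
      show "1 - 2 * \<epsilon> * cmod (f x) / n \<le> exp (- (2 * \<epsilon> * cmod (f x) / n))"
        using exp_ge_add_one_self[of "- (2 * \<epsilon> * cmod (f x) / n)"] by simp
      show "0 \<le> 1 - 2 * \<epsilon> * cmod (f x) / n" using W2[of x] zero_le_power2[of "cmod (W x)"] by linarith
    qed
    also have "\<dots> = (exp (- \<epsilon> * cmod (f x)))\<^sup>2"
      using n by (simp flip: exp_of_nat_mult)
    finally show ?thesis by (rule power2_le_imp_le) simp
  qed
  have B2: "cmod (B x - 1) \<le> \<epsilon> * cmod (H x)" for x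
  proof -
    have "cmod (W x ^ n - 1 ^ n) \<le> n * cmod (W x - 1)"
      by (rule norm_power_diff) (use W1 in auto)
    also have "\<dots> = \<epsilon> * cmod (H x)" using n eps by (simp add: W_def norm_mult norm_divide)
    finally show ?thesis by (simp add: B_def)
  qed
  have "mean (\<lambda>x. (cmod (B x - 1))\<^sup>2) \<le> mean (\<lambda>x. \<epsilon>\<^sup>2 * (cmod (H x))\<^sup>2)"
  proof (rule mean_mono)
    show "(cmod (B x - 1))\<^sup>2 \<le> \<epsilon>\<^sup>2 * (cmod (H x))\<^sup>2" for x
      using power_mono[OF B2[of x], of 2] by (simp add: power_mult_distrib)
  qed (intro circ_fun_power circ_fun_norm circ_fun_cmult circ_fun_diff circ_fun_const Hc trigpoly_circ_fun[OF tB])+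
  also have "\<dots> = \<epsilon>\<^sup>2 * mean (\<lambda>x. (cmod (H x))\<^sup>2)" by (rule mean_cmult)
  also have "\<dots> \<le> \<epsilon>\<^sup>2 * (4 * m)" using H2 q2m by (intro mult_left_mono) auto
  finally show ?thesis using that[OF tB B1] by (simp add: m_def mult_ac)
qed

section \<open>A bounded test_fun function for Littlewood sums\<close>

lemma trigpoly_fejer_Int: "trigpoly K g \<Longrightarrow> trigpoly (K \<inter> {- int M<..<int M}) (fejer M g)"
  using trigpoly_fejer[of M g] unfolding trigpoly_def by (auto simp: spectrum_def fcoeff_fejer)

lemma mean_square_fejer_le:
  assumes g: "trigpoly K g" and M: "M > 0"
  shows "mean (\<lambda>x. (cmod (fejer M g x))\<^sup>2) \<le> mean (\<lambda>x. (cmod (g x))\<^sup>2)"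
proof -
  have "mean (\<lambda>x. (cmod (fejer M g x))\<^sup>2) = (\<Sum>k\<in>spectrum (fejer M g). (cmod (fcoeff (fejer M g) k))\<^sup>2)"
    by (rule parseval[OF trigpoly_fejer])
  also have "\<dots> \<le> (\<Sum>k\<in>spectrum (fejer M g). (cmod (fcoeff g k))\<^sup>2)"
    using fejer_weight_bounds[OF M]
    by (intro sum_mono power_mono) (auto simp: fcoeff_fejer norm_mult intro!: mult_left_le_one_le)
  also have "\<dots> \<le> mean (\<lambda>x. (cmod (g x))\<^sup>2)"
    by (rule bessel_trigpoly[OF g trigpoly_spectrum(1)[OF trigpoly_fejer]])
  finally show ?thesis .
qed

text \<open>The invariant of the recursion for the test function: damping a function bounded by 200
  makes room for a block of modulus t. With u = t/100 and e^{-u} \<le> 1 - u/2 the two sides balance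
  exactly, which is why 200 goes with the rate 1/100.\<close>

lemma exp_damping_bound:
  assumes "0 \<le> t" "t \<le> (1::real)" shows "200 * exp (- (1/100) * t) + t \<le> 200"
proof -
  define u where "u = t / 100"
  have u: "0 \<le> u" "u \<le> 1" using assms by (auto simp: u_def)
  have "exp (- u) \<le> 1 / (1 + u)"
    using exp_ge_add_one_self[of u] u by (simp add: exp_minus field_simps)
  also have "\<dots> \<le> 1 - u / 2"
  proof -
    have "u * u \<le> u" using u by (simp add: mult_left_le)
    then have "1 \<le> (1 - u / 2) * (1 + u)" by (simp add: algebra_simps)
    then show ?thesis using u by (simp add: divide_le_eq)
  qed
  finally show ?thesis by (simp add: u_def)
qed

text \<open>The McGehee-Pigno-Smith setting. Block i has 4^i coefficients of modulus 4^{-i}, hence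
  sup norm at most 1 and L^2 norm 2^{-i}. The condition \<open>4 * J \<le> P\<close> keeps the
  combined loss of the J Fejer means below 1/4.\<close>

locale signed_blocks =
  fixes T :: "nat \<Rightarrow> nat set" and \<sigma> :: "nat \<Rightarrow> complex" and J P :: nat
  assumes T_card: "i < J \<Longrightarrow> card (T i) = 4 ^ i"
    and T_less: "i < j \<Longrightarrow> j < J \<Longrightarrow> a \<in> T i \<Longrightarrow> b \<in> T j \<Longrightarrow> a < b"
    and T_pos: "i < J \<Longrightarrow> n \<in> T i \<Longrightarrow> 0 < n"
    and norm_sigma: "cmod (\<sigma> n) = 1"
    and P_ge: "4 * J \<le> P" and P_pos: "0 < P"
begin

definition block :: "nat \<Rightarrow> real \<Rightarrow> complex" where
  "block i x = (\<Sum>n\<in>T i. \<sigma> n / 4 ^ i * echar (int n) x)"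

definition block_max :: "nat \<Rightarrow> nat" where "block_max i = Max (T i)"

text \<open>A factor as in \<open>damping_factor\<close> at the rate 1/100; the last bound is 4 /
  100^2 times the mean square of the block.\<close>

definition damping :: "nat \<Rightarrow> real \<Rightarrow> complex" where
  "damping i = (SOME B. trigpoly {..0} B \<and> (\<forall>x. cmod (B x) \<le> exp (- (1/100) * cmod (block i x))) \<and>
     mean (\<lambda>x. (cmod (B x - 1))\<^sup>2) \<le> 4 / 10000 / 4 ^ i)"

text \<open>The spectrum of the damping factor may reach arbitrarily far to the left, hence the
  truncation. It is harmless where the coefficients matter: at a frequency n not beyond the current
  block the Fejer weight is at least 1 - 1/P.\<close>

primrec test_fun :: "nat \<Rightarrow> real \<Rightarrow> complex" where
  "test_fun 0 = (\<lambda>x. 0)"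
| "test_fun (Suc i) = fejer (P * block_max i) (\<lambda>x. test_fun i x * damping i x + block i x)"

text \<open>What step i adds to the Fejer mean of \<open>test_fun i\<close>. These pieces are small
  in L^2, of order 2^{-i}, and have spectrum bounded on both sides in terms of block i alone; the
  test function as a whole has neither property.\<close>

definition increment :: "nat \<Rightarrow> real \<Rightarrow> complex" where
  "increment i = fejer (P * block_max i) (\<lambda>x. test_fun i x * (damping i x - 1) + block i x)"

text \<open>The Fejer means taken after step i act on \<open>increment i\<close> as Fourier
  multipliers; this is their product.\<close>

definition tail_weight :: "nat \<Rightarrow> nat \<Rightarrow> int \<Rightarrow> real" where
  "tail_weight i j k = (\<Prod>t\<in>{i<..<j}. fejer_weight (P * block_max t) k)"

lemma T_fin: "i < J \<Longrightarrow> finite (T i)"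
  using T_card[of i] by (metis card.infinite power_eq_0_iff zero_neq_numeral)

lemma T_ne: "i < J \<Longrightarrow> T i \<noteq> {}"
  using T_card[of i] by (metis card.empty power_eq_0_iff zero_neq_numeral)

lemma block_max_in: "i < J \<Longrightarrow> block_max i \<in> T i"
  unfolding block_max_def by (rule Max_in[OF T_fin T_ne])

lemma le_block_max: "i < J \<Longrightarrow> n \<in> T i \<Longrightarrow> n \<le> block_max i"
  unfolding block_max_def by (rule Max_ge[OF T_fin])

lemma block_max_less: "i < j \<Longrightarrow> j < J \<Longrightarrow> n \<in> T j \<Longrightarrow> block_max i < n"
  using T_less[of i j "block_max i" n] block_max_in[of i] by simp

lemma block_max_mono: "i \<le> j \<Longrightarrow> j < J \<Longrightarrow> block_max i \<le> block_max j"
  using block_max_less[of i j "block_max j"] block_max_in[of j] by (cases "i = j") auto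

lemma ord_pos: "i < J \<Longrightarrow> 0 < P * block_max i"
  using T_pos[of i "block_max i"] block_max_in[of i] P_pos by simp

lemma sigma_nonzero: "\<sigma> n \<noteq> 0"
  using norm_sigma[of n] by (metis norm_zero zero_neq_one)

lemma fcoeff_block:
  assumes "i < J" shows "fcoeff (block i) k = (if k \<in> int ` T i then \<sigma> (nat k) / 4 ^ i else 0)"
proof -
  have "block i = (\<lambda>x. \<Sum>k\<in>int ` T i. \<sigma> (nat k) / 4 ^ i * echar k x)"
    by (auto simp: block_def sum.reindex)
  then show ?thesis using fcoeff_trig_sum[of "int ` T i" "\<lambda>k. \<sigma> (nat k) / 4 ^ i" k] T_fin[OF assms] by simp
qed

lemma trigpoly_block: "i < J \<Longrightarrow> trigpoly {..int (block_max i)} (block i)"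
  unfolding block_def by (intro trigpoly_sum trigpoly_cmult trigpoly_echar) (auto intro: le_block_max)

lemma norm_block: assumes "i < J" shows "cmod (block i x) \<le> 1"
proof -
  have "cmod (block i x) \<le> (\<Sum>n\<in>T i. cmod (\<sigma> n / 4 ^ i * echar (int n) x))"
    unfolding block_def by (rule norm_sum)
  also have "\<dots> = 1" using T_card[OF assms] by (simp add: norm_mult norm_divide norm_sigma norm_power)
  finally show ?thesis .
qed

lemma mean_square_block: assumes "i < J" shows "mean (\<lambda>x. (cmod (block i x))\<^sup>2) = 1 / 4 ^ i"
proof -
  have s: "spectrum (block i) = int ` T i"
    unfolding spectrum_def fcoeff_block[OF assms] using sigma_nonzero by auto
  have "mean (\<lambda>x. (cmod (block i x))\<^sup>2) = (\<Sum>k\<in>int ` T i. (cmod (fcoeff (block i) k))\<^sup>2)"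
    using parseval[OF trigpoly_block[OF assms]] s by simp
  also have "\<dots> = (\<Sum>k\<in>int ` T i. (1 / 4 ^ i)\<^sup>2)"
    by (intro sum.cong refl) (simp add: fcoeff_block[OF assms] norm_divide norm_sigma norm_power)
  also have "\<dots> = 1 / 4 ^ i"
    using T_card[OF assms] by (simp add: card_image power2_eq_square)
  finally show ?thesis .
qed

lemma damping_props:
  assumes "i < J"
  shows "trigpoly {..0} (damping i)" "cmod (damping i x) \<le> exp (- (1/100) * cmod (block i x))"
    "mean (\<lambda>x. (cmod (damping i x - 1))\<^sup>2) \<le> 4 / 10000 / 4 ^ i"
proof -
  have "\<exists>B. trigpoly {..0} B \<and> (\<forall>x. cmod (B x) \<le> exp (- (1/100) * cmod (block i x))) \<and>
     mean (\<lambda>x. (cmod (B x - 1))\<^sup>2) \<le> 4 / 10000 / 4 ^ i"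
  proof (rule damping_factor[of "block i" "1/100"])
    show "trigpoly UNIV (block i)" using trigpoly_block[OF assms] trigpoly_mono by blast
    fix B assume "trigpoly {..0} B" "\<And>x. cmod (B x) \<le> exp (- (1/100) * cmod (block i x))"
     "mean (\<lambda>x. (cmod (B x - 1))\<^sup>2) \<le> 4 * (1/100)\<^sup>2 * mean (\<lambda>x. (cmod (block i x))\<^sup>2)"
    then show ?thesis by (intro exI[of _ B]) (auto simp: mean_square_block[OF assms] power_divide)
  qed (use norm_block[OF assms] mean_square_block[OF assms] in auto)
  from someI_ex[OF this, folded damping_def]
  show "trigpoly {..0} (damping i)" "cmod (damping i x) \<le> exp (- (1/100) * cmod (block i x))"
    "mean (\<lambda>x. (cmod (damping i x - 1))\<^sup>2) \<le> 4 / 10000 / 4 ^ i" by auto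
qed

lemma trigpoly_step:
  assumes "i < J" "trigpoly {..int (block_max i)} g"
  shows "trigpoly {..int (block_max i)} (\<lambda>x. g x * damping i x + block i x)"
    "trigpoly {..int (block_max i)} (\<lambda>x. g x * (damping i x - 1) + block i x)"
proof -
  show "trigpoly {..int (block_max i)} (\<lambda>x. g x * damping i x + block i x)"
    by (intro trigpoly_add trigpoly_block[OF assms(1)] trigpoly_mult[OF assms(2) damping_props(1)[OF assms(1)]]) auto
  have "trigpoly {..0} (\<lambda>x. damping i x - 1)"
    by (intro trigpoly_diff trigpoly_const damping_props(1)[OF assms(1)]) auto
  then show "trigpoly {..int (block_max i)} (\<lambda>x. g x * (damping i x - 1) + block i x)"
    by (intro trigpoly_add trigpoly_block[OF assms(1)] trigpoly_mult[OF assms(2)]) auto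
qed

lemma trigpoly_test_fun:
  "i \<le> J \<Longrightarrow> trigpoly (if i = 0 then {} else {..int (block_max (i - 1))}) (test_fun i)"
proof (induction i)
  case 0
  then show ?case using trigpoly_zero by simp
next
  case (Suc i)
  have "trigpoly {..int (block_max i)} (test_fun i)"
    using Suc block_max_mono[of "i - 1" i] by (elim meta_impE) (auto elim!: trigpoly_mono split: if_splits)
  from trigpoly_fejer_Int[OF trigpoly_step(1)[OF _ this], of "P * block_max i"] Suc
  show ?case by (auto elim: trigpoly_mono)
qed

lemma trigpoly_test_fun': "i < J \<Longrightarrow> trigpoly {..int (block_max i)} (test_fun i)"
  using trigpoly_test_fun[of i] block_max_mono[of "i - 1" i] by (auto elim!: trigpoly_mono split: if_splits)

lemma trigpoly_increment: "i < J \<Longrightarrow> trigpoly {- int (P * block_max i)<..int (block_max i)} (increment i)"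
  unfolding increment_def
  by (rule trigpoly_mono[OF trigpoly_fejer_Int[OF trigpoly_step(2)[OF _ trigpoly_test_fun']]]) auto

lemma norm_test_fun: "i \<le> J \<Longrightarrow> cmod (test_fun i x) \<le> 200"
proof (induction i arbitrary: x)
  case 0
  then show ?case by simp
next
  case (Suc i)
  then have i: "i < J" by simp
  have "cmod (test_fun i y * damping i y + block i y) \<le> 200" for y
  proof -
    have "cmod (test_fun i y * damping i y + block i y) \<le> cmod (test_fun i y) * cmod (damping i y) + cmod (block i y)"
      by (metis norm_mult norm_triangle_ineq)
    also have "\<dots> \<le> 200 * exp (- (1/100) * cmod (block i y)) + cmod (block i y)"
      using Suc damping_props(2)[OF i] by (intro add_right_mono mult_mono) auto
    also have "\<dots> \<le> 200" by (rule exp_damping_bound) (use norm_block[OF i] in auto)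
    finally show ?thesis .
  qed
  then show ?case
    using trigpoly_circ_fun[OF trigpoly_step(1)[OF i trigpoly_test_fun'[OF i]]] ord_pos[OF i]
    by (auto intro!: norm_fejer_le)
qed

lemma circ_funs: "i < J \<Longrightarrow> circ_fun (test_fun i)" "i < J \<Longrightarrow> circ_fun (damping i)" "i < J \<Longrightarrow> circ_fun (block i)"
  using trigpoly_circ_fun trigpoly_test_fun' trigpoly_block damping_props(1) by blast+

section \<open>Size and spectrum of the increments\<close>

lemma mean_square_increment:
  assumes i: "i < J" shows "mean (\<lambda>x. (cmod (increment i x))\<^sup>2) \<le> 36 / 4 ^ i"
proof -
  note c = circ_funs[OF i]
  have "mean (\<lambda>x. (cmod (increment i x))\<^sup>2) \<le> mean (\<lambda>x. (cmod (test_fun i x * (damping i x - 1) + block i x))\<^sup>2)"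
    unfolding increment_def
    by (rule mean_square_fejer_le[OF trigpoly_step(2)[OF i trigpoly_test_fun'[OF i]] ord_pos[OF i]])
  also have "\<dots> \<le> mean (\<lambda>x. 80000 * (cmod (damping i x - 1))\<^sup>2 + 2 * (cmod (block i x))\<^sup>2)"
  proof (rule mean_mono)
    fix x
    have "(cmod (test_fun i x * (damping i x - 1) + block i x))\<^sup>2 \<le> (200 * cmod (damping i x - 1) + cmod (block i x))\<^sup>2"
    proof (rule power_mono)
      have "cmod (test_fun i x * (damping i x - 1) + block i x) \<le> cmod (test_fun i x) * cmod (damping i x - 1) + cmod (block i x)"
        by (metis norm_mult norm_triangle_ineq)
      also have "\<dots> \<le> 200 * cmod (damping i x - 1) + cmod (block i x)"
        using norm_test_fun[of i x] i by (intro add_right_mono mult_right_mono) auto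
      finally show "cmod (test_fun i x * (damping i x - 1) + block i x) \<le> 200 * cmod (damping i x - 1) + cmod (block i x)" .
    qed simp
    also have "\<dots> \<le> 2 * (200 * cmod (damping i x - 1))\<^sup>2 + 2 * (cmod (block i x))\<^sup>2"
      using sum_squares_bound[of "200 * cmod (damping i x - 1)" "cmod (block i x)"]
      by (simp add: power2_sum)
    finally show "(cmod (test_fun i x * (damping i x - 1) + block i x))\<^sup>2 \<le> 80000 * (cmod (damping i x - 1))\<^sup>2 + 2 * (cmod (block i x))\<^sup>2"
      by (simp add: power_mult_distrib)
  qed (intro circ_fun_power circ_fun_norm circ_fun_add circ_fun_cmult circ_fun_mult circ_fun_diff circ_fun_const c)+
  also have "\<dots> = 80000 * mean (\<lambda>x. (cmod (damping i x - 1))\<^sup>2) + 2 * mean (\<lambda>x. (cmod (block i x))\<^sup>2)"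
    by (subst mean_add) (simp_all only: mean_cmult circ_fun_power circ_fun_norm circ_fun_cmult circ_fun_diff circ_fun_const c)
  also have "\<dots> \<le> 80000 * (4 / 10000 / 4 ^ i) + 2 * (1 / 4 ^ i)"
    using damping_props(3)[OF i] mean_square_block[OF i] by simp
  \<comment> \<open>The constants add up to 32 + 2 = 34, rounded up to a square because the root 6
    enters the Cauchy-Schwarz estimates.\<close>
  also have "\<dots> \<le> 36 / 4 ^ i" by (simp add: field_simps)
  finally show ?thesis .
qed

lemma tail_weight_bounds: "j \<le> J \<Longrightarrow> 0 \<le> tail_weight i j k" "j \<le> J \<Longrightarrow> tail_weight i j k \<le> 1"
  unfolding tail_weight_def by (auto intro!: prod_nonneg prod_le_1 fejer_weight_bounds ord_pos)

lemma fcoeff_test_fun_Suc: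
  assumes i: "i < J"
  shows "fcoeff (test_fun (Suc i)) k = of_real (fejer_weight (P * block_max i) k) * fcoeff (test_fun i) k + fcoeff (increment i) k"
proof -
  note c = circ_funs[OF i]
  have "(\<lambda>x. test_fun i x * damping i x + block i x) = (\<lambda>x. test_fun i x + (test_fun i x * (damping i x - 1) + block i x))"
    by (simp add: algebra_simps)
  moreover have "fcoeff \<dots> k = fcoeff (test_fun i) k + fcoeff (\<lambda>x. test_fun i x * (damping i x - 1) + block i x) k"
    by (rule fcoeff_add) (intro circ_fun_add circ_fun_mult circ_fun_diff circ_fun_const c)+
  ultimately show ?thesis by (simp add: fcoeff_fejer increment_def distrib_left)
qed

lemma fcoeff_test_fun: "j \<le> J \<Longrightarrow> fcoeff (test_fun j) k = (\<Sum>i<j. of_real (tail_weight i j k) * fcoeff (increment i) k)"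
proof (induction j)
  case 0
  have "fcoeff (\<lambda>x. 0) k = 0" using fcoeff_trig_sum[of "{}" "\<lambda>_. 0" k] by simp
  then show ?case by simp
next
  case (Suc j)
  have "tail_weight i (Suc j) k = fejer_weight (P * block_max j) k * tail_weight i j k" if "i < j" for i
  proof -
    have "{i<..<Suc j} = insert j {i<..<j}" using that by auto
    then show ?thesis by (simp add: tail_weight_def)
  qed
  moreover have "tail_weight j (Suc j) k = 1"
  proof -
    have "{j<..<Suc j} = {}" by auto
    then show ?thesis by (simp only: tail_weight_def prod.empty)
  qed
  ultimately show ?case using Suc fcoeff_test_fun_Suc[of j k]
    by (simp add: sum_distrib_left mult.assoc)
qed

lemma fcoeff_increment_lower:
  assumes "i < l" "l < J" "n \<in> T l" shows "fcoeff (increment i) (int n) = 0"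
  by (rule trigpoly_fcoeff[OF trigpoly_increment]) (use assms block_max_less[OF assms] in auto)

lemma fcoeff_increment_expand:
  assumes i: "i < J"
  shows "fcoeff (increment i) k = of_real (fejer_weight (P * block_max i) k) *
    (fcoeff (\<lambda>x. test_fun i x * (damping i x - 1)) k + fcoeff (block i) k)"
proof -
  note c = circ_funs[OF i]
  show ?thesis unfolding increment_def fcoeff_fejer
    by (subst fcoeff_add) (intro refl circ_fun_mult circ_fun_diff circ_fun_const c)+
qed

text \<open>A factor with spectrum in \<open>{..0}\<close> never raises a frequency, so everything
  built in earlier steps stays below block l, and only the block itself contributes.\<close>

lemma fcoeff_increment_same:
  assumes l: "l < J" "n \<in> T l"
  shows "fcoeff (increment l) (int n) = of_real (fejer_weight (P * block_max l) (int n)) * (\<sigma> n / 4 ^ l)"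
proof -
  have "trigpoly {..<int n} (test_fun l)"
    using trigpoly_test_fun[of l] l block_max_less[of "l - 1" l n] by (auto elim!: trigpoly_mono split: if_splits)
  then have "trigpoly {..<int n} (\<lambda>x. test_fun l x * (damping l x - 1))"
    by (rule trigpoly_mult[OF _ trigpoly_diff[OF damping_props(1)[OF l(1)] trigpoly_const]]) auto
  then have "fcoeff (\<lambda>x. test_fun l x * (damping l x - 1)) (int n) = 0" by (rule trigpoly_fcoeff) auto
  then show ?thesis using l by (simp add: fcoeff_increment_expand fcoeff_block)
qed

text \<open>A later step disturbs the coefficient at n only by shifting frequencies k \<ge> n down
  to n, and these come from the increments j with l \<le> j < i. Cauchy-Schwarz bounds the share of
  each by 6 / 2^j times 2 / 100 / 2^i, and the geometric sum over j gives decay in both l and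
  i.\<close>

lemma fcoeff_increment_upper:
  assumes l: "l < i" "i < J" "n \<in> T l"
  shows "cmod (fcoeff (increment i) (int n)) \<le> 24 / 100 / 2 ^ l / 2 ^ i"
proof -
  define h where "h = (\<lambda>x. damping i x - 1)"
  have h: "trigpoly {..0} h"
    unfolding h_def by (rule trigpoly_diff[OF damping_props(1)[OF l(2)] trigpoly_const]) auto
  define F where "F = spectrum (test_fun i)"
  have t: "trigpoly UNIV (test_fun i)" using trigpoly_test_fun'[OF l(2)] trigpoly_mono by blast
  have F: "finite F" unfolding F_def by (rule trigpoly_spectrum(1)[OF t])
  have nT: "fcoeff (block i) (int n) = 0"
    using T_less[OF l(1,2,3), of n] l by (auto simp: fcoeff_block)
  have lJ: "l < J" using l by simp
  have "fcoeff (\<lambda>x. test_fun i x * h x) (int n) = (\<Sum>k\<in>F. fcoeff (test_fun i) k * fcoeff h (int n - k))"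
    unfolding F_def by (rule fcoeff_mult[OF t trigpoly_circ_fun[OF h]])
  also have "\<dots> = (\<Sum>k\<in>F. \<Sum>j<i. of_real (tail_weight j i k) * fcoeff (increment j) k * fcoeff h (int n - k))"
    using l by (simp add: fcoeff_test_fun sum_distrib_right)
  also have "\<dots> = (\<Sum>j<i. \<Sum>k\<in>F. of_real (tail_weight j i k) * fcoeff (increment j) k * fcoeff h (int n - k))"
    by (rule sum.swap)
  also have "\<dots> = (\<Sum>j\<in>{l..<i}. \<Sum>k\<in>F. of_real (tail_weight j i k) * fcoeff (increment j) k * fcoeff h (int n - k))"
  proof (rule sum.mono_neutral_right)
    show "\<forall>j\<in>{..<i} - {l..<i}. (\<Sum>k\<in>F. of_real (tail_weight j i k) * fcoeff (increment j) k * fcoeff h (int n - k)) = 0"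
    proof (intro ballI sum.neutral)
      fix j k assume j: "j \<in> {..<i} - {l..<i}"
      then have jl: "j < l" "j < J" using l by auto
      show "of_real (tail_weight j i k) * fcoeff (increment j) k * fcoeff h (int n - k) = 0"
      proof (cases "k \<ge> int n")
        case True
        then have "fcoeff (increment j) k = 0"
          using block_max_less[OF jl(1) lJ l(3)] by (intro trigpoly_fcoeff[OF trigpoly_increment[OF jl(2)]]) auto
        then show ?thesis by simp
      next
        case False
        then show ?thesis using trigpoly_fcoeff[OF h, of "int n - k"] by simp
      qed
    qed
  qed auto
  finally have eq: "fcoeff (\<lambda>x. test_fun i x * h x) (int n) =
    (\<Sum>j\<in>{l..<i}. \<Sum>k\<in>F. (of_real (tail_weight j i k) * fcoeff (increment j) k) * fcoeff h (int n - k))" .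
  have "cmod (fcoeff (\<lambda>x. test_fun i x * h x) (int n)) \<le>
    (\<Sum>j\<in>{l..<i}. cmod (\<Sum>k\<in>F. (of_real (tail_weight j i k) * fcoeff (increment j) k) * fcoeff h (int n - k)))"
    unfolding eq by (rule norm_sum)
  also have "\<dots> \<le> (\<Sum>j\<in>{l..<i}. 6 / 2 ^ j * (2 / 100 / 2 ^ i))"
  proof (rule sum_mono)
    fix j assume j: "j \<in> {l..<i}"
    then have jJ: "j < J" using l by auto
    have "cmod (\<Sum>k\<in>F. (of_real (tail_weight j i k) * fcoeff (increment j) k) * fcoeff h (int n - k)) \<le>
      sqrt (\<Sum>k\<in>F. (cmod (of_real (tail_weight j i k) * fcoeff (increment j) k))\<^sup>2) * sqrt (\<Sum>k\<in>F. (cmod (fcoeff h (int n - k)))\<^sup>2)"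
      by (rule norm_sum_mult_le)
    also have "\<dots> \<le> sqrt (36 / 4 ^ j) * sqrt (4 / 10000 / 4 ^ i)"
    proof (intro mult_mono real_sqrt_le_mono)
      have "(\<Sum>k\<in>F. (cmod (of_real (tail_weight j i k) * fcoeff (increment j) k))\<^sup>2) \<le> (\<Sum>k\<in>F. (cmod (fcoeff (increment j) k))\<^sup>2)"
        using tail_weight_bounds[of i j] l by (intro sum_mono power_mono) (auto simp: norm_mult intro!: mult_left_le_one_le)
      also have "\<dots> \<le> mean (\<lambda>x. (cmod (increment j x))\<^sup>2)" by (rule bessel_trigpoly[OF trigpoly_increment[OF jJ] F])
      finally show "(\<Sum>k\<in>F. (cmod (of_real (tail_weight j i k) * fcoeff (increment j) k))\<^sup>2) \<le> 36 / 4 ^ j"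
        using mean_square_increment[OF jJ] by linarith
      have "(\<Sum>k\<in>F. (cmod (fcoeff h (int n - k)))\<^sup>2) = (\<Sum>k\<in>(\<lambda>k. int n - k) ` F. (cmod (fcoeff h k))\<^sup>2)"
        by (subst sum.reindex) (auto simp: inj_on_def)
      also have "\<dots> \<le> mean (\<lambda>x. (cmod (h x))\<^sup>2)" by (rule bessel_trigpoly[OF h]) (use F in auto)
      finally show "(\<Sum>k\<in>F. (cmod (fcoeff h (int n - k)))\<^sup>2) \<le> 4 / 10000 / 4 ^ i"
        using damping_props(3)[OF l(2)] by (simp add: h_def)
    qed (auto intro!: sum_nonneg)
    also have "sqrt (36 / 4 ^ j) = 6 / 2 ^ j"
      by (rule real_sqrt_unique) (simp_all add: power_divide flip: power_mult, simp add: power_mult mult.commute[of j])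
    also have "sqrt (4 / 10000 / 4 ^ i) = 2 / 100 / 2 ^ i"
      by (rule real_sqrt_unique) (simp_all add: power_divide flip: power_mult, simp add: power_mult mult.commute[of i])
    finally show "cmod (\<Sum>k\<in>F. (of_real (tail_weight j i k) * fcoeff (increment j) k) * fcoeff h (int n - k)) \<le> 6 / 2 ^ j * (2 / 100 / 2 ^ i)" .
  qed
  also have "\<dots> = 12 / 100 / 2 ^ i * (\<Sum>j\<in>{l..<i}. 1 / 2 ^ j)"
    unfolding sum_distrib_left by (intro sum.cong refl) (simp add: mult_ac)
  also have "(\<Sum>j\<in>{l..<i}. 1 / 2 ^ j) \<le> 2 / (2::real) ^ l"
  proof -
    have "(\<Sum>j\<in>{l..<i}. 1 / (2::real) ^ j) = 2 / 2 ^ l - 2 / 2 ^ i" using l(1)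
    proof (induction i)
      case (Suc i)
      then show ?case by (cases "l = i") (auto simp: less_Suc_eq)
    qed simp
    then show ?thesis by simp
  qed
  finally have *: "cmod (fcoeff (\<lambda>x. test_fun i x * h x) (int n)) \<le> 24 / 100 / 2 ^ l / 2 ^ i"
    by (simp add: mult_left_mono field_simps)
  have "cmod (fcoeff (increment i) (int n)) \<le> cmod (fcoeff (\<lambda>x. test_fun i x * h x) (int n))"
    using fejer_weight_bounds(1,2)[OF ord_pos[OF l(2)]] nT
    by (simp add: fcoeff_increment_expand[OF l(2)] norm_mult h_def mult_left_le_one_le)
  then show ?thesis using * by linarith
qed

text \<open>In units of 4^{-l}: the Fejer weights keep at least 3/4 of the main term and the later
  corrections take away at most 24/100, leaving 51/100.\<close>

lemma Re_fcoeff_test_fun: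
  assumes l: "l < J" "n \<in> T l"
  shows "Re (\<sigma> n * cnj (fcoeff (test_fun J) (int n))) \<ge> 1 / 2 / 4 ^ l"
proof -
  define E where "E = (\<Sum>i\<in>{l<..<J}. of_real (tail_weight i J (int n)) * fcoeff (increment i) (int n))"
  define \<kappa> where "\<kappa> = tail_weight l J (int n) * fejer_weight (P * block_max l) (int n)"
  have "fcoeff (test_fun J) (int n) = (\<Sum>i\<in>{l..<J}. of_real (tail_weight i J (int n)) * fcoeff (increment i) (int n))"
    unfolding fcoeff_test_fun[OF order_refl]
    by (rule sum.mono_neutral_right) (auto simp: fcoeff_increment_lower[OF _ l])
  also have "{l..<J} = insert l {l<..<J}" using l by auto
  also have "(\<Sum>i\<in>insert l {l<..<J}. of_real (tail_weight i J (int n)) * fcoeff (increment i) (int n)) = of_real \<kappa> * (\<sigma> n / 4 ^ l) + E"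
    by (simp add: E_def \<kappa>_def fcoeff_increment_same[OF l])
  finally have eq: "fcoeff (test_fun J) (int n) = of_real \<kappa> * (\<sigma> n / 4 ^ l) + E" .
  have "cmod E \<le> (\<Sum>i\<in>{l<..<J}. cmod (of_real (tail_weight i J (int n)) * fcoeff (increment i) (int n)))"
    unfolding E_def by (rule norm_sum)
  also have "\<dots> \<le> (\<Sum>i\<in>{l<..<J}. 24 / 100 / 2 ^ l / 2 ^ i)"
  proof (rule sum_mono)
    fix i assume i: "i \<in> {l<..<J}"
    have "cmod (of_real (tail_weight i J (int n)) * fcoeff (increment i) (int n)) \<le> cmod (fcoeff (increment i) (int n))"
      using tail_weight_bounds[of J i "int n"] by (simp add: norm_mult mult_left_le_one_le)
    then show "cmod (of_real (tail_weight i J (int n)) * fcoeff (increment i) (int n)) \<le> 24 / 100 / 2 ^ l / 2 ^ i"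
      using fcoeff_increment_upper[of l i n] i l by auto
  qed
  also have "\<dots> = 24 / 100 / 2 ^ l * (\<Sum>i\<in>{l<..<J}. 1 / 2 ^ i)" by (simp add: sum_distrib_left)
  also have "\<dots> \<le> 24 / 100 / 2 ^ l * (1 / 2 ^ l)"
  proof (rule mult_left_mono)
    have "(\<Sum>i\<in>{l<..<J}. 1 / (2::real) ^ i) = 1 / 2 ^ l - 2 / 2 ^ J" using l(1)
    proof (induction J)
      case (Suc J)
      show ?case
      proof (cases "l = J")
        case False
        then have "{l<..<Suc J} = insert J {l<..<J}" using Suc by auto
        then show ?thesis using Suc False by (auto simp: less_Suc_eq)
      next
        case True
        then have "{l<..<Suc J} = {}" by auto
        then show ?thesis using True by (simp only: sum.empty) simp
      qed
    qed simp
    then show "(\<Sum>i\<in>{l<..<J}. 1 / (2::real) ^ i) \<le> 1 / 2 ^ l" by simp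
  qed simp
  also have "\<dots> = 24 / 100 / 4 ^ l" by (simp add: power_mult_distrib[symmetric])
  finally have E: "cmod E \<le> 24 / 100 / 4 ^ l" .
  \<comment> \<open>\<kappa> is the product of the J - l Fejer weights from step l on; each falls
    short of 1 by at most 1/P, and a product is at least 1 minus the sum of the shortfalls.\<close>
  have "\<kappa> = (\<Prod>t\<in>{l..<J}. fejer_weight (P * block_max t) (int n))"
  proof -
    have "{l..<J} = insert l {l<..<J}" using l by auto
    then show ?thesis by (simp add: \<kappa>_def tail_weight_def)
  qed
  also have "\<dots> = (\<Prod>t\<in>{l..<J}. 1 - (1 - fejer_weight (P * block_max t) (int n)))" by simp
  also have "\<dots> \<ge> 1 - (\<Sum>t\<in>{l..<J}. 1 - fejer_weight (P * block_max t) (int n))"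
    by (rule Weierstrass_prod_ineq) (use fejer_weight_bounds(1,2) ord_pos in auto)
  finally have "\<kappa> \<ge> 1 - (\<Sum>t\<in>{l..<J}. 1 - fejer_weight (P * block_max t) (int n))" .
  moreover have "(\<Sum>t\<in>{l..<J}. 1 - fejer_weight (P * block_max t) (int n)) \<le> (\<Sum>t\<in>{l..<J}. 1 / real P)"
  proof (rule sum_mono)
    fix t assume t: "t \<in> {l..<J}"
    then have "n \<le> block_max t" using le_block_max[OF l] block_max_mono[of l t] by auto
    then have "real n / real (P * block_max t) \<le> 1 / real P"
      using P_pos ord_pos[of t] t by (simp add: field_simps)
    then show "1 - fejer_weight (P * block_max t) (int n) \<le> 1 / real P"
      using fejer_weight_bounds(3)[OF ord_pos[of t], of "int n"] t by auto
  qed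
  moreover have "(\<Sum>t\<in>{l..<J}. 1 / real P) \<le> 1 / 4"
    using P_ge P_pos by (simp add: field_simps)
  ultimately have \<kappa>: "\<kappa> \<ge> 3 / 4" by linarith
  have "\<sigma> n * cnj (fcoeff (test_fun J) (int n)) = of_real (\<kappa> / 4 ^ l) * (\<sigma> n * cnj (\<sigma> n)) + \<sigma> n * cnj E"
    by (simp add: eq algebra_simps)
  also have "\<sigma> n * cnj (\<sigma> n) = 1" using norm_sigma[of n] by (simp flip: complex_norm_square)
  finally have "Re (\<sigma> n * cnj (fcoeff (test_fun J) (int n))) = \<kappa> / 4 ^ l + Re (\<sigma> n * cnj E)" by simp
  moreover have "\<bar>Re (\<sigma> n * cnj E)\<bar> \<le> cmod E"
    using abs_Re_le_cmod[of "\<sigma> n * cnj E"] by (simp add: norm_mult norm_sigma)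
  moreover have "\<kappa> / 4 ^ l \<ge> 3 / 4 / 4 ^ l" using \<kappa> by (intro divide_right_mono) auto
  ultimately have "Re (\<sigma> n * cnj (fcoeff (test_fun J) (int n))) \<ge> 3 / 4 / 4 ^ l - 24 / 100 / 4 ^ l" using E by linarith
  also have "3 / 4 / 4 ^ l - 24 / 100 / 4 ^ l = 51 / 100 / (4::real) ^ l" by (simp add: field_simps)
  moreover have "51 / 100 / (4::real) ^ l \<ge> 1 / 2 / 4 ^ l" by (intro divide_right_mono) auto
  ultimately show ?thesis by linarith
qed

text \<open>The point of the truncation: for n beyond block i, positive multiples of n lie to the
  right of the spectrum, and multiples by less than -P lie to its left.\<close>

lemma fcoeff_increment_mult_zero:
  assumes i: "i < J" and n: "int (block_max i) < int n" and k: "int n dvd k" "k \<noteq> 0"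
    and m: "k div int n > 0 \<or> \<bar>k div int n\<bar> > int P"
  shows "fcoeff (increment i) k = 0"
proof (rule trigpoly_fcoeff[OF trigpoly_increment[OF i]])
  obtain m where km: "k = int n * m" using k(1) by (elim dvdE)
  have n0: "int n > 0" using n by linarith
  then have kd: "k div int n = m" by (simp add: km)
  show "k \<notin> {- int (P * block_max i)<..int (block_max i)}"
  proof (cases "m > 0")
    case True
    then have "int n * 1 \<le> k" unfolding km using n0 by (intro mult_left_mono) auto
    then have "int (block_max i) < k" using n by linarith
    then show ?thesis by simp
  next
    case False
    then have "m < - int P" using m kd by auto
    then have "int n * m \<le> int n * (- int P)" using n0 by (intro mult_left_mono) auto
    also have "\<dots> \<le> int (block_max i) * (- int P)" using n by (intro mult_right_mono_neg) auto
    finally show ?thesis using km by (simp add: mult.commute)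
  qed
qed

text \<open>Duality with \<open>test_fun J\<close>, which is bounded by 200: every block contributes
  at least 1/2 and the tail costs at most 1/4 per step, whence 800 = 4 * 200. At step i only the n
  in the blocks up to i are felt, and their tail has L^2 size at most 2^i / 24, where 24 is chosen
  so that the product with 6 / 2^i is 1/4.\<close>

theorem mean_norm_ge_blocks:
  fixes w :: "real \<Rightarrow> complex" and \<phi> :: "int \<Rightarrow> complex" and S :: "nat set"
  assumes J: "J > 0" and S: "finite S" "0 \<notin> S" "\<And>i. i < J \<Longrightarrow> T i \<subseteq> S"
    and beyond: "\<And>n i. n \<in> S \<Longrightarrow> n \<notin> (\<Union>i<J. T i) \<Longrightarrow> i < J \<Longrightarrow> block_max i < n"
    and phi: "\<phi> 1 = 1" "\<And>m. m \<noteq> 1 \<Longrightarrow> \<phi> m \<noteq> 0 \<Longrightarrow> \<bar>m\<bar> > int P"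
    and w: "circ_fun w" "\<And>k. fcoeff w k = (\<Sum>n\<in>S. if int n dvd k then \<sigma> n * \<phi> (k div int n) else 0)"
    and tail: "\<And>i K. i < J \<Longrightarrow> finite K \<Longrightarrow>
      (\<Sum>k\<in>K. (cmod (\<Sum>n\<in>(\<Union>j\<le>i. T j). if int n dvd k \<and> k \<noteq> int n then \<sigma> n * \<phi> (k div int n) else 0))\<^sup>2) \<le> 4 ^ i / 576"
  shows "real J \<le> 800 * mean (\<lambda>x. cmod (w x))"
proof -
  \<comment> \<open>What n contributes to the coefficient at k besides its own frequency k =
    n.\<close>
  define c where "c n k = (if int n dvd k \<and> k \<noteq> int n then \<sigma> n * \<phi> (k div int n) else 0)" for n k
  define \<Phi> where "\<Phi> = test_fun J"
  have tPhi: "trigpoly UNIV \<Phi>" using trigpoly_test_fun[of J] trigpoly_mono unfolding \<Phi>_def by blast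
  define F where "F = spectrum \<Phi> \<union> int ` S"
  have F: "finite F" using S trigpoly_spectrum(1)[OF tPhi] by (simp add: F_def)
  \<comment> \<open>S may contain elements to the right of all blocks; the spectrum of the test
    function ends at the last block and does not see them.\<close>
  have top0: "fcoeff \<Phi> (int n) = 0" if "n \<in> S" "n \<notin> (\<Union>i<J. T i)" for n
    unfolding \<Phi>_def using trigpoly_test_fun[of J] J beyond[OF that, of "J - 1"]
    by (intro trigpoly_fcoeff[of "{..int (block_max (J - 1))}"]) auto
  have "mean (\<lambda>x. w x * cnj (\<Phi> x)) = (\<Sum>k\<in>spectrum \<Phi>. fcoeff w k * cnj (fcoeff \<Phi> k))"
    by (rule mean_mult_cnj[OF tPhi w(1)])
  also have "\<dots> = (\<Sum>k\<in>F. fcoeff w k * cnj (fcoeff \<Phi> k))"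
    using F by (intro sum.mono_neutral_left) (auto simp: F_def spectrum_def)
  also have "\<dots> = (\<Sum>k\<in>F. (\<Sum>n\<in>S. if k = int n then \<sigma> n else 0) * cnj (fcoeff \<Phi> k) + (\<Sum>n\<in>S. c n k) * cnj (fcoeff \<Phi> k))"
  proof (intro sum.cong refl)
    fix k
    have "fcoeff w k = (\<Sum>n\<in>S. (if k = int n then \<sigma> n else 0) + c n k)"
      unfolding w(2)
    proof (intro sum.cong refl)
      fix n assume "n \<in> S"
      then have "n > 0" using S(2) by (cases n) auto
      then show "(if int n dvd k then \<sigma> n * \<phi> (k div int n) else 0) = (if k = int n then \<sigma> n else 0) + c n k"
        by (auto simp: c_def phi)
    qed
    then show "fcoeff w k * cnj (fcoeff \<Phi> k) = (\<Sum>n\<in>S. if k = int n then \<sigma> n else 0) * cnj (fcoeff \<Phi> k) + (\<Sum>n\<in>S. c n k) * cnj (fcoeff \<Phi> k)"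
      by (simp add: sum.distrib distrib_right)
  qed
  also have "\<dots> = (\<Sum>k\<in>F. (\<Sum>n\<in>S. if k = int n then \<sigma> n else 0) * cnj (fcoeff \<Phi> k)) + (\<Sum>k\<in>F. (\<Sum>n\<in>S. c n k) * cnj (fcoeff \<Phi> k))"
    by (rule sum.distrib)
  also have "(\<Sum>k\<in>F. (\<Sum>n\<in>S. if k = int n then \<sigma> n else 0) * cnj (fcoeff \<Phi> k)) = (\<Sum>n\<in>S. \<sigma> n * cnj (fcoeff \<Phi> (int n)))"
  proof -
    have "(\<Sum>k\<in>F. (\<Sum>n\<in>S. if k = int n then \<sigma> n else 0) * cnj (fcoeff \<Phi> k)) =
       (\<Sum>n\<in>S. \<Sum>k\<in>F. if k = int n then \<sigma> n * cnj (fcoeff \<Phi> k) else 0)"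
      unfolding sum_distrib_right by (subst sum.swap) (intro sum.cong refl, simp)
    also have "\<dots> = (\<Sum>n\<in>S. \<sigma> n * cnj (fcoeff \<Phi> (int n)))"
      using F by (intro sum.cong refl) (simp add: F_def)
    finally show ?thesis .
  qed
  finally have eq: "mean (\<lambda>x. w x * cnj (\<Phi> x)) = (\<Sum>n\<in>S. \<sigma> n * cnj (fcoeff \<Phi> (int n))) + (\<Sum>k\<in>F. (\<Sum>n\<in>S. c n k) * cnj (fcoeff \<Phi> k))" .

  have "(\<Sum>n\<in>S. \<sigma> n * cnj (fcoeff \<Phi> (int n))) = (\<Sum>n\<in>(\<Union>i<J. T i). \<sigma> n * cnj (fcoeff \<Phi> (int n)))"
    by (rule sum.mono_neutral_right) (use S top0 in auto)
  also have "\<dots> = (\<Sum>i<J. \<Sum>n\<in>T i. \<sigma> n * cnj (fcoeff \<Phi> (int n)))"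
  proof (rule sum.UNION_disjoint)
    show "\<forall>i\<in>{..<J}. \<forall>j\<in>{..<J}. i \<noteq> j \<longrightarrow> T i \<inter> T j = {}"
      using T_less by (metis (no_types, lifting) disjoint_iff lessThan_iff less_irrefl nat_neq_iff)
  qed (use T_fin in auto)
  finally have "Re (\<Sum>n\<in>S. \<sigma> n * cnj (fcoeff \<Phi> (int n))) = (\<Sum>i<J. \<Sum>n\<in>T i. Re (\<sigma> n * cnj (fcoeff \<Phi> (int n))))"
    by (simp only: Re_sum)
  also have "\<dots> \<ge> (\<Sum>i<J. \<Sum>n\<in>T i. 1 / 2 / 4 ^ i)"
    unfolding \<Phi>_def by (intro sum_mono Re_fcoeff_test_fun) auto
  also have "(\<Sum>i<J. \<Sum>n\<in>T i. 1 / 2 / (4::real) ^ i) = (\<Sum>i<J. 1 / 2)"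
    by (intro sum.cong refl) (simp add: T_card)
  finally have main: "Re (\<Sum>n\<in>S. \<sigma> n * cnj (fcoeff \<Phi> (int n))) \<ge> real J / 2" by simp

  \<comment> \<open>For n beyond block i an off-diagonal frequency k = n m has |m| > P, hence lies
    outside the spectrum of this increment.\<close>
  have cz: "c n k * cnj (fcoeff (increment i) k) = 0" if i: "i < J" and n: "n \<in> S" "n \<notin> (\<Union>j\<le>i. T j)" for i n k
  proof (cases "c n k = 0")
    case False
    have nt: "block_max i < n"
    proof (cases "n \<in> (\<Union>j<J. T j)")
      case True
      then obtain j where j: "j < J" "n \<in> T j" by auto
      then have "i < j" using n by (metis UN_I atMost_iff not_less)
      then show ?thesis using block_max_less j by auto
    next
      case False
      then show ?thesis using beyond n i by auto
    qed
    then have n0: "n > 0" by simp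
    from False have c: "int n dvd k" "k \<noteq> int n" "\<phi> (k div int n) \<noteq> 0" by (auto simp: c_def split: if_splits)
    then have "k div int n \<noteq> 1" using n0 by (auto elim!: dvdE)
    then have P: "\<bar>k div int n\<bar> > int P" using phi c by blast
    then have "k \<noteq> 0" by auto
    then have "fcoeff (increment i) k = 0" using fcoeff_increment_mult_zero[OF i, of n k] nt c P by auto
    then show ?thesis by simp
  qed simp
  have "(\<Sum>k\<in>F. (\<Sum>n\<in>S. c n k) * cnj (fcoeff \<Phi> k)) =
    (\<Sum>k\<in>F. \<Sum>i<J. (\<Sum>n\<in>S. c n k * cnj (fcoeff (increment i) k)) * of_real (tail_weight i J k))"
    unfolding \<Phi>_def fcoeff_test_fun[OF order_refl]
    by (intro sum.cong refl) (simp add: sum_distrib_left sum_distrib_right mult_ac)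
  also have "\<dots> = (\<Sum>k\<in>F. \<Sum>i<J. (\<Sum>n\<in>(\<Union>j\<le>i. T j). c n k * cnj (fcoeff (increment i) k)) * of_real (tail_weight i J k))"
  proof (intro sum.cong refl)
    fix k i assume "i \<in> {..<J}"
    then have i: "i < J" by simp
    have sub: "(\<Union>j\<le>i. T j) \<subseteq> S"
    proof (rule UN_least)
      fix j assume "j \<in> {..i}"
      then have "j < J" using i by simp
      then show "T j \<subseteq> S" by (rule S(3))
    qed
    have "(\<Sum>n\<in>S. c n k * cnj (fcoeff (increment i) k)) = (\<Sum>n\<in>(\<Union>j\<le>i. T j). c n k * cnj (fcoeff (increment i) k))"
      by (rule sum.mono_neutral_right[OF S(1) sub]) (use cz[OF i] in blast)
    then show "(\<Sum>n\<in>S. c n k * cnj (fcoeff (increment i) k)) * of_real (tail_weight i J k) =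
      (\<Sum>n\<in>(\<Union>j\<le>i. T j). c n k * cnj (fcoeff (increment i) k)) * of_real (tail_weight i J k)" by (simp only:)
  qed
  also have "\<dots> = (\<Sum>i<J. \<Sum>k\<in>F. (\<Sum>n\<in>(\<Union>j\<le>i. T j). c n k) * (cnj (fcoeff (increment i) k) * of_real (tail_weight i J k)))"
    by (subst sum.swap) (simp add: sum_distrib_right mult.assoc)
  finally have tl: "(\<Sum>k\<in>F. (\<Sum>n\<in>S. c n k) * cnj (fcoeff \<Phi> k)) =
    (\<Sum>i<J. \<Sum>k\<in>F. (\<Sum>n\<in>(\<Union>j\<le>i. T j). c n k) * (cnj (fcoeff (increment i) k) * of_real (tail_weight i J k)))" .
  have "cmod (\<Sum>k\<in>F. (\<Sum>n\<in>S. c n k) * cnj (fcoeff \<Phi> k)) \<le>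
    (\<Sum>i<J. cmod (\<Sum>k\<in>F. (\<Sum>n\<in>(\<Union>j\<le>i. T j). c n k) * (cnj (fcoeff (increment i) k) * of_real (tail_weight i J k))))"
    unfolding tl by (rule norm_sum)
  also have "\<dots> \<le> (\<Sum>i<J. 1 / 4)"
  proof (rule sum_mono)
    fix i assume "i \<in> {..<J}"
    then have i: "i < J" by simp
    have "cmod (\<Sum>k\<in>F. (\<Sum>n\<in>(\<Union>j\<le>i. T j). c n k) * (cnj (fcoeff (increment i) k) * of_real (tail_weight i J k)))
      \<le> sqrt (\<Sum>k\<in>F. (cmod (\<Sum>n\<in>(\<Union>j\<le>i. T j). c n k))\<^sup>2) * sqrt (\<Sum>k\<in>F. (cmod (cnj (fcoeff (increment i) k) * of_real (tail_weight i J k)))\<^sup>2)"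
      by (rule norm_sum_mult_le)
    also have "\<dots> \<le> sqrt (4 ^ i / 576) * sqrt (36 / 4 ^ i)"
    proof (intro mult_mono real_sqrt_le_mono)
      show "(\<Sum>k\<in>F. (cmod (\<Sum>n\<in>(\<Union>j\<le>i. T j). c n k))\<^sup>2) \<le> 4 ^ i / 576"
        using tail[OF i F] by (simp only: c_def)
      have "(\<Sum>k\<in>F. (cmod (cnj (fcoeff (increment i) k) * of_real (tail_weight i J k)))\<^sup>2) \<le> (\<Sum>k\<in>F. (cmod (fcoeff (increment i) k))\<^sup>2)"
        using tail_weight_bounds[of J i] by (intro sum_mono power_mono) (auto simp: norm_mult intro!: mult_right_le_one_le)
      also have "\<dots> \<le> mean (\<lambda>x. (cmod (increment i x))\<^sup>2)" by (rule bessel_trigpoly[OF trigpoly_increment[OF i] F])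
      finally show "(\<Sum>k\<in>F. (cmod (cnj (fcoeff (increment i) k) * of_real (tail_weight i J k)))\<^sup>2) \<le> 36 / 4 ^ i"
        using mean_square_increment[OF i] by linarith
    qed (auto intro!: sum_nonneg)
    also have "\<dots> = sqrt ((4 ^ i / 576) * (36 / 4 ^ i))" by (rule real_sqrt_mult[symmetric])
    also have "(4 ^ i / 576) * (36 / 4 ^ i) = ((1 / 4)\<^sup>2 :: real)" by (simp add: power2_eq_square)
    also have "sqrt ((1 / 4)\<^sup>2 :: real) = 1 / 4" by (rule real_sqrt_abs[THEN trans]) simp
    finally show "cmod (\<Sum>k\<in>F. (\<Sum>n\<in>(\<Union>j\<le>i. T j). c n k) * (cnj (fcoeff (increment i) k) * of_real (tail_weight i J k))) \<le> 1 / 4" .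
  qed
  finally have tail': "cmod (\<Sum>k\<in>F. (\<Sum>n\<in>S. c n k) * cnj (fcoeff \<Phi> k)) \<le> real J / 4" by simp

  have "Re (mean (\<lambda>x. w x * cnj (\<Phi> x))) \<ge> real J / 4"
    using eq main tail' abs_Re_le_cmod[of "\<Sum>k\<in>F. (\<Sum>n\<in>S. c n k) * cnj (fcoeff \<Phi> k)"]
    by (simp only: plus_complex.sel)
  moreover have "Re (mean (\<lambda>x. w x * cnj (\<Phi> x))) \<le> mean (\<lambda>x. cmod (w x * cnj (\<Phi> x)))"
    using complex_Re_le_cmod norm_mean_le order_trans by blast
  moreover have "mean (\<lambda>x. cmod (w x * cnj (\<Phi> x))) \<le> mean (\<lambda>x. 200 * cmod (w x))"
  proof (rule mean_mono)
    show "cmod (w x * cnj (\<Phi> x)) \<le> 200 * cmod (w x)" for x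
      using mult_left_mono[OF norm_test_fun[of J x], of "cmod (w x)"] by (simp add: \<Phi>_def norm_mult mult.commute)
  qed (intro circ_fun_norm circ_fun_mult circ_fun_cmult circ_fun_cnj w(1) trigpoly_circ_fun[OF tPhi])+
  ultimately show ?thesis by (simp add: mean_cmult)
qed

end

section \<open>Convolution with rough numbers\<close>

text \<open>Evaluating \<open>\<Sum>\<^sub>p v\<^sub>p(n) X\<^sup>p\<close> at a generic integer linearises multiplication on a finite set.\<close>

lemma completely_additive_injection:
  fixes U :: "nat set"
  assumes "finite U" "0 \<notin> U"
  obtains \<theta> :: "nat \<Rightarrow> int" where "\<And>a b. a > 0 \<Longrightarrow> b > 0 \<Longrightarrow> \<theta> (a * b) = \<theta> a + \<theta> b" "inj_on \<theta> U"
proof -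
  define \<Theta> :: "nat \<Rightarrow> int poly" where "\<Theta> n = (\<Sum>p\<in>#prime_factorization n. monom 1 p)" for n
  have add: "\<Theta> (a * b) = \<Theta> a + \<Theta> b" if "a > 0" "b > 0" for a b
    using that by (simp add: \<Theta>_def prime_factorization_mult)
  have coeff: "coeff (\<Sum>p\<in>#M. monom (1::int) p) i = of_nat (count M i)" for M i
    by (induction M) auto
  have inj: "a = b" if "\<Theta> a = \<Theta> b" "a > 0" "b > 0" for a b
  proof -
    have "int (count (prime_factorization a) i) = int (count (prime_factorization b) i)" for i
      using that(1) coeff[of "prime_factorization a" i] coeff[of "prime_factorization b" i] by (simp add: \<Theta>_def)
    then have "prime_factorization a = prime_factorization b" by (intro multiset_eqI) simp
    then show ?thesis using prime_factorization_unique[of a b] that by simp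
  qed
  define bad where "bad = (\<Union>(a, b)\<in>{(a, b). a \<in> U \<and> b \<in> U \<and> a \<noteq> b}. {x. poly (\<Theta> a - \<Theta> b) x = 0})"
  have "finite {(a, b). a \<in> U \<and> b \<in> U \<and> a \<noteq> b}"
    by (rule finite_subset[of _ "U \<times> U"]) (use assms in auto)
  moreover have "finite {x. poly (\<Theta> a - \<Theta> b) x = 0}" if "a \<in> U" "b \<in> U" "a \<noteq> b" for a b
    using inj[of a b] that assms by (intro poly_roots_finite) (auto intro: gr0I)
  ultimately have "finite bad" unfolding bad_def by (intro finite_UN_I) auto
  then obtain x where x: "x \<notin> bad" using ex_new_if_finite[OF infinite_UNIV_int] by blast
  show ?thesis
  proof (rule that[of "\<lambda>n. poly (\<Theta> n) x"])
    show "inj_on (\<lambda>n. poly (\<Theta> n) x) U"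
      using x by (auto simp: inj_on_def bad_def)
  qed (simp add: add)
qed

text \<open>Take a prime p dividing k. It divides some entry of the list, so each list for k arises
  from a list for k/p by multiplying one of the q entries by p.\<close>

lemma card_ordered_factorizations:
  fixes k q :: nat
  assumes "k > 0"
  shows "finite {xs. length xs = q \<and> prod_list xs = k} \<and>
    card {xs. length xs = q \<and> prod_list xs = k} \<le> q ^ size (prime_factorization k)"
  using assms
proof (induction k rule: less_induct)
  case (less k)
  let ?L = "\<lambda>k. {xs :: nat list. length xs = q \<and> prod_list xs = k}"
  show ?case
  proof (cases "k = 1")
    case True
    have all1: "prod_list ys = 1 \<Longrightarrow> \<forall>x\<in>set ys. x = (1::nat)" for ys by (induction ys) auto
    have sub: "?L 1 \<subseteq> {replicate q 1}"
    proof
      fix xs assume "xs \<in> ?L 1"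
      then have "length xs = q" "\<forall>x\<in>set xs. x = 1" using all1[of xs] by simp_all
      then show "xs \<in> {replicate q 1}" by (simp add: replicate_eqI)
    qed
    have "finite (?L 1)" by (rule finite_subset[OF sub]) simp
    moreover have "card (?L 1) \<le> 1" using card_mono[OF _ sub] by simp
    ultimately show ?thesis unfolding True by (simp only: prime_factorization_1 size_empty power_0 simp_thms)
  next
    case False
    then obtain p where p: "prime p" "p dvd k" using prime_factor_nat by blast
    then obtain m where m: "k = p * m" by (elim dvdE)
    have m0: "m > 0" "m < k" using less.prems p m prime_gt_1_nat[of p] by (auto intro: gr0I)
    note IH = less.IH[OF m0(2,1)]
    let ?f = "\<lambda>(xs, i). xs[i := p * (xs ! i)]"
    have upd: "prod_list (zs[i := p * (zs ! i)]) = p * prod_list zs" if "i < length zs" for i zs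
      using that
    proof (induction zs arbitrary: i)
      case (Cons z zs)
      then show ?case by (cases i) auto
    qed simp
    have sub: "?L k \<subseteq> ?f ` (?L m \<times> {..<q})"
    proof
      fix ys assume ys: "ys \<in> ?L k"
      then have "p dvd prod_list ys" using p by simp
      then have "\<exists>y\<in>set ys. p dvd y" using p(1)
        by (induction ys) (auto simp: prime_dvd_mult_iff)
      then obtain i where i: "i < q" "p dvd ys ! i" using ys by (auto simp: in_set_conv_nth)
      define xs where "xs = ys[i := ys ! i div p]"
      have yi: "ys ! i = p * (ys ! i div p)" using i by simp
      have "xs[i := p * (xs ! i)] = ys" using i ys yi by (simp add: xs_def)
      moreover have "p * prod_list xs = prod_list (xs[i := p * (xs ! i)])"
        using upd[of i xs] i ys by (simp add: xs_def)
      ultimately have "?f (xs, i) = ys" "xs \<in> ?L m" using ys m p prime_gt_0_nat[of p] by (auto simp: xs_def)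
      then show "ys \<in> ?f ` (?L m \<times> {..<q})" using i by (intro image_eqI[of _ _ "(xs, i)"]) auto
    qed
    have fin: "finite (?L m \<times> {..<q})" using IH by simp
    then have 1: "finite (?L k)" using sub finite_surj by blast
    have "card (?L k) \<le> card (?L m) * q"
      using surj_card_le[OF fin sub] by (simp add: card_cartesian_product)
    also have "\<dots> \<le> q ^ size (prime_factorization m) * q" using IH by simp
    also have "\<dots> = q ^ size (prime_factorization k)"
      using p m m0 by (simp add: prime_factorization_mult prime_factorization_prime)
    finally show ?thesis using 1 by simp
  qed
qed

lemma power_sum_lists:
  fixes f :: "'i \<Rightarrow> 'b::comm_semiring_1"
  assumes "finite M"
  shows "(\<Sum>m\<in>M. f m) ^ q = (\<Sum>xs\<in>{xs. set xs \<subseteq> M \<and> length xs = q}. prod_list (map f xs))"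
proof (induction q)
  case 0
  have "{xs. set xs \<subseteq> M \<and> length xs = 0} = {[]}" by auto
  then show ?case by simp
next
  case (Suc q)
  let ?L = "{xs. set xs \<subseteq> M \<and> length xs = q}"
  have *: "{xs. set xs \<subseteq> M \<and> length xs = Suc q} = (\<lambda>(x, xs). x # xs) ` (M \<times> ?L)"
    by (auto simp: length_Suc_conv image_iff)
  have "(\<Sum>m\<in>M. f m) ^ Suc q = (\<Sum>(x, xs)\<in>M \<times> ?L. f x * prod_list (map f xs))"
    by (simp add: Suc sum_product sum.cartesian_product)
  also have "\<dots> = (\<Sum>xs\<in>{xs. set xs \<subseteq> M \<and> length xs = Suc q}. prod_list (map f xs))"
    unfolding * by (subst sum.reindex) (auto simp: inj_on_def case_prod_unfold)
  finally show ?case .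
qed

lemma trig_sum_general:
  assumes "finite I" and g: "\<And>x. g x = (\<Sum>i\<in>I. c i * echar (\<nu> i) x)"
  shows "trigpoly (\<nu> ` I) g" "fcoeff g v = (\<Sum>i\<in>{i\<in>I. \<nu> i = v}. c i)"
proof -
  have g': "g = (\<lambda>x. \<Sum>u\<in>\<nu> ` I. (\<Sum>i\<in>{i\<in>I. \<nu> i = u}. c i) * echar u x)"
  proof
    fix x
    have "g x = (\<Sum>u\<in>\<nu> ` I. \<Sum>i\<in>{i\<in>I. \<nu> i = u}. c i * echar (\<nu> i) x)"
      unfolding g using assms(1) by (rule sum.image_gen)
    also have "\<dots> = (\<Sum>u\<in>\<nu> ` I. (\<Sum>i\<in>{i\<in>I. \<nu> i = u}. c i) * echar u x)"
      by (simp add: sum_distrib_right)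
    finally show "g x = (\<Sum>u\<in>\<nu> ` I. (\<Sum>i\<in>{i\<in>I. \<nu> i = u}. c i) * echar u x)" .
  qed
  show "trigpoly (\<nu> ` I) g"
    by (rule trigpolyI[of "\<nu> ` I" _ _ "\<lambda>u. \<Sum>i\<in>{i\<in>I. \<nu> i = u}. c i"]) (use assms in \<open>auto simp: fun_cong[OF g']\<close>)
  have "fcoeff g v = (if v \<in> \<nu> ` I then \<Sum>i\<in>{i\<in>I. \<nu> i = v}. c i else 0)"
    unfolding g' by (rule fcoeff_trig_sum) (use assms in simp)
  also have "\<dots> = (\<Sum>i\<in>{i\<in>I. \<nu> i = v}. c i)"
  proof (cases "v \<in> \<nu> ` I")
    case False
    then have "{i\<in>I. \<nu> i = v} = {}" by auto
    then show ?thesis using False by (simp only: sum.empty if_False)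
  qed simp
  finally show "fcoeff g v = (\<Sum>i\<in>{i\<in>I. \<nu> i = v}. c i)" .
qed

text \<open>Parseval over the values of \<nu> and Cauchy-Schwarz on its fibres: coinciding
  frequencies cost a factor equal to their multiplicity.\<close>

lemma mean_square_trig_sum_le:
  assumes I: "finite I" and g: "\<And>x. g x = (\<Sum>i\<in>I. c i * echar (\<nu> i) x)"
  shows "mean (\<lambda>x. (cmod (g x))\<^sup>2) \<le> (\<Sum>i\<in>I. real (card {j\<in>I. \<nu> j = \<nu> i}) * (cmod (c i))\<^sup>2)"
proof -
  note t = trig_sum_general[OF I g]
  have "mean (\<lambda>x. (cmod (g x))\<^sup>2) = (\<Sum>v\<in>spectrum g. (cmod (fcoeff g v))\<^sup>2)" by (rule parseval[OF t(1)])
  also have "\<dots> \<le> (\<Sum>v\<in>\<nu> ` I. (cmod (fcoeff g v))\<^sup>2)"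
    using trigpoly_spectrum[OF t(1)] I by (intro sum_mono2) auto
  also have "\<dots> \<le> (\<Sum>v\<in>\<nu> ` I. \<Sum>i\<in>{i\<in>I. \<nu> i = v}. real (card {j\<in>I. \<nu> j = \<nu> i}) * (cmod (c i))\<^sup>2)"
  proof (rule sum_mono)
    fix v
    let ?A = "{i\<in>I. \<nu> i = v}"
    have "cmod (fcoeff g v) \<le> (\<Sum>i\<in>?A. cmod (c i))" unfolding t(2) by (rule norm_sum)
    then have "(cmod (fcoeff g v))\<^sup>2 \<le> (\<Sum>i\<in>?A. 1 * cmod (c i))\<^sup>2" by (intro power_mono) auto
    also have "\<dots> \<le> (\<Sum>i\<in>?A. 1\<^sup>2) * (\<Sum>i\<in>?A. (cmod (c i))\<^sup>2)" by (rule Cauchy_Schwarz_ineq_sum)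
    also have "\<dots> = (\<Sum>i\<in>?A. real (card {j\<in>I. \<nu> j = \<nu> i}) * (cmod (c i))\<^sup>2)"
      by (simp add: sum_distrib_left)
    finally show "(cmod (fcoeff g v))\<^sup>2 \<le> (\<Sum>i\<in>?A. real (card {j\<in>I. \<nu> j = \<nu> i}) * (cmod (c i))\<^sup>2)" .
  qed
  also have "\<dots> = (\<Sum>i\<in>I. real (card {j\<in>I. \<nu> j = \<nu> i}) * (cmod (c i))\<^sup>2)"
    using I by (rule sum.image_gen[symmetric])
  finally show ?thesis .
qed

text \<open>The summand is m^{-3/2}, which is at most the telescoping difference 2 / sqrt (m - 1) -
  2 / sqrt m.\<close>

lemma sum_sqrt_tail:
  assumes "finite M" "\<And>m. m \<in> M \<Longrightarrow> m > P" "P > 0"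
  shows "(\<Sum>m\<in>M. sqrt (real m) / (real m)\<^sup>2) \<le> 2 / sqrt (real P)"
proof -
  have *: "(\<Sum>m\<in>{P<..P + R}. sqrt (real m) / (real m)\<^sup>2) \<le> 2 / sqrt (real P) - 2 / sqrt (real (P + R))" for R
  proof (induction R)
    case (Suc R)
    define a b where "a = sqrt (real (P + R))" and "b = sqrt (real (P + Suc R))"
    have ab: "0 < a" "a \<le> b" "b\<^sup>2 = real (P + Suc R)" "b\<^sup>2 = a\<^sup>2 + 1" using assms(3) by (auto simp: a_def b_def)
    have "b / (b\<^sup>2)\<^sup>2 \<le> 2 / a - 2 / b"
    proof -
      have b0: "0 < b" using ab by linarith
      have "(b - a) * (a + b) = 1" using ab(4) by (simp add: power2_eq_square algebra_simps)
      then have ba: "b - a = 1 / (a + b)" using ab b0 by (simp add: field_simps)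
      have "(a + b) * (a * b) \<le> (2 * b) * (b * b)" using ab b0 by (intro mult_mono) auto
      then have "1 / ((2 * b) * (b * b)) \<le> 1 / ((a + b) * (a * b))" using ab b0 by (intro divide_left_mono) auto
      then have "2 * (1 / ((2 * b) * (b * b))) \<le> 2 * (1 / (a + b) / (a * b))" by simp
      also have "\<dots> = 2 * ((b - a) / (a * b))" by (simp add: ba)
      also have "\<dots> = 2 / a - 2 / b" using ab b0 by (simp add: field_simps)
      finally show ?thesis using b0 by (simp add: power2_eq_square field_simps)
    qed
    then have 1: "sqrt (real (P + Suc R)) / (real (P + Suc R))\<^sup>2 \<le> 2 / sqrt (real (P + R)) - 2 / sqrt (real (P + Suc R))"
      using ab(3) by (simp add: a_def b_def)
    have "{P<..P + Suc R} = insert (P + Suc R) {P<..P + R}" by auto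
    then show ?case using Suc 1 by simp
  qed simp
  have "M \<subseteq> {P<..P + Max (insert 0 M)}"
  proof
    fix m assume m: "m \<in> M"
    have "m \<le> Max (insert 0 M)" by (rule Max_ge) (use assms(1) m in auto)
    then show "m \<in> {P<..P + Max (insert 0 M)}" using assms(2)[OF m] by simp
  qed
  then have "(\<Sum>m\<in>M. sqrt (real m) / (real m)\<^sup>2) \<le> (\<Sum>m\<in>{P<..P + Max (insert 0 M)}. sqrt (real m) / (real m)\<^sup>2)"
    by (intro sum_mono2) auto
  also have "\<dots> \<le> 2 / sqrt (real P)" using *[of "Max (insert 0 M)"] by (smt (verit) divide_nonneg_nonneg real_sqrt_ge_zero of_nat_0_le_iff)
  finally show ?thesis .
qed

text \<open>If all prime factors are at least q^2, then q^2 raised to their number is at most k.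
  This ties the order q of the moment to the roughness: the number of ordered factorizations becomes
  at most sqrt k.\<close>

lemma power_size_prime_factorization_le:
  fixes k q :: nat
  assumes "k > 0" "\<And>p. prime p \<Longrightarrow> p dvd k \<Longrightarrow> q\<^sup>2 \<le> p"
  shows "real (q ^ size (prime_factorization k)) \<le> sqrt (real k)"
proof -
  have "(q\<^sup>2) ^ size M \<le> prod_mset M" if "\<And>p. p \<in># M \<Longrightarrow> q\<^sup>2 \<le> p" for M
    using that by (induction M) (auto intro!: mult_mono)
  from this[of "prime_factorization k"] have "(q\<^sup>2) ^ size (prime_factorization k) \<le> k"
    using assms by (simp add: prod_mset_prime_factorization_nat in_prime_factors_iff)
  then have "(q ^ size (prime_factorization k))\<^sup>2 \<le> k" by (simp add: power_mult[symmetric] mult.commute)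
  then have "(real (q ^ size (prime_factorization k)))\<^sup>2 \<le> real k"
    by (metis of_nat_le_iff of_nat_power)
  then show ?thesis by (rule real_le_rsqrt)
qed

text \<open>A pointwise Chebyshev inequality: below \<eta> the first term suffices, above it the
  power does. It replaces splitting the circle into the sets where z is small and large.\<close>

lemma interpolation_bound:
  fixes z \<eta> :: real
  assumes "0 \<le> z" "0 < \<eta>" "1 \<le> q"
  shows "z \<le> \<eta> + \<eta> * (z / \<eta>) ^ q"
proof (cases "z \<le> \<eta>")
  case True
  then show ?thesis using assms by (simp add: add_increasing2)
next
  case False
  then have "1 \<le> z / \<eta>" using assms by simp
  then have "z / \<eta> \<le> (z / \<eta>) ^ q" using assms(3) self_le_power[of "z / \<eta>" q] by simp
  then have "\<eta> * (z / \<eta>) \<le> \<eta> * (z / \<eta>) ^ q" using assms by (intro mult_left_mono) auto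
  then show ?thesis using assms by simp
qed

text \<open>A Gal-type large values estimate: a high moment of the Dirichlet polynomial of the rough
  numbers \<open>m\<close> shows that it is small off a negligible set.\<close>

lemma rough_convolution_bound:
  fixes S K :: "nat set" and a \<sigma> :: "nat \<Rightarrow> complex" and P q :: nat
  assumes S: "finite S" "0 \<notin> S" and K: "finite K" "0 \<notin> K"
    and sigma: "\<And>n. cmod (\<sigma> n) \<le> 1" and a: "\<And>m. cmod (a m) \<le> 1 / real m"
    and rough: "\<And>m. a m \<noteq> 0 \<Longrightarrow> m > 1 \<and> (\<forall>p. prime p \<longrightarrow> p dvd m \<longrightarrow> p > P)"
    and q: "q \<ge> 1" "q\<^sup>2 \<le> P" "real (card S) \<le> exp (2 * real q)"
  shows "(\<Sum>k\<in>K. (cmod (\<Sum>n\<in>S. if n dvd k then \<sigma> n * a (k div n) else 0))\<^sup>2) \<le> 30 * real (card S) / sqrt (real P)"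
proof -
  define N where "N = real (card S)"
  have P0: "P > 0" using q by (cases P) auto
  \<comment> \<open>A quotient k / n with k in K is at most the largest element of K, so finitely
    many m matter; inserting 0 covers empty K.\<close>
  define M where "M = {m. m \<le> Max (insert 0 K) \<and> a m \<noteq> 0}"
  have Mf: "finite M" by (rule finite_subset[of _ "{..Max (insert 0 K)}"]) (auto simp: M_def)
  have M1: "m > 1" "m > P" "\<And>p. prime p \<Longrightarrow> p dvd m \<Longrightarrow> p > P" if "m \<in> M" for m
  proof -
    show "m > 1" and r: "\<And>p. prime p \<Longrightarrow> p dvd m \<Longrightarrow> p > P" using rough that by (auto simp: M_def)
    then obtain p where "prime p" "p dvd m" using prime_factor_nat[of m] by auto
    then show "m > P" using r[of p] dvd_imp_le[of p m] \<open>m > 1\<close> by simp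
  qed
  define L where "L = {xs. set xs \<subseteq> M \<and> length xs = q}"
  have Lf: "finite L" unfolding L_def by (rule finite_lists_length_eq[OF Mf])
  have posM: "set xs \<subseteq> M \<Longrightarrow> prod_list xs > 0" for xs
  proof (induction xs)
    case (Cons m xs)
    then show ?case using M1(1)[of m] by simp
  qed simp
  \<comment> \<open>All integers whose \<theta>-values have to be told apart.\<close>
  define U where "U = prod_list ` L \<union> (\<lambda>(m, n). m * n) ` (M \<times> S) \<union> K \<union> S"
  have posL: "prod_list xs > 0" if "xs \<in> L" for xs
    using that posM unfolding L_def by simp
  have "finite U" unfolding U_def using Mf Lf S K by auto
  moreover have "0 \<notin> U" using posL M1(1) S K by (force simp: U_def)
  ultimately obtain \<theta> :: "nat \<Rightarrow> int" where add: "\<And>a b. a > 0 \<Longrightarrow> b > 0 \<Longrightarrow> \<theta> (a * b) = \<theta> a + \<theta> b" and inj: "inj_on \<theta> U"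
    using completely_additive_injection by blast
  \<comment> \<open>Since \<theta> turns products into sums, the multiplicative convolution of a and
    \<sigma> becomes the product of the two functions Z and D on the circle.\<close>
  define Z where "Z x = (\<Sum>m\<in>M. a m * echar (\<theta> m) x)" for x
  define D where "D x = (\<Sum>n\<in>S. \<sigma> n * echar (\<theta> n) x)" for x
  have Zc: "circ_fun Z" unfolding Z_def by (intro circ_fun_sum circ_fun_cmult circ_fun_echar)
  have Dc: "circ_fun D" unfolding D_def by (intro circ_fun_sum circ_fun_cmult circ_fun_echar)

  have theta_list: "\<theta> (prod_list xs) = (\<Sum>x\<leftarrow>xs. \<theta> x) \<and> prod_list (map (\<lambda>m. a m * echar (\<theta> m) x) xs) = prod_list (map a xs) * echar (\<theta> (prod_list xs)) x"
    if "set xs \<subseteq> M" for xs x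
    using that
  proof (induction xs)
    case Nil
    have "\<theta> 1 = 0" using add[of 1 1] by simp
    then show ?case by simp
  next
    case (Cons m xs)
    have "prod_list xs > 0" using Cons.prems by (intro posM) simp
    moreover have "m > 0" using Cons.prems M1(1)[of m] by simp
    ultimately have "\<theta> (m * prod_list xs) = \<theta> m + \<theta> (prod_list xs)" by (rule add[rotated])
    then show ?case using Cons by (simp add: echar_add)
  qed
  \<comment> \<open>Two lists share a frequency only if they have the same product k, so the
    multiplicity counts ordered factorizations of k and is at most sqrt k. The sum then factorises
    over the entries of the list.\<close>
  have "mean (\<lambda>x. (cmod (Z x ^ q))\<^sup>2) \<le>
      (\<Sum>xs\<in>L. real (card {ys\<in>L. \<theta> (prod_list ys) = \<theta> (prod_list xs)}) * (cmod (prod_list (map a xs)))\<^sup>2)"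
  proof (rule mean_square_trig_sum_le[OF Lf])
    show "Z x ^ q = (\<Sum>xs\<in>L. prod_list (map a xs) * echar (\<theta> (prod_list xs)) x)" for x
      unfolding Z_def power_sum_lists[OF Mf] L_def by (intro sum.cong refl) (use theta_list in auto)
  qed
  also have "\<dots> \<le> (\<Sum>xs\<in>L. prod_list (map (\<lambda>m. sqrt (real m) / (real m)\<^sup>2) xs))"
  proof (rule sum_mono)
    fix xs assume xs: "xs \<in> L"
    let ?k = "prod_list xs"
    have k0: "?k > 0" by (rule posL[OF xs])
    have "{ys\<in>L. \<theta> (prod_list ys) = \<theta> ?k} \<subseteq> {ys. length ys = q \<and> prod_list ys = ?k}"
    proof clarify
      fix ys assume ys: "ys \<in> L" "\<theta> (prod_list ys) = \<theta> ?k"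
      have "prod_list ys = ?k" by (rule inj_onD[OF inj ys(2)]) (use ys xs in \<open>auto simp: U_def\<close>)
      then show "length ys = q \<and> prod_list ys = ?k" using ys(1) by (simp add: L_def)
    qed
    then have "card {ys\<in>L. \<theta> (prod_list ys) = \<theta> ?k} \<le> card {ys. length ys = q \<and> prod_list ys = ?k}"
      using card_ordered_factorizations[OF k0, of q] by (intro card_mono) auto
    also have "\<dots> \<le> q ^ size (prime_factorization ?k)"
      using card_ordered_factorizations[OF k0, of q] by simp
    finally have "real (card {ys\<in>L. \<theta> (prod_list ys) = \<theta> ?k}) \<le> real (q ^ size (prime_factorization ?k))"
      by (rule of_nat_mono)
    also have "\<dots> \<le> sqrt (real ?k)"
    proof (rule power_size_prime_factorization_le[OF k0])
      fix p assume p: "prime p" "p dvd ?k"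
      then have "\<exists>y\<in>set xs. p dvd y" by (induction xs) (auto simp: prime_dvd_mult_iff)
      then show "q\<^sup>2 \<le> p" using M1(3)[OF _ p(1)] xs q(2) unfolding L_def by fastforce
    qed
    finally have 1: "real (card {ys\<in>L. \<theta> (prod_list ys) = \<theta> ?k}) \<le> sqrt (real ?k)" .
    have "cmod (prod_list (map a ys)) \<le> 1 / real (prod_list ys)" for ys
    proof (induction ys)
      case (Cons y ys)
      have "cmod (a y) * cmod (prod_list (map a ys)) \<le> 1 / real y * (1 / real (prod_list ys))"
        using Cons a by (intro mult_mono) auto
      then show ?case by (simp add: norm_mult)
    qed simp
    then have "(cmod (prod_list (map a xs)))\<^sup>2 \<le> (1 / real ?k)\<^sup>2" by (intro power_mono) auto
    then have "real (card {ys\<in>L. \<theta> (prod_list ys) = \<theta> ?k}) * (cmod (prod_list (map a xs)))\<^sup>2 \<le> sqrt (real ?k) * (1 / real ?k)\<^sup>2"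
      using 1 by (intro mult_mono) auto
    also have "\<dots> = prod_list (map (\<lambda>m. sqrt (real m) / (real m)\<^sup>2) xs)"
    proof (induction xs)
      case (Cons m zs)
      have "sqrt (real (m * prod_list zs)) * (1 / real (m * prod_list zs))\<^sup>2 =
          (sqrt (real m) / (real m)\<^sup>2) * (sqrt (real (prod_list zs)) * (1 / real (prod_list zs))\<^sup>2)"
        by (simp add: real_sqrt_mult power_mult_distrib power_divide)
      then show ?case by (simp only: prod_list.Cons list.map Cons.IH)
    qed simp
    finally show "real (card {ys\<in>L. \<theta> (prod_list ys) = \<theta> ?k}) * (cmod (prod_list (map a xs)))\<^sup>2 \<le>
        prod_list (map (\<lambda>m. sqrt (real m) / (real m)\<^sup>2) xs)" .
  qed
  also have "\<dots> = (\<Sum>m\<in>M. sqrt (real m) / (real m)\<^sup>2) ^ q"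
    unfolding L_def by (rule power_sum_lists[OF Mf, symmetric])
  also have "\<dots> \<le> (2 / sqrt (real P)) ^ q"
    using sum_sqrt_tail[OF Mf M1(2) P0] by (intro power_mono sum_nonneg) auto
  finally have Zq: "mean (\<lambda>x. (cmod (Z x ^ q))\<^sup>2) \<le> (2 / sqrt (real P)) ^ q" .

  have "mean (\<lambda>x. (cmod (D x))\<^sup>2) \<le> (\<Sum>n\<in>S. real (card {j\<in>S. \<theta> j = \<theta> n}) * (cmod (\<sigma> n))\<^sup>2)"
    by (rule mean_square_trig_sum_le[OF S(1)]) (simp add: D_def)
  also have "\<dots> \<le> (\<Sum>n\<in>S. 1 * 1)"
  proof (rule sum_mono, rule mult_mono)
    fix n assume n: "n \<in> S"
    have "{j\<in>S. \<theta> j = \<theta> n} \<subseteq> {n}"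
    proof clarify
      fix j assume j: "j \<in> S" "\<theta> j = \<theta> n"
      show "j = n" by (rule inj_onD[OF inj j(2)]) (use j n in \<open>auto simp: U_def\<close>)
    qed
    then have "{j\<in>S. \<theta> j = \<theta> n} = {n}" using n by auto
    then show "real (card {j\<in>S. \<theta> j = \<theta> n}) \<le> 1" by simp
    show "(cmod (\<sigma> n))\<^sup>2 \<le> 1" using sigma[of n] by (simp add: power_le_one)
  qed auto
  finally have D2: "mean (\<lambda>x. (cmod (D x))\<^sup>2) \<le> N" by (simp add: N_def)
  have D1: "cmod (D x) \<le> N" for x
  proof -
    have "cmod (D x) \<le> (\<Sum>n\<in>S. cmod (\<sigma> n * echar (\<theta> n) x))" unfolding D_def by (rule norm_sum)
    also have "\<dots> \<le> (\<Sum>n\<in>S. 1)" using sigma by (intro sum_mono) (simp add: norm_mult)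
    finally show ?thesis by (simp add: N_def)
  qed

  \<comment> \<open>\<tau>^q bounds the mean of |Z|^{2q}, and the threshold \<eta> is larger than
    \<tau> by e^2. Where |Z|^2 exceeds \<eta>, the trivial bound |D| \<le> N is paid for by the
    factor e^{-2q}, at most 1/N by hypothesis.\<close>
  define \<tau> where "\<tau> = 2 / sqrt (real P)"
  define \<eta> where "\<eta> = exp 2 * \<tau>"
  have tau: "\<tau> > 0" "\<eta> > 0" using P0 by (auto simp: \<tau>_def \<eta>_def)
  have "mean (\<lambda>x. (cmod (Z x * D x))\<^sup>2) \<le> mean (\<lambda>x. \<eta> * (cmod (D x))\<^sup>2 + (\<eta> / \<eta> ^ q * N\<^sup>2) * (cmod (Z x ^ q))\<^sup>2)"
  proof (rule mean_mono)
    fix x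
    have "(cmod (Z x))\<^sup>2 \<le> \<eta> + \<eta> * ((cmod (Z x))\<^sup>2 / \<eta>) ^ q"
      by (rule interpolation_bound) (use tau q in auto)
    also have "\<eta> * ((cmod (Z x))\<^sup>2 / \<eta>) ^ q = \<eta> / \<eta> ^ q * (cmod (Z x ^ q))\<^sup>2"
      by (simp add: power_divide norm_power flip: power_mult) (simp add: mult.commute)
    finally have "(cmod (Z x))\<^sup>2 * (cmod (D x))\<^sup>2 \<le> (\<eta> + \<eta> / \<eta> ^ q * (cmod (Z x ^ q))\<^sup>2) * (cmod (D x))\<^sup>2"
      by (rule mult_right_mono) simp
    also have "\<dots> = \<eta> * (cmod (D x))\<^sup>2 + (\<eta> / \<eta> ^ q * (cmod (Z x ^ q))\<^sup>2) * (cmod (D x))\<^sup>2" by (rule distrib_right)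
    also have "\<dots> \<le> \<eta> * (cmod (D x))\<^sup>2 + (\<eta> / \<eta> ^ q * (cmod (Z x ^ q))\<^sup>2) * N\<^sup>2"
      using tau D1[of x] by (intro add_left_mono mult_left_mono power_mono) auto
    finally show "(cmod (Z x * D x))\<^sup>2 \<le> \<eta> * (cmod (D x))\<^sup>2 + (\<eta> / \<eta> ^ q * N\<^sup>2) * (cmod (Z x ^ q))\<^sup>2"
      by (simp add: norm_mult power_mult_distrib mult_ac)
  qed (intro circ_fun_power circ_fun_norm circ_fun_mult circ_fun_add circ_fun_cmult Zc Dc)+
  also have "\<dots> = \<eta> * mean (\<lambda>x. (cmod (D x))\<^sup>2) + (\<eta> / \<eta> ^ q * N\<^sup>2) * mean (\<lambda>x. (cmod (Z x ^ q))\<^sup>2)"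
    by (subst mean_add) (simp_all only: mean_cmult circ_fun_power circ_fun_norm circ_fun_cmult Zc Dc)
  also have "\<dots> \<le> \<eta> * N + (\<eta> / \<eta> ^ q * N\<^sup>2) * \<tau> ^ q"
    using D2 Zq tau by (intro add_mono mult_left_mono) (auto simp: \<tau>_def)
  also have "(\<eta> / \<eta> ^ q * N\<^sup>2) * \<tau> ^ q = \<eta> * N * (N * exp (- (2 * real q)))"
  proof -
    have "\<eta> ^ q = exp (2 * real q) * \<tau> ^ q" by (simp add: \<eta>_def power_mult_distrib exp_of_nat2_mult[symmetric] mult.commute)
    then show ?thesis using tau by (simp add: exp_minus power2_eq_square field_simps)
  qed
  also have "N * exp (- (2 * real q)) \<le> 1"
    using q(3) by (simp add: N_def exp_minus field_simps)
  finally have "mean (\<lambda>x. (cmod (Z x * D x))\<^sup>2) \<le> \<eta> * N + \<eta> * N * 1"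
    using tau by (simp add: N_def mult_left_mono)
  also have "\<dots> = 4 * exp 2 * (N / sqrt (real P))" by (simp add: \<eta>_def \<tau>_def)
  also have "\<dots> \<le> 30 * (N / sqrt (real P))"
  proof (rule mult_right_mono)
    have "exp (2::real) = exp 1 * exp 1" by (simp flip: exp_add)
    also have "\<dots> \<le> (272/100) * (272/100)" using e_less_272 by (intro mult_mono) auto
    finally show "4 * exp 2 \<le> (30::real)" by simp
  qed (simp add: N_def)
  finally have ZD: "mean (\<lambda>x. (cmod (Z x * D x))\<^sup>2) \<le> 30 * N / sqrt (real P)" by simp

  \<comment> \<open>The values of the convolution are Fourier coefficients of Z D at the distinct
    points \<theta>(k), so Bessel's inequality concludes.\<close>
  let ?c = "\<lambda>(m, n). a m * \<sigma> n" and ?\<nu> = "\<lambda>(m, n). \<theta> (m * n)"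
  have ZDeq: "Z x * D x = (\<Sum>i\<in>M \<times> S. ?c i * echar (?\<nu> i) x)" for x
    unfolding Z_def D_def sum_product sum.cartesian_product
  proof (rule sum.cong[OF refl], clarify)
    fix m n assume "m \<in> M" "n \<in> S"
    then have "m > 0" "n > 0" using M1(1)[of m] S by (auto intro: gr0I)
    then show "(a m * echar (\<theta> m) x) * (\<sigma> n * echar (\<theta> n) x) = (a m * \<sigma> n) * echar (\<theta> (m * n)) x"
      by (simp add: add echar_add)
  qed
  have MS: "finite (M \<times> S)" using Mf S by simp
  note t = trig_sum_general[OF MS ZDeq]
  have "(\<Sum>k\<in>K. (cmod (\<Sum>n\<in>S. if n dvd k then \<sigma> n * a (k div n) else 0))\<^sup>2) = (\<Sum>k\<in>K. (cmod (fcoeff (\<lambda>x. Z x * D x) (\<theta> k)))\<^sup>2)"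
  proof (rule sum.cong[OF refl], rule arg_cong[where f="\<lambda>z. (cmod z)\<^sup>2"])
    fix k assume k: "k \<in> K"
    then have k0: "k > 0" using K by (auto intro: gr0I)
    have "fcoeff (\<lambda>x. Z x * D x) (\<theta> k) = (\<Sum>i\<in>{i\<in>M \<times> S. ?\<nu> i = \<theta> k}. ?c i)" by (rule t(2))
    also have "{i\<in>M \<times> S. ?\<nu> i = \<theta> k} = {i\<in>M \<times> S. fst i * snd i = k}"
    proof -
      have "\<theta> (m * n) = \<theta> k \<longleftrightarrow> m * n = k" if "m \<in> M" "n \<in> S" for m n
        using inj_onD[OF inj, of "m * n" k] that k by (auto simp: U_def)
      then show ?thesis by auto
    qed
    also have "(\<Sum>i\<in>{i\<in>M \<times> S. fst i * snd i = k}. ?c i) = (\<Sum>n\<in>{n\<in>S. n dvd k \<and> k div n \<in> M}. \<sigma> n * a (k div n))"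
    proof (rule sum.reindex_bij_witness[of _ "\<lambda>n. (k div n, n)" snd])
      fix i assume "i \<in> {i\<in>M \<times> S. fst i * snd i = k}"
      then obtain m n where i: "i = (m, n)" "m \<in> M" "n \<in> S" "m * n = k" by auto
      then have n0: "n > 0" using k0 by (auto intro: gr0I)
      then have mk: "k div n = m" using i by auto
      show "(k div snd i, snd i) = i" "snd i \<in> {n\<in>S. n dvd k \<and> k div n \<in> M}" "\<sigma> (snd i) * a (k div snd i) = ?c i"
        using i mk by auto
    qed auto
    also have "\<dots> = (\<Sum>n\<in>S. if n dvd k then \<sigma> n * a (k div n) else 0)"
    proof (rule sum.mono_neutral_cong_left)
      show "\<forall>n\<in>S - {n\<in>S. n dvd k \<and> k div n \<in> M}. (if n dvd k then \<sigma> n * a (k div n) else 0) = 0"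
      proof
        fix n assume n: "n \<in> S - {n\<in>S. n dvd k \<and> k div n \<in> M}"
        have "k div n \<le> Max (insert 0 K)" using k K by (meson Max_ge div_le_dividend finite_insert insertCI order_trans)
        then show "(if n dvd k then \<sigma> n * a (k div n) else 0) = 0" using n by (auto simp: M_def)
      qed
    qed (use S in auto)
    finally show "(\<Sum>n\<in>S. if n dvd k then \<sigma> n * a (k div n) else 0) = fcoeff (\<lambda>x. Z x * D x) (\<theta> k)" by simp
  qed
  also have "\<dots> = (\<Sum>v\<in>\<theta> ` K. (cmod (fcoeff (\<lambda>x. Z x * D x) v))\<^sup>2)"
    by (subst sum.reindex) (use inj in \<open>auto simp: U_def intro: inj_on_subset\<close>)
  also have "\<dots> \<le> mean (\<lambda>x. (cmod (Z x * D x))\<^sup>2)"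
    by (rule bessel_trigpoly[OF t(1)]) (use K in simp)
  finally show ?thesis using ZD by (simp add: N_def)
qed

section \<open>A Mertens upper bound\<close>

text \<open>Chebyshev's argument: a prime in this range divides (2n)! but not n!, hence divides the
  central binomial coefficient, and so does the product of these primes.\<close>

lemma prod_primes_le_central_binomial:
  fixes n :: nat
  assumes "n > 0"
  shows "\<Prod>{p. prime p \<and> n < p \<and> p \<le> 2 * n} \<le> 4 ^ n"
proof -
  let ?A = "{p. prime p \<and> n < p \<and> p \<le> 2 * n}"
  have fin: "finite ?A" by (rule finite_subset[of _ "{..2 * n}"]) auto
  have dvd: "p dvd (2 * n choose n)" if p: "p \<in> ?A" for p
  proof -
    have "fact (2 * n) = (fact n * fact n) * (2 * n choose n)"
      using binomial_fact_lemma[of n "2 * n"] by (simp add: mult_2)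
    moreover have "p dvd fact (2 * n)" using p by (simp add: prime_dvd_fact_iff)
    moreover have "\<not> p dvd fact n" using p by (simp add: prime_dvd_fact_iff)
    ultimately show ?thesis using p by (metis (no_types, lifting) mem_Collect_eq prime_dvd_mult_iff)
  qed
  have "\<Prod>X dvd (2 * n choose n)" if "finite X" "X \<subseteq> ?A" for X
    using that
  proof (induction X rule: finite_induct)
    case (insert p X)
    have "coprime p (\<Prod>X)"
      using insert by (intro prod_coprime_right) (auto intro!: primes_coprime)
    then show ?case using insert dvd[of p] by (auto intro!: divides_mult)
  qed simp
  from this[OF fin] have "\<Prod>?A dvd (2 * n choose n)" by simp
  then have "\<Prod>?A \<le> (2 * n choose n)" by (rule dvd_imp_le) simp
  also have "\<dots> \<le> 4 ^ n"
    using binomial_le_pow2[of "2 * n" n] by (simp add: power_mult)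
  finally show ?thesis .
qed

text \<open>On the dyadic range 1/p is at most 1/n, so the logarithm of the Chebyshev product gives
  a bound free of n; summing over dyadic ranges then gives order ln P.\<close>

lemma sum_ln_primes_dyadic:
  fixes n :: nat
  assumes "n > 0"
  shows "(\<Sum>p\<in>{p. prime p \<and> n < p \<and> p \<le> 2 * n}. ln (real p) / real p) \<le> ln 4"
proof -
  let ?A = "{p. prime p \<and> n < p \<and> p \<le> 2 * n}"
  have fin: "finite ?A" by (rule finite_subset[of _ "{..2 * n}"]) auto
  have "(\<Sum>p\<in>?A. ln (real p) / real p) \<le> (\<Sum>p\<in>?A. ln (real p) / real n)"
    using assms by (intro sum_mono divide_left_mono) (auto simp: prime_gt_0_nat)
  also have "\<dots> = ln (real (\<Prod>?A)) / real n"
  proof -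
    have "ln (real (\<Prod>?A)) = (\<Sum>p\<in>?A. ln (real p))"
      unfolding of_nat_prod by (rule ln_prod) (auto simp: prime_gt_0_nat fin)
    then show ?thesis by (simp add: sum_divide_distrib)
  qed
  also have "\<dots> \<le> ln (4 ^ n) / real n"
  proof (rule divide_right_mono)
    have "real (\<Prod>?A) \<le> real (4 ^ n)" using prod_primes_le_central_binomial[OF assms] by (rule of_nat_mono)
    moreover have "0 < real (\<Prod>?A)"
      unfolding of_nat_prod by (intro prod_pos) (auto simp: prime_gt_0_nat)
    ultimately show "ln (real (\<Prod>?A)) \<le> ln (4 ^ n)"
      by (subst ln_le_cancel_iff) simp_all
  qed simp
  also have "\<dots> = ln 4" using assms by (simp add: ln_realpow)
  finally show ?thesis .
qed

lemma sum_ln_primes_pow2: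
  "(\<Sum>p\<in>{p. prime p \<and> p \<le> 2 ^ Suc k}. ln (real p) / real p) \<le> (real k + 1) * ln 4"
proof (induction k)
  case 0
  have "{p. prime p \<and> p \<le> 2 ^ Suc 0} = {2::nat}"
    by (auto dest: prime_ge_2_nat)
  moreover have "ln 2 / 2 \<le> ln (4::real)"
  proof -
    have "ln (4::real) = 2 * ln 2" using ln_realpow[of 2 2] by simp
    then show ?thesis using ln_gt_zero[of "2::real"] by linarith
  qed
  ultimately show ?case by simp
next
  case (Suc k)
  let ?B = "{p. prime p \<and> 2 ^ Suc k < p \<and> p \<le> 2 * (2::nat) ^ Suc k}"
  have "{p. prime p \<and> p \<le> 2 ^ Suc (Suc k)} = {p. prime p \<and> p \<le> 2 ^ Suc k} \<union> ?B"
    by (auto simp: not_less)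
  moreover have "finite {p::nat. prime p \<and> p \<le> 2 ^ Suc k}" "finite ?B"
    by (auto intro: finite_subset[of _ "{..2 * (2::nat) ^ Suc k}"])
  moreover have "{p::nat. prime p \<and> p \<le> 2 ^ Suc k} \<inter> ?B = {}" by auto
  ultimately have "(\<Sum>p\<in>{p. prime p \<and> p \<le> 2 ^ Suc (Suc k)}. ln (real p) / real p) =
    (\<Sum>p\<in>{p. prime p \<and> p \<le> 2 ^ Suc k}. ln (real p) / real p) + (\<Sum>p\<in>?B. ln (real p) / real p)"
    by (simp only: sum.union_disjoint)
  also have "\<dots> \<le> (real k + 1) * ln 4 + ln 4"
    by (intro add_mono Suc sum_ln_primes_dyadic) simp
  finally show ?case by (simp add: algebra_simps)
qed

lemma sum_ln_primes_le:
  fixes P :: nat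
  assumes "P \<ge> 2"
  shows "(\<Sum>p\<in>{p. prime p \<and> p \<le> P}. ln (real p) / real p) \<le> 4 * ln (real P)"
proof -
  define k where "k = nat \<lfloor>log 2 (real P)\<rfloor>"
  have lg: "log 2 (real P) \<ge> 1" using assms by simp
  have k: "real k \<le> log 2 (real P)" "log 2 (real P) < real k + 1"
    using lg by (auto simp: k_def)
  have "real P = 2 powr (log 2 (real P))" using assms by simp
  also have "\<dots> \<le> 2 powr (real (Suc k))" using k by (intro powr_mono) auto
  also have "\<dots> = 2 ^ Suc k" by (rule powr_realpow) simp
  finally have "P \<le> 2 ^ Suc k" by (metis of_nat_le_iff of_nat_numeral of_nat_power)
  then have "(\<Sum>p\<in>{p. prime p \<and> p \<le> P}. ln (real p) / real p) \<le>
      (\<Sum>p\<in>{p. prime p \<and> p \<le> 2 ^ Suc k}. ln (real p) / real p)"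
    by (intro sum_mono2) (auto intro: finite_subset[of _ "{..(2::nat) ^ Suc k}"] dest: prime_gt_0_nat)
  also have "\<dots> \<le> (real k + 1) * ln 4" by (rule sum_ln_primes_pow2)
  also have "\<dots> \<le> (2 * log 2 (real P)) * ln 4" using k lg by (intro mult_right_mono) auto
  also have "\<dots> = 4 * ln (real P)"
  proof -
    have "ln (4::real) = 2 * ln 2" using ln_realpow[of 2 2] by simp
    then show ?thesis by (simp add: log_def)
  qed
  finally show ?thesis .
qed

text \<open>Comparison with the integral of x^{-s}, by telescoping the antiderivative through the
  mean value theorem. In the strengthened induction \<open>max n 1\<close> makes the bound equal to
  1 for the empty sum.\<close>

lemma sum_powr_le:
  fixes s :: real
  assumes "s > 1"
  shows "(\<Sum>d=1..n. real d powr (- s)) \<le> 1 + 1 / (s - 1)"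
proof -
  have "(\<Sum>d=1..n. real d powr (- s)) \<le> 1 + 1 / (s - 1) - (1 / (s - 1)) * real (max n 1) powr (1 - s)"
  proof (induction n)
    case 0
    then show ?case by simp
  next
    case (Suc n)
    show ?case
    proof (cases "n = 0")
      case True
      then show ?thesis by simp
    next
      case False
      have "\<exists>z>real n. z < real (Suc n) \<and> (1 / (1 - s)) * real (Suc n) powr (1 - s) - (1 / (1 - s)) * real n powr (1 - s)
          = (real (Suc n) - real n) * (z powr (- s))"
      proof (rule MVT2)
        fix x assume "real n \<le> x" "x \<le> real (Suc n)"
        then have "x > 0" using False by simp
        then show "((\<lambda>x. (1 / (1 - s)) * x powr (1 - s)) has_real_derivative x powr (- s)) (at x)"
          using assms by (auto intro!: derivative_eq_intros)
      qed simp
      then obtain z where z: "real n < z" "z < real (Suc n)"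
        "(1 / (1 - s)) * real (Suc n) powr (1 - s) - (1 / (1 - s)) * real n powr (1 - s) = z powr (- s)" by auto
      have "real (Suc n) powr (- s) \<le> z powr (- s)"
        using z assms False by (intro powr_mono2') auto
      moreover have "1 / (1 - s) = - (1 / (s - 1))" using assms by (simp add: field_simps)
      ultimately show ?thesis using Suc z(3) False by simp
    qed
  qed
  moreover have "(1 / (s - 1)) * real (max n 1) powr (1 - s) \<ge> 0" using assms by simp
  ultimately show ?thesis by linarith
qed

text \<open>Rankin's trick: compare the product with the one at the exponent \<open>1 + 1 / ln P\<close>.\<close>

lemma prod_primes_one_plus_inverse_le:
  fixes P :: nat
  assumes "P \<ge> 3"
  shows "(\<Prod>p\<in>{p. prime p \<and> p \<le> P}. 1 + 1 / real p) \<le> 2 * exp 4 * ln (real P)"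
proof -
  let ?A = "{p. prime p \<and> p \<le> P}"
  have fin: "finite ?A" by (rule finite_subset[of _ "{..P}"]) auto
  define L where "L = ln (real P)"
  have "exp 1 \<le> real P" using e_less_272 assms by simp
  then have L: "L \<ge> 1" unfolding L_def by (subst ln_ge_iff) (use assms in auto)
  define s where "s = 1 + 1 / L"
  have s: "s > 1" using L by (simp add: s_def)
  \<comment> \<open>Used with a = p^{-s} and b = (ln p) / (p L): as p^{-s} = e^{-(ln p)/L} / p, the
    two add up to at least 1/p. The factors 1 + b are bounded by exponentials, whose product is at
    most e^4 by the Chebyshev sum.\<close>
  have gen: "1 + c \<le> (1 + a) * (1 + b)" if "c \<le> a + b" "0 \<le> a" "0 \<le> b" for a b c :: real
  proof -
    have "(1 + a) * (1 + b) = 1 + (a + b) + a * b" by (simp add: algebra_simps)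
    moreover have "0 \<le> a * b" by (rule mult_nonneg_nonneg[OF that(2,3)])
    ultimately show ?thesis using that(1) by linarith
  qed
  have "(\<Prod>p\<in>?A. 1 + 1 / real p) \<le> (\<Prod>p\<in>?A. (1 + real p powr (- s)) * exp (ln (real p) / real p / L))"
  proof (rule prod_mono, intro conjI)
    fix p assume p: "p \<in> ?A"
    then have p0: "real p > 0" by (auto simp: prime_gt_0_nat)
    have "real p powr (- s) = 1 / real p * exp (- (ln (real p) / L))"
    proof -
      have "- s * ln (real p) = - ln (real p) + - (ln (real p) / L)"
        by (simp add: s_def algebra_simps)
      then have "real p powr (- s) = exp (- ln (real p) + - (ln (real p) / L))"
        using p0 by (simp add: powr_def)
      also have "\<dots> = exp (- ln (real p)) * exp (- (ln (real p) / L))" by (rule exp_add)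
      finally show ?thesis using p0 by (simp add: exp_minus inverse_eq_divide)
    qed
    also have "\<dots> \<ge> 1 / real p * (1 - ln (real p) / L)"
      using exp_ge_add_one_self[of "- (ln (real p) / L)"] p0 by (intro mult_left_mono) auto
    finally have 1: "1 / real p \<le> real p powr (- s) + ln (real p) / real p / L"
      by (simp add: right_diff_distrib mult.commute)
    have nn: "0 \<le> ln (real p) / real p / L" using p L by (auto dest: prime_ge_1_nat)
    have "1 + 1 / real p \<le> (1 + real p powr (- s)) * (1 + ln (real p) / real p / L)"
      by (rule gen[OF 1 powr_ge_zero nn])
    also have "\<dots> \<le> (1 + real p powr (- s)) * exp (ln (real p) / real p / L)"
      by (intro mult_left_mono exp_ge_add_one_self) simp
    finally show "1 + 1 / real p \<le> (1 + real p powr (- s)) * exp (ln (real p) / real p / L)" .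
  qed simp
  also have "\<dots> = (\<Prod>p\<in>?A. 1 + real p powr (- s)) * exp ((\<Sum>p\<in>?A. ln (real p) / real p) / L)"
    by (simp add: prod.distrib exp_sum fin sum_divide_distrib)
  also have "\<dots> \<le> (1 + L) * exp 4"
  proof (rule mult_mono)
    \<comment> \<open>Expanding gives d^{-s} for distinct squarefree d, a part of the series for
      zeta(s).\<close>
    have "(\<Prod>p\<in>?A. 1 + real p powr (- s)) = (\<Sum>X\<in>Pow ?A. (\<Prod>p\<in>X. real p powr (- s)))"
      by (subst add.commute) (simp add: prod_add[OF fin])
    also have "\<dots> = (\<Sum>X\<in>Pow ?A. real (\<Prod>X) powr (- s))"
    proof (rule sum.cong[OF refl])
      fix X assume "X \<in> Pow ?A"
      show "(\<Prod>p\<in>X. real p powr (- s)) = real (\<Prod>X) powr (- s)"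
        by (induction X rule: infinite_finite_induct) (auto simp: powr_mult prod_nonneg)
    qed
    also have "\<dots> = (\<Sum>d\<in>Prod ` Pow ?A. real d powr (- s))"
    proof (subst sum.reindex)
      show "inj_on Prod (Pow ?A)"
      proof (rule inj_onI)
        fix X Y assume X: "X \<in> Pow ?A" and Y: "Y \<in> Pow ?A" and eq: "\<Prod>X = \<Prod>Y"
        have *: "p \<in> Z \<longleftrightarrow> prime p \<and> p dvd \<Prod>Z" if "Z \<in> Pow ?A" for Z p
        proof -
          have fZ: "finite Z" using that fin by (auto intro: finite_subset)
          show ?thesis
          proof
            assume "p \<in> Z" then show "prime p \<and> p dvd \<Prod>Z" using that fZ by (auto intro: dvd_prodI)
          next
            assume p: "prime p \<and> p dvd \<Prod>Z"
            then obtain r where "r \<in> Z" "p dvd r" using prime_dvd_prod_iff[OF fZ, of p "\<lambda>x. x"] by auto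
            then show "p \<in> Z" using that p by (metis (no_types, lifting) Pow_iff mem_Collect_eq primes_dvd_imp_eq subsetD)
          qed
        qed
        show "X = Y" by (intro set_eqI) (simp only: *[OF X] *[OF Y] eq)
      qed
    qed simp
    also have "\<dots> \<le> (\<Sum>d=1..\<Prod>?A. real d powr (- s))"
    proof (rule sum_mono2)
      show "Prod ` Pow ?A \<subseteq> {1..\<Prod>?A}"
      proof clarsimp
        fix X assume X: "X \<subseteq> ?A"
        have "\<Prod>X dvd \<Prod>?A" using prod_dvd_prod_subset[OF fin X, of "\<lambda>x. x"] by simp
        moreover have pos: "0 < \<Prod>?A" by (intro prod_pos) (auto simp: prime_gt_0_nat)
        ultimately have "\<Prod>X \<le> \<Prod>?A" by (intro dvd_imp_le)
        moreover have "0 < \<Prod>X" using X by (intro prod_pos) (auto simp: prime_gt_0_nat)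
        ultimately show "Suc 0 \<le> \<Prod>X \<and> \<Prod>X \<le> \<Prod>?A" by simp
      qed
    qed auto
    also have "\<dots> \<le> 1 + 1 / (s - 1)" by (rule sum_powr_le[OF s])
    also have "\<dots> = 1 + L" using L by (simp add: s_def)
    finally show "(\<Prod>p\<in>?A. 1 + real p powr (- s)) \<le> 1 + L" .
    have "(\<Sum>p\<in>?A. ln (real p) / real p) \<le> 4 * L" unfolding L_def by (rule sum_ln_primes_le) (use assms in simp)
    then show "exp ((\<Sum>p\<in>?A. ln (real p) / real p) / L) \<le> exp 4" using L by (simp add: divide_le_eq)
  qed (use L in auto)
  also have "\<dots> \<le> 2 * exp 4 * L" using L by (simp add: algebra_simps)
  finally show ?thesis by (simp add: L_def)
qed

section \<open>Littlewood sums with a rough tail\<close>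

lemma ordered_blocks_exist:
  fixes S :: "nat set"
  assumes S: "finite S" and J: "(\<Sum>i<J. 4 ^ i) \<le> card S"
  obtains T :: "nat \<Rightarrow> nat set" where
    "\<And>i. i < J \<Longrightarrow> card (T i) = 4 ^ i" "\<And>i. i < J \<Longrightarrow> T i \<subseteq> S"
    "\<And>i j a b. i < j \<Longrightarrow> j < J \<Longrightarrow> a \<in> T i \<Longrightarrow> b \<in> T j \<Longrightarrow> a < b"
    "\<And>n i a. n \<in> S \<Longrightarrow> n \<notin> (\<Union>i<J. T i) \<Longrightarrow> i < J \<Longrightarrow> a \<in> T i \<Longrightarrow> a < n"
proof -
  define xs where "xs = sorted_list_of_set S"
  have len: "length xs = card S" and set: "set xs = S" using S by (auto simp: xs_def)
  have nth_less: "xs ! u < xs ! v" if "u < v" "v < card S" for u v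
    using that len sorted_list_of_set.strict_sorted_key_list_of_set[of S] unfolding xs_def
    by (auto simp: sorted_wrt_iff_nth_less)
  define s :: "nat \<Rightarrow> nat" where "s i = (\<Sum>t<i. 4 ^ t)" for i
  have sS: "s (Suc i) = s i + 4 ^ i" for i by (simp add: s_def)
  have smono: "s i \<le> s j" if "i \<le> j" for i j unfolding s_def using that by (intro sum_mono2) auto
  have sJ: "s i \<le> card S" if "i \<le> J" for i using smono[OF that] J by (simp add: s_def)
  define T where "T i = (\<lambda>u. xs ! u) ` {s i..<s (Suc i)}" for i
  show ?thesis
  proof (rule that[of T])
    fix i assume i: "i < J"
    have r: "s (Suc i) \<le> card S" using i by (intro sJ) simp
    have "inj_on (\<lambda>u. xs ! u) {s i..<s (Suc i)}"
    proof (rule inj_onI)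
      fix u v assume uv: "u \<in> {s i..<s (Suc i)}" "v \<in> {s i..<s (Suc i)}" "xs ! u = xs ! v"
      show "u = v" using nth_less[of u v] nth_less[of v u] uv r by (cases u v rule: linorder_cases) auto
    qed
    then show "card (T i) = 4 ^ i" by (simp add: T_def card_image sS)
    show "T i \<subseteq> S" using r len set by (auto simp: T_def intro!: nth_mem)
  next
    fix i j a b assume ij: "i < j" "j < J" and ab: "a \<in> T i" "b \<in> T j"
    then obtain u v where uv: "a = xs ! u" "b = xs ! v" "u < s (Suc i)" "s j \<le> v" "v < s (Suc j)" by (auto simp: T_def)
    have "s (Suc i) \<le> s j" "s (Suc j) \<le> card S" using ij by (auto intro!: smono sJ)
    then show "a < b" using nth_less[of u v] uv by simp
  next
    fix n i a assume n: "n \<in> S" "n \<notin> (\<Union>i<J. T i)" and i: "i < J" "a \<in> T i"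
    obtain v where v: "n = xs ! v" "v < card S" using n(1) set len by (metis in_set_conv_nth)
    have "s J \<le> v"
    proof (rule ccontr)
      assume "\<not> s J \<le> v"
      then have "v < s J" by simp
      then have "\<exists>j<J. s j \<le> v \<and> v < s (Suc j)"
      proof (induction J)
        case (Suc J)
        then show ?case by (cases "v < s J") (auto intro: less_SucI)
      qed (simp add: s_def)
      then obtain j where j: "j < J" "s j \<le> v" "v < s (Suc j)" by blast
      then have "n \<in> T j" unfolding T_def v(1) by (intro imageI) simp
      then show False using n(2) j(1) by blast
    qed
    moreover obtain u where u: "a = xs ! u" "u < s (Suc i)" using i by (auto simp: T_def)
    moreover have "s (Suc i) \<le> s J" using i by (intro smono) simp
    ultimately show "a < n" using nth_less[of u v] v by simp
  qed
qed

text \<open>Provides the tail bound required by \<open>mean_norm_ge_blocks\<close>. The blocks up to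
  i have at most (4/3) 4^i elements, and their positive and negative multiples are each a
  convolution with rough numbers; P \<ge> 10^10 brings 60 * (4/3) / sqrt P below 1/576.\<close>

theorem mean_norm_ge_rough:
  fixes S :: "nat set" and \<sigma> :: "nat \<Rightarrow> complex" and \<phi> :: "int \<Rightarrow> complex" and P q J :: nat
  assumes S: "finite S" "0 \<notin> S" and sigma: "\<And>n. cmod (\<sigma> n) = 1"
    and phi1: "\<phi> 1 = 1" and phi: "\<And>m. cmod (\<phi> m) \<le> 1 / \<bar>real_of_int m\<bar>"
    and rough: "\<And>m. m \<noteq> 1 \<Longrightarrow> \<phi> m \<noteq> 0 \<Longrightarrow> \<bar>m\<bar> > 1 \<and> (\<forall>p. prime p \<longrightarrow> int p dvd m \<longrightarrow> p > P)"
    and P: "P \<ge> 10 ^ 10" "q \<ge> 1" "q\<^sup>2 \<le> P" "real (card S) \<le> exp (2 * real q)"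
    and J: "J > 0" "4 * J \<le> P" "(\<Sum>i<J. 4 ^ i) \<le> card S"
    and w: "circ_fun w" "\<And>k. fcoeff w k = (\<Sum>n\<in>S. if int n dvd k then \<sigma> n * \<phi> (k div int n) else 0)"
  shows "real J \<le> 800 * mean (\<lambda>x. cmod (w x))"
proof (rule ordered_blocks_exist[OF S(1) J(3)])
  fix T :: "nat \<Rightarrow> nat set"
  assume T: "\<And>i. i < J \<Longrightarrow> card (T i) = 4 ^ i" "\<And>i. i < J \<Longrightarrow> T i \<subseteq> S"
    "\<And>i j a b. i < j \<Longrightarrow> j < J \<Longrightarrow> a \<in> T i \<Longrightarrow> b \<in> T j \<Longrightarrow> a < b"
    "\<And>n i a. n \<in> S \<Longrightarrow> n \<notin> (\<Union>i<J. T i) \<Longrightarrow> i < J \<Longrightarrow> a \<in> T i \<Longrightarrow> a < n"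
  have pos: "0 < n" if "i < J" "n \<in> T i" for i n using that T(2) S(2) by (auto intro: gr0I)
  interpret signed_blocks T \<sigma> J P
  proof unfold_locales
    show "card (T i) = 4 ^ i" if "i < J" for i by (rule T(1)[OF that])
    show "a < b" if "i < j" "j < J" "a \<in> T i" "b \<in> T j" for i j a b by (rule T(3)[OF that])
    show "0 < n" if "i < J" "n \<in> T i" for i n by (rule pos[OF that])
    show "cmod (\<sigma> n) = 1" for n by (rule sigma)
    show "4 * J \<le> P" by (rule J(2))
    show "0 < P" by (rule less_le_trans[OF _ P(1)]) simp
  qed
  show ?thesis
  proof (rule mean_norm_ge_blocks[of S \<phi> w])
    show "block_max i < n" if "n \<in> S" "n \<notin> (\<Union>i<J. T i)" "i < J" for n i
      using T(4)[OF that block_max_in[OF that(3)]] .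
    fix m :: int assume m: "m \<noteq> 1" "\<phi> m \<noteq> 0"
    then have r: "\<bar>m\<bar> > 1" "\<And>p. prime p \<Longrightarrow> int p dvd m \<Longrightarrow> p > P" using rough by auto
    have "nat \<bar>m\<bar> \<noteq> 1" using r(1) by linarith
    from prime_factor_nat[OF this] obtain p where p: "prime p" "p dvd nat \<bar>m\<bar>" by blast
    then have "int p dvd m" by simp
    then have "P < p" using r p by blast
    moreover have "int p \<le> \<bar>m\<bar>" using dvd_imp_le_int[OF _ \<open>int p dvd m\<close>] r by auto
    ultimately show "\<bar>m\<bar> > int P" by linarith
  next
    fix i K assume i: "i < J" and K: "finite (K :: int set)"
    define V where "V = (\<Union>j\<le>i. T j)"
    have Vsub: "V \<subseteq> S"
    proof -
      have "T j \<subseteq> S" if "j \<le> i" for j using T(2)[of j] that i by simp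
      then show ?thesis unfolding V_def by blast
    qed
    have V: "finite V" "0 \<notin> V" using Vsub S finite_subset by auto
    have cV: "real (card V) \<le> 4 / 3 * 4 ^ i"
    proof -
      have "card V \<le> (\<Sum>j\<le>i. card (T j))" unfolding V_def by (rule card_UN_le) simp
      also have "\<dots> = (\<Sum>j\<le>i. 4 ^ j)" using i T(1) by (intro sum.cong) auto
      finally have "real (card V) \<le> (\<Sum>j\<le>i. 4 ^ j)"
        using of_nat_mono by fastforce
      also have "\<dots> = (4 * 4 ^ i - 1) / (3::real)" by (induction i) (auto simp: field_simps)
      finally show ?thesis by simp
    qed
    have cVS: "real (card V) \<le> exp (2 * real q)"
      using P(4) card_mono[OF S(1) Vsub] by linarith
    define c where "c k = (\<Sum>n\<in>V. if int n dvd k \<and> k \<noteq> int n then \<sigma> n * \<phi> (k div int n) else 0)" for k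
    \<comment> \<open>The coefficients at s m for a sign s. For s = 1 the diagonal m = 1 is removed;
      for s = -1 the hypothesis on \<phi> already excludes m = 1.\<close>
    define ap where "ap s m = (if m \<le> 1 \<and> s = 1 then 0 else \<phi> (s * int m))" for s :: int and m :: nat
    have bnd: "(\<Sum>k\<in>L. (cmod (\<Sum>n\<in>V. if n dvd k then \<sigma> n * ap s (k div n) else 0))\<^sup>2) \<le> 30 * real (card V) / sqrt (real P)"
      if s: "s = 1 \<or> s = -1" and L: "finite L" "0 \<notin> L" for s L
    proof (rule rough_convolution_bound[OF V L _ _ _ P(2,3) cVS])
      show "cmod (\<sigma> n) \<le> 1" for n using sigma by simp
      show "cmod (ap s m) \<le> 1 / real m" for m
        using phi[of "s * int m"] s by (auto simp: ap_def abs_mult)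
      fix m assume m: "ap s m \<noteq> 0"
      then have ne: "s * int m \<noteq> 1" "\<phi> (s * int m) \<noteq> 0" using s by (auto simp: ap_def split: if_splits)
      from rough[OF ne] show "m > 1 \<and> (\<forall>p. prime p \<longrightarrow> p dvd m \<longrightarrow> p > P)" using s by auto
    qed
    define Kp where "Kp = nat ` {k\<in>K. k > 0}"
    define Kn where "Kn = nat ` uminus ` {k\<in>K. k < 0}"
    \<comment> \<open>The bound 1 / |m| is 0 at m = 0, since division by zero yields 0.\<close>
    have phi0: "\<phi> 0 = 0" using phi[of 0] by simp
    have c0: "c 0 = 0" unfolding c_def using phi0 by (intro sum.neutral) auto
    have c_pos: "c (int k) = (\<Sum>n\<in>V. if n dvd k then \<sigma> n * ap 1 (k div n) else 0)" if "k > 0" for k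
      unfolding c_def
    proof (rule sum.cong[OF refl])
      fix n assume n: "n \<in> V"
      then have n0: "n > 0" using V(2) by (auto intro: gr0I)
      show "(if int n dvd int k \<and> int k \<noteq> int n then \<sigma> n * \<phi> (int k div int n) else 0) = (if n dvd k then \<sigma> n * ap 1 (k div n) else 0)"
      proof (cases "n dvd k")
        case True
        then obtain m where m: "k = n * m" by (elim dvdE)
        then have "m > 0" "k div n = m" "int k div int n = int m" using that n0 by auto
        then show ?thesis using m n0 by (auto simp: ap_def)
      qed auto
    qed
    have c_neg: "c (- int k) = (\<Sum>n\<in>V. if n dvd k then \<sigma> n * ap (-1) (k div n) else 0)" if "k > 0" for k
      unfolding c_def
    proof (rule sum.cong[OF refl])
      fix n assume n: "n \<in> V"
      then have n0: "n > 0" using V(2) by (auto intro: gr0I)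
      show "(if int n dvd - int k \<and> - int k \<noteq> int n then \<sigma> n * \<phi> (- int k div int n) else 0) = (if n dvd k then \<sigma> n * ap (-1) (k div n) else 0)"
      proof (cases "n dvd k")
        case True
        then obtain m where m: "k = n * m" by (elim dvdE)
        have "- int k = int n * (- int m)" using m by simp
        then have "- int k div int n = - int m" using n0 by (metis nonzero_mult_div_cancel_left of_nat_0_less_iff order_less_irrefl)
        moreover have "k div n = m" using m n0 by simp
        ultimately show ?thesis using True that by (auto simp: ap_def)
      qed auto
    qed
    have "(\<Sum>k\<in>K. (cmod (c k))\<^sup>2) = (\<Sum>k\<in>{k\<in>K. k > 0} \<union> {k\<in>K. k < 0}. (cmod (c k))\<^sup>2)"
      using K c0 by (intro sum.mono_neutral_right) (auto simp: not_less order.order_iff_strict)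
    also have "\<dots> = (\<Sum>k\<in>{k\<in>K. k > 0}. (cmod (c k))\<^sup>2) + (\<Sum>k\<in>{k\<in>K. k < 0}. (cmod (c k))\<^sup>2)"
      using K by (intro sum.union_disjoint) auto
    also have "(\<Sum>k\<in>{k\<in>K. k > 0}. (cmod (c k))\<^sup>2) = (\<Sum>k\<in>Kp. (cmod (c (int k)))\<^sup>2)"
      unfolding Kp_def by (subst sum.reindex) (auto simp: inj_on_def)
    also have "(\<Sum>k\<in>{k\<in>K. k < 0}. (cmod (c k))\<^sup>2) = (\<Sum>k\<in>Kn. (cmod (c (- int k)))\<^sup>2)"
      unfolding Kn_def image_image by (subst sum.reindex) (auto simp: inj_on_def)
    also have "(\<Sum>k\<in>Kp. (cmod (c (int k)))\<^sup>2) \<le> 30 * real (card V) / sqrt (real P)"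
    proof -
      have pos: "k > 0" if "k \<in> Kp" for k using that by (auto simp: Kp_def)
      have "(\<Sum>k\<in>Kp. (cmod (c (int k)))\<^sup>2) = (\<Sum>k\<in>Kp. (cmod (\<Sum>n\<in>V. if n dvd k then \<sigma> n * ap 1 (k div n) else 0))\<^sup>2)"
        by (rule sum.cong[OF refl]) (simp only: c_pos[OF pos])
      also have "\<dots> \<le> 30 * real (card V) / sqrt (real P)"
        by (rule bnd) (use K pos in \<open>auto simp: Kp_def\<close>)
      finally show ?thesis .
    qed
    also have "(\<Sum>k\<in>Kn. (cmod (c (- int k)))\<^sup>2) \<le> 30 * real (card V) / sqrt (real P)"
    proof -
      have pos: "k > 0" if "k \<in> Kn" for k using that by (auto simp: Kn_def)
      have "(\<Sum>k\<in>Kn. (cmod (c (- int k)))\<^sup>2) = (\<Sum>k\<in>Kn. (cmod (\<Sum>n\<in>V. if n dvd k then \<sigma> n * ap (-1) (k div n) else 0))\<^sup>2)"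
        by (rule sum.cong[OF refl]) (simp only: c_neg[OF pos])
      also have "\<dots> \<le> 30 * real (card V) / sqrt (real P)"
        by (rule bnd) (use K pos in \<open>auto simp: Kn_def\<close>)
      finally show ?thesis .
    qed
    also have "30 * real (card V) / sqrt (real P) + 30 * real (card V) / sqrt (real P) \<le> 4 ^ i / 576"
    proof -
      have "sqrt (real P) \<ge> 10 ^ 5" using P(1) by (intro real_le_rsqrt) (simp add: power_mult[symmetric])
      then have "60 * real (card V) / sqrt (real P) \<le> 60 * (4 / 3 * 4 ^ i) / 10 ^ 5"
        using cV by (intro frac_le mult_left_mono) auto
      also have "\<dots> \<le> 4 ^ i / (576::real)" by simp
      finally show ?thesis by simp
    qed
    finally show "(\<Sum>k\<in>K. (cmod (\<Sum>n\<in>(\<Union>j\<le>i. T j). if int n dvd k \<and> k \<noteq> int n then \<sigma> n * \<phi> (k div int n) else 0))\<^sup>2) \<le> 4 ^ i / 576"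
      by (simp add: c_def V_def)
  qed (use J S T phi1 w in auto)
qed

text \<open>One prime at a time: because \<gamma>(p r) = \<rho>(p) \<gamma>(r) / p, subtracting
  \<rho>(p)/p times the dilate w(p x) deletes exactly the multiples of p. Dilation preserves the L^1
  norm, so each prime costs a factor 1 + 1/p.\<close>

lemma sieve_primes:
  fixes S Q :: "nat set" and \<rho> \<sigma> :: "nat \<Rightarrow> complex" and \<gamma> :: "int \<Rightarrow> complex"
  assumes Q: "finite Q" "\<And>p. p \<in> Q \<Longrightarrow> prime p" and S: "0 \<notin> S"
    and chi: "\<And>p. cmod (\<rho> p) \<le> 1"
    and gam: "\<And>p r. p \<in> Q \<Longrightarrow> \<gamma> (int p * r) = \<rho> p / of_nat p * \<gamma> r"
    and w: "circ_fun w" "\<And>k. fcoeff w k = (\<Sum>n\<in>S. if int n dvd k then \<sigma> n * \<gamma> (k div int n) else 0)"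
  shows "\<exists>w'. circ_fun w' \<and> mean (\<lambda>x. cmod (w' x)) \<le> (\<Prod>p\<in>Q. 1 + 1 / real p) * mean (\<lambda>x. cmod (w x)) \<and>
    (\<forall>k. fcoeff w' k = (\<Sum>n\<in>S. if int n dvd k \<and> (\<forall>p\<in>Q. \<not> int p dvd k div int n) then \<sigma> n * \<gamma> (k div int n) else 0))"
  using Q gam
proof (induction Q rule: finite_induct)
  case empty
  then show ?case using w by (intro exI[of _ w]) auto
next
  case (insert p Q)
  then obtain w' where w': "circ_fun w'" "mean (\<lambda>x. cmod (w' x)) \<le> (\<Prod>p\<in>Q. 1 + 1 / real p) * mean (\<lambda>x. cmod (w x))"
    "\<And>k. fcoeff w' k = (\<Sum>n\<in>S. if int n dvd k \<and> (\<forall>p\<in>Q. \<not> int p dvd k div int n) then \<sigma> n * \<gamma> (k div int n) else 0)"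
    by auto
  have p: "prime p" "p > 0" using insert.prems(1)[of p] by (auto intro: prime_gt_0_nat)
  define v where "v x = w' x - \<rho> p / of_nat p * w' (real p * x)" for x
  have dil: "circ_fun (\<lambda>x. w' (real p * x))" by (rule circ_fun_dilate[OF w'(1)])
  have vc: "circ_fun v" unfolding v_def by (intro circ_fun_diff circ_fun_cmult dil w'(1))
  have "mean (\<lambda>x. cmod (v x)) \<le> mean (\<lambda>x. cmod (w' x) + 1 / real p * cmod (w' (real p * x)))"
  proof (rule mean_mono)
    fix x
    have "cmod (v x) \<le> cmod (w' x) + cmod (\<rho> p / of_nat p * w' (real p * x))" unfolding v_def by (rule norm_triangle_ineq4)
    also have "cmod (\<rho> p / of_nat p * w' (real p * x)) \<le> 1 / real p * cmod (w' (real p * x))"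
      using chi[of p] by (auto simp: norm_mult norm_divide intro!: mult_left_le_one_le divide_right_mono)
    finally show "cmod (v x) \<le> cmod (w' x) + 1 / real p * cmod (w' (real p * x))" by simp
  qed (intro circ_fun_norm circ_fun_add circ_fun_cmult vc dil w'(1))+
  also have "\<dots> = mean (\<lambda>x. cmod (w' x)) + 1 / real p * mean (\<lambda>x. cmod (w' (real p * x)))"
    by (subst mean_add) (simp_all only: mean_cmult circ_fun_norm circ_fun_cmult dil w'(1))
  also have "mean (\<lambda>x. cmod (w' (real p * x))) = mean (\<lambda>x. cmod (w' x))"
    by (rule mean_dilate[OF circ_fun_norm[OF w'(1)] p(2)])
  also have "mean (\<lambda>x. cmod (w' x)) + 1 / real p * mean (\<lambda>x. cmod (w' x)) = (1 + 1 / real p) * mean (\<lambda>x. cmod (w' x))"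
    by (simp add: distrib_right)
  also have "\<dots> \<le> (1 + 1 / real p) * ((\<Prod>p\<in>Q. 1 + 1 / real p) * mean (\<lambda>x. cmod (w x)))"
    by (intro mult_left_mono w'(2)) auto
  finally have 1: "mean (\<lambda>x. cmod (v x)) \<le> (\<Prod>p\<in>insert p Q. 1 + 1 / real p) * mean (\<lambda>x. cmod (w x))"
    using insert.hyps by (simp add: mult.assoc)
  have 2: "fcoeff v k = (\<Sum>n\<in>S. if int n dvd k \<and> (\<forall>p\<in>insert p Q. \<not> int p dvd k div int n) then \<sigma> n * \<gamma> (k div int n) else 0)" for k
  proof -
    have "fcoeff v k = fcoeff w' k - \<rho> p / of_nat p * (if int p dvd k then fcoeff w' (k div int p) else 0)"
      unfolding v_def
      by (subst fcoeff_diff[OF w'(1) circ_fun_cmult[OF dil]]) (simp only: fcoeff_cmult fcoeff_dilate[OF w'(1) p(2)])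
    also have "\<rho> p / of_nat p * (if int p dvd k then fcoeff w' (k div int p) else 0) =
      (\<Sum>n\<in>S. if int n dvd k \<and> (\<forall>p\<in>Q. \<not> int p dvd k div int n) \<and> int p dvd k div int n then \<sigma> n * \<gamma> (k div int n) else 0)"
      (is "?L = (\<Sum>n\<in>S. ?r n)")
    proof (cases "int p dvd k")
      case True
      then obtain j where j: "k = int p * j" by (elim dvdE)
      have "?L = (\<Sum>n\<in>S. \<rho> p / of_nat p * (if int n dvd j \<and> (\<forall>p\<in>Q. \<not> int p dvd j div int n) then \<sigma> n * \<gamma> (j div int n) else 0))"
        using True p j by (simp add: w'(3) sum_distrib_left)
      also have "\<dots> = (\<Sum>n\<in>S. ?r n)"
      proof (rule sum.cong[OF refl])
        fix n assume "n \<in> S"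
        then have n: "int n > 0" using S by (auto intro: gr0I)
        show "\<rho> p / of_nat p * (if int n dvd j \<and> (\<forall>p\<in>Q. \<not> int p dvd j div int n) then \<sigma> n * \<gamma> (j div int n) else 0) = ?r n"
        proof (cases "int n dvd j")
          case True
          then obtain r where r: "j = int n * r" by (elim dvdE)
          have kr: "k = int n * (int p * r)" using j r by simp
          have kd: "k div int n = int p * r" "j div int n = r" unfolding kr r using n by simp_all
          \<comment> \<open>The primes sieved earlier are coprime to p, so dilation by p does not
            disturb what they removed.\<close>
          have "int p' dvd int p * r \<longleftrightarrow> int p' dvd r" if "p' \<in> Q" for p'
          proof -
            have "prime p'" "p' \<noteq> p" using that insert by auto
            then have "coprime (int p') (int p)" using p(1) primes_coprime by simp
            then show ?thesis by (rule coprime_dvd_mult_right_iff)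
          qed
          moreover have "int n dvd k" using kr by simp
          moreover have "\<gamma> (int p * r) = \<rho> p / of_nat p * \<gamma> r" using insert.prems(2)[of p r] by simp
          ultimately show ?thesis using True by (auto simp: kd)
        next
          case False
          have "\<not> (int n dvd k \<and> int p dvd k div int n)"
          proof
            assume a: "int n dvd k \<and> int p dvd k div int n"
            then obtain u where "k div int n = int p * u" by (auto elim: dvdE)
            then have "k = int n * (int p * u)" using a by (metis dvd_mult_div_cancel)
            then have "int p * j = int p * (int n * u)" using j by (simp add: mult_ac)
            then have "j = int n * u" using p(2) by simp
            then show False using False by simp
          qed
          then show ?thesis using False by auto
        qed
      qed
      finally show ?thesis .
    next
      case False
      have "(\<Sum>n\<in>S. ?r n) = 0"
      proof (rule sum.neutral, rule ballI)
        fix n assume "n \<in> S"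
        have "\<not> (int n dvd k \<and> int p dvd k div int n)" using False by (metis dvd_div_mult_self dvd_mult2)
        then show "?r n = 0" by auto
      qed
      then show ?thesis using False by simp
    qed
    finally show ?thesis
      unfolding w'(3) sum_subtractf[symmetric] by (simp only:) (intro sum.cong refl, auto)
  qed
  show ?case using vc 1 2 by blast
qed

section \<open>Square waves and their Fourier series\<close>

definition square_wave :: "real \<Rightarrow> real" where
  "square_wave x = (if frac x < 1/2 then 1 else -1)"

text \<open>The centred indicator of the middle third. It and \<open>sixth_wave\<close> are what the
  plain and the alternating sum over the 2k arcs become once dilations by 2k and by k are factored
  out.\<close>

definition third_wave :: "real \<Rightarrow> real" where
  "third_wave x = (if 1/3 \<le> frac x \<and> frac x < 2/3 then 2/3 else -1/3)"

definition sixth_wave :: "real \<Rightarrow> real" where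
  "sixth_wave x = (if 1/6 \<le> frac x \<and> frac x < 1/3 then 1 else if 2/3 \<le> frac x \<and> frac x < 5/6 then -1 else 0)"

lemma frac_eqI: "of_int j \<le> x \<Longrightarrow> x < of_int j + 1 \<Longrightarrow> frac x = x - of_int j" for x :: real
  by (simp add: frac_def floor_unique)

lemma circ_fun_waves: "circ_fun square_wave" "circ_fun third_wave" "circ_fun sixth_wave"
proof -
  show "circ_fun square_wave"
  proof (rule circ_funI[where C=1])
    show "square_wave \<in> borel_measurable borel"
      unfolding square_wave_def[abs_def] frac_def by measurable
  qed (simp_all add: square_wave_def frac_1_eq)
  show "circ_fun third_wave"
  proof (rule circ_funI[where C=1])
    show "third_wave \<in> borel_measurable borel"
      unfolding third_wave_def[abs_def] frac_def by measurable
  qed (simp_all add: third_wave_def frac_1_eq)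
  show "circ_fun sixth_wave"
  proof (rule circ_funI[where C=1])
    show "sixth_wave \<in> borel_measurable borel"
      unfolding sixth_wave_def[abs_def] frac_def by measurable
  qed (simp_all add: sixth_wave_def frac_1_eq)
qed

lemma sixth_wave_eq: "sixth_wave x = (square_wave x - square_wave (3 * x)) / 2"
proof -
  define y where "y = frac x"
  have y: "0 \<le> y" "y < 1" by (auto simp: y_def frac_lt_1)
  have "3 * x = 3 * y + of_int (3 * \<lfloor>x\<rfloor>)" by (simp add: y_def frac_def)
  then have sq: "square_wave (3 * x) = square_wave (3 * y)"
    using circ_fun_period_int[OF circ_fun_waves(1)] by metis
  consider "y < 1/6" | "1/6 \<le> y \<and> y < 1/3" | "1/3 \<le> y \<and> y < 1/2" | "1/2 \<le> y \<and> y < 2/3"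
    | "2/3 \<le> y \<and> y < 5/6" | "5/6 \<le> y" by linarith
  then show ?thesis
  proof cases
    case 1
    then have "frac (3 * y) = 3 * y" using frac_eqI[of 0 "3 * y"] y by simp
    then show ?thesis using 1 y unfolding sq by (simp add: sixth_wave_def square_wave_def flip: y_def)
  next
    case 2
    then have "frac (3 * y) = 3 * y" using frac_eqI[of 0 "3 * y"] y by simp
    then show ?thesis using 2 y unfolding sq by (simp add: sixth_wave_def square_wave_def flip: y_def)
  next
    case 3
    then have "frac (3 * y) = 3 * y - 1" using frac_eqI[of 1 "3 * y"] y by simp
    then show ?thesis using 3 y unfolding sq by (simp add: sixth_wave_def square_wave_def flip: y_def)
  next
    case 4
    then have "frac (3 * y) = 3 * y - 1" using frac_eqI[of 1 "3 * y"] y by simp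
    then show ?thesis using 4 y unfolding sq by (simp add: sixth_wave_def square_wave_def flip: y_def)
  next
    case 5
    then have "frac (3 * y) = 3 * y - 2" using frac_eqI[of 2 "3 * y"] y by simp
    then show ?thesis using 5 y unfolding sq by (simp add: sixth_wave_def square_wave_def flip: y_def)
  next
    case 6
    then have "frac (3 * y) = 3 * y - 2" using frac_eqI[of 2 "3 * y"] y by simp
    then show ?thesis using 6 y unfolding sq by (simp add: sixth_wave_def square_wave_def flip: y_def)
  qed
qed

lemma echar_half: "echar k (1/2) = (if even k then 1 else -1)"
proof -
  have "echar k (1/2) = cis (pi * of_int k)" by (simp add: echar_def)
  also have "\<dots> = (if even k then 1 else -1)"
  proof (cases "even k")
    case True
    then obtain j where "k = 2 * j" by (elim evenE)
    then show ?thesis using echar_of_int[of 1 j] True by (simp add: echar_def mult_ac)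
  next
    case False
    then obtain j where "k = 2 * j + 1" by (elim oddE)
    then have "pi * of_int k = 2 * pi * of_int j + pi" by (simp add: distrib_left)
    then have "cis (pi * of_int k) = cis (2 * pi * of_int j) * cis pi" by (simp only: cis_mult)
    also have "cis (2 * pi * of_int j) = 1" using echar_of_int[of j 1] by (simp add: echar_def)
    finally show ?thesis using False by (simp only: cis_pi if_False mult_1)
  qed
  finally show ?thesis .
qed

lemma fcoeff_square_wave:
  "fcoeff (\<lambda>x. of_real (square_wave x)) r = (if even r then 0 else 2 / (\<i> * of_real pi * of_int r))"
proof (cases "r = 0")
  case False
  have c: "circ_fun (\<lambda>x. complex_of_real (square_wave x) * echar (- r) x)"
    by (intro circ_fun_mult circ_fun_of_real circ_fun_waves circ_fun_echar)
  have "fcoeff (\<lambda>x. of_real (square_wave x)) r =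
    (LINT x:{0..<1/2}|lborel. complex_of_real (square_wave x) * echar (- r) x) +
    (LINT x:{1/2..<1}|lborel. complex_of_real (square_wave x) * echar (- r) x)"
    unfolding fcoeff_def mean_def by (rule set_integral_Ico_split[OF c]) auto
  also have "(LINT x:{0..<1/2}|lborel. complex_of_real (square_wave x) * echar (- r) x) = (LINT x:{0..<1/2}|lborel. echar (- r) x)"
    by (rule set_lebesgue_integral_cong) (auto simp: square_wave_def frac_eq)
  also have "(LINT x:{1/2..<1}|lborel. complex_of_real (square_wave x) * echar (- r) x) = (LINT x:{1/2..<1}|lborel. - echar (- r) x)"
    by (rule set_lebesgue_integral_cong) (auto simp: square_wave_def frac_eq)
  also have "\<dots> = - (LINT x:{1/2..<1}|lborel. echar (- r) x)"
    by (rule set_integral_uminus) (intro circ_fun_set_integrable circ_fun_echar)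
  finally have "fcoeff (\<lambda>x. of_real (square_wave x)) r = (2 * echar (- r) (1/2) - 2) / (2 * pi * \<i> * of_int (- r))"
    using False echar_of_int[of "- r" 0] echar_of_int[of "- r" 1]
    by (simp add: set_integral_echar diff_divide_distrib add_divide_distrib mult_ac)
  then show ?thesis using False by (cases "even r") (simp_all add: echar_half field_simps)
next
  case True
  have c: "circ_fun square_wave" by (rule circ_fun_waves)
  have "mean square_wave = (LINT x:{0..<1/2}|lborel. square_wave x) + (LINT x:{1/2..<1}|lborel. square_wave x)"
    unfolding mean_def by (rule set_integral_Ico_split[OF c]) auto
  also have "(LINT x:{0..<1/2}|lborel. square_wave x) = (LINT x:{0..<1/2::real}|lborel. 1)"
    by (rule set_lebesgue_integral_cong) (auto simp: square_wave_def frac_eq)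
  also have "(LINT x:{1/2..<1}|lborel. square_wave x) = (LINT x:{1/2..<1::real}|lborel. -1)"
    by (rule set_lebesgue_integral_cong) (auto simp: square_wave_def frac_eq)
  finally have "mean square_wave = 0" by (simp add: set_lebesgue_integral_def)
  then show ?thesis using True by (simp add: fcoeff_def mean_of_real)
qed

text \<open>The nonprincipal character modulo 3. Its complete multiplicativity is what allows the
  cosine series to be sieved.\<close>

definition chi3 :: "int \<Rightarrow> real" where
  "chi3 r = (if r mod 3 = 1 then 1 else if r mod 3 = 2 then -1 else 0)"

lemma chi3_mult: "chi3 (a * b) = chi3 a * chi3 b"
proof -
  have "a mod 3 = 0 \<or> a mod 3 = 1 \<or> a mod 3 = 2" "b mod 3 = 0 \<or> b mod 3 = 1 \<or> b mod 3 = 2" by presburger+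
  moreover have "(a * b) mod 3 = ((a mod 3) * (b mod 3)) mod 3" by (simp add: mod_mult_eq)
  ultimately show ?thesis unfolding chi3_def by (elim disjE) simp_all
qed

lemma abs_chi3_le: "\<bar>chi3 r\<bar> \<le> 1" by (simp add: chi3_def)

text \<open>The Gauss sum of \<open>chi3\<close>, up to sign: it turns the endpoints 1/3 and 2/3 of
  the interval into the character.\<close>

lemma echar_thirds: "echar (- r) (2/3) - echar (- r) (1/3) = \<i> * of_real (sqrt 3 * chi3 r)"
proof -
  have s: "sin (2 * pi / 3) = sqrt 3 / 2" "cos (2 * pi / 3) = - 1 / 2"
    using sin_120' cos_120' by (simp_all add: mult.commute)
  define z where "z = cis (2 * pi / 3)"
  have z: "z = Complex (-1/2) (sqrt 3 / 2)" using s by (simp add: z_def complex_eq_iff)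
  have e1: "echar (-1) (1/3) = cnj z" by (simp add: echar_def z_def cis_cnj)
  have e2: "echar (-1) (2/3) = z"
  proof -
    have "echar (-1) (2/3) = echar (-1) (1 + (- 1/3))" by simp
    also have "\<dots> = echar (-1) (of_int 1) * echar (-1) (-1/3)" by (subst echar_add_arg) simp
    also have "\<dots> = echar (-1) (-1/3)" by (simp only: echar_of_int mult_1)
    also have "\<dots> = z" by (simp add: echar_def z_def)
    finally show ?thesis .
  qed
  have zz: "z - cnj z = \<i> * of_real (sqrt 3)" by (simp add: z complex_eq_iff)
  define j where "j = r div 3"
  have red: "echar (- r) (of_int u / 3) = echar (- (r mod 3)) (of_int u / 3)" for u
  proof -
    have r: "- r = - (r mod 3) + (- 3 * j)" unfolding j_def by presburger
    have "echar (- 3 * j) (of_int u / 3) = echar (- j) (of_int u)" by (simp add: echar_def mult_ac)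
    then have "echar (- 3 * j) (of_int u / 3) = 1" by (simp only: echar_of_int)
    then show ?thesis by (subst r) (simp only: echar_add mult_1_right)
  qed
  have r2: "echar (- r) (2/3) = echar (- (r mod 3)) (2/3)" and r1: "echar (- r) (1/3) = echar (- (r mod 3)) (1/3)"
    using red[of 2] red[of 1] by simp_all
  have "r mod 3 = 0 \<or> r mod 3 = 1 \<or> r mod 3 = 2" by presburger
  then show ?thesis
  proof (elim disjE)
    assume "r mod 3 = 0" then show ?thesis by (simp add: r1 r2 chi3_def)
  next
    assume "r mod 3 = 1" then show ?thesis using e1 e2 zz by (simp add: r1 r2 chi3_def)
  next
    assume m: "r mod 3 = 2"
    have "echar (-2) (1/3) = z" using e2 by (simp add: echar_def)
    moreover have "echar (-2) (2/3) = cnj z"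
    proof -
      have "echar (-2) (2/3) = echar (-1) (of_int 1 + 1/3)" by (simp add: echar_def)
      also have "\<dots> = cnj z" using e1 by (simp only: echar_add_arg echar_of_int mult_1)
      finally show ?thesis .
    qed
    ultimately have "echar (- r) (2/3) - echar (- r) (1/3) = - (z - cnj z)" using m by (simp add: r1 r2)
    then show ?thesis using m by (simp add: zz chi3_def)
  qed
qed

lemma fcoeff_third_wave:
  "fcoeff (\<lambda>x. of_real (third_wave x)) r = of_real (- sqrt 3 * chi3 r) / (2 * of_real pi * of_int r)"
proof (cases "r = 0")
  case False
  define I where "I = (\<lambda>x::real. if 1/3 \<le> frac x \<and> frac x < 2/3 then 1 else 0 :: real)"
  have Ic: "circ_fun I"
  proof (rule circ_funI[where C=1])
    show "I \<in> borel_measurable borel" unfolding I_def frac_def by measurable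
  qed (simp_all add: I_def frac_1_eq)
  have c: "circ_fun (\<lambda>x. complex_of_real (I x) * echar (- r) x)"
    by (intro circ_fun_mult circ_fun_of_real Ic circ_fun_echar)
  have "(\<lambda>x. complex_of_real (third_wave x)) = (\<lambda>x. complex_of_real (I x) - (1/3 :: complex) * echar 0 x)"
    by (auto simp: third_wave_def I_def)
  then have "fcoeff (\<lambda>x. of_real (third_wave x)) r = fcoeff (\<lambda>x. complex_of_real (I x)) r - (1/3 :: complex) * fcoeff (echar 0) r"
    using fcoeff_diff[OF circ_fun_of_real[OF Ic] circ_fun_cmult[OF circ_fun_echar], of "1/3" 0 r] by (simp only: fcoeff_cmult)
  also have "fcoeff (echar 0) r = 0" using False by (simp add: fcoeff_echar)
  also have "fcoeff (\<lambda>x. complex_of_real (I x)) r =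
    (LINT x:{0..<1/3}|lborel. complex_of_real (I x) * echar (- r) x) +
    (LINT x:{1/3..<1}|lborel. complex_of_real (I x) * echar (- r) x)"
    unfolding fcoeff_def mean_def by (rule set_integral_Ico_split[OF c]) auto
  also have "(LINT x:{1/3..<1}|lborel. complex_of_real (I x) * echar (- r) x) =
    (LINT x:{1/3..<2/3}|lborel. complex_of_real (I x) * echar (- r) x) +
    (LINT x:{2/3..<1}|lborel. complex_of_real (I x) * echar (- r) x)"
    by (rule set_integral_Ico_split[OF c]) auto
  also have "(LINT x:{0..<1/3}|lborel. complex_of_real (I x) * echar (- r) x) = (LINT x:{0..<1/3::real}|lborel. 0)"
    by (rule set_lebesgue_integral_cong) (auto simp: I_def frac_eq)
  also have "(LINT x:{2/3..<1}|lborel. complex_of_real (I x) * echar (- r) x) = (LINT x:{2/3..<1::real}|lborel. 0)"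
    by (rule set_lebesgue_integral_cong) (auto simp: I_def frac_eq)
  also have "(LINT x:{1/3..<2/3}|lborel. complex_of_real (I x) * echar (- r) x) = (LINT x:{1/3..<2/3}|lborel. echar (- r) x)"
    by (rule set_lebesgue_integral_cong) (auto simp: I_def frac_eq)
  also have "\<dots> = (\<i> * of_real (sqrt 3 * chi3 r)) / (2 * pi * \<i> * of_int (- r))"
    using False by (subst set_integral_echar) (auto simp: echar_thirds)
  finally show ?thesis using False by (simp add: set_lebesgue_integral_def field_simps)
next
  case True
  have c: "circ_fun third_wave" by (rule circ_fun_waves)
  have "mean third_wave = (LINT x:{0..<1/3}|lborel. third_wave x) + (LINT x:{1/3..<1}|lborel. third_wave x)"
    unfolding mean_def by (rule set_integral_Ico_split[OF c]) auto
  also have "(LINT x:{1/3..<1}|lborel. third_wave x) = (LINT x:{1/3..<2/3}|lborel. third_wave x) + (LINT x:{2/3..<1}|lborel. third_wave x)"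
    by (rule set_integral_Ico_split[OF c]) auto
  also have "(LINT x:{0..<1/3}|lborel. third_wave x) = (LINT x:{0..<1/3::real}|lborel. -1/3)"
    by (rule set_lebesgue_integral_cong) (auto simp: third_wave_def frac_eq)
  also have "(LINT x:{2/3..<1}|lborel. third_wave x) = (LINT x:{2/3..<1::real}|lborel. -1/3)"
    by (rule set_lebesgue_integral_cong) (auto simp: third_wave_def frac_eq)
  also have "(LINT x:{1/3..<2/3}|lborel. third_wave x) = (LINT x:{1/3..<2/3::real}|lborel. 2/3)"
    by (rule set_lebesgue_integral_cong) (auto simp: third_wave_def frac_eq)
  finally have "mean third_wave = 0" by (simp add: set_lebesgue_integral_def)
  then show ?thesis using True by (simp add: fcoeff_def mean_of_real)
qed

text \<open>The symmetric difference of A and 3A, which is what survives the cancellation in a sum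
  of g(n) - g(3n) over A.\<close>

definition tripling_boundary :: "nat set \<Rightarrow> nat set" where
  "tripling_boundary A = (A - (\<lambda>n. 3 * n) ` A) \<union> ((\<lambda>n. 3 * n) ` A - A)"

lemma sum_tripling_boundary:
  fixes g :: "nat \<Rightarrow> complex"
  assumes "finite A"
  shows "(\<Sum>n\<in>A. g n - g (3 * n)) = (\<Sum>n\<in>tripling_boundary A. (if n \<in> A then 1 else -1) * g n)"
proof -
  let ?B = "(\<lambda>n. 3 * n) ` A"
  have fB: "finite ?B" using assms by simp
  have "(\<Sum>n\<in>A. g n - g (3 * n)) = sum g A - sum g ?B"
    by (simp add: sum_subtractf sum.reindex inj_on_def)
  also have "sum g A = sum g (A - ?B) + sum g (A \<inter> ?B)"
    by (subst sum.Int_Diff[OF assms, of _ ?B]) (simp add: add.commute)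
  also have "sum g ?B = sum g (?B - A) + sum g (A \<inter> ?B)"
    by (subst sum.Int_Diff[OF fB, of _ A]) (simp add: add.commute Int_commute)
  also have "sum g (A - ?B) = (\<Sum>n\<in>A - ?B. (if n \<in> A then 1 else -1) * g n)"
    by (rule sum.cong) auto
  also have "sum g (?B - A) = - (\<Sum>n\<in>?B - A. (if n \<in> A then 1 else -1) * g n)"
    unfolding sum_negf[symmetric] by (rule sum.cong) auto
  finally have "(\<Sum>n\<in>A. g n - g (3 * n)) =
    (\<Sum>n\<in>A - ?B. (if n \<in> A then 1 else -1) * g n) + (\<Sum>n\<in>?B - A. (if n \<in> A then 1 else -1) * g n)" by simp
  also have "\<dots> = (\<Sum>n\<in>tripling_boundary A. (if n \<in> A then 1 else -1) * g n)"
    unfolding tripling_boundary_def using assms by (intro sum.union_disjoint[symmetric]) auto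
  finally show ?thesis .
qed

lemma fcoeff_dilates:
  assumes g: "circ_fun g" and S: "0 \<notin> S"
  shows "fcoeff (\<lambda>x. \<Sum>n\<in>S. \<sigma> n * g (real n * x)) k = (\<Sum>n\<in>S. if int n dvd k then \<sigma> n * fcoeff g (k div int n) else 0)"
proof -
  have "fcoeff (\<lambda>x. \<Sum>n\<in>S. \<sigma> n * g (real n * x)) k = (\<Sum>n\<in>S. \<sigma> n * fcoeff (\<lambda>x. g (real n * x)) k)"
    by (subst fcoeff_sum) (auto simp: fcoeff_cmult intro!: circ_fun_cmult circ_fun_dilate g)
  also have "\<dots> = (\<Sum>n\<in>S. if int n dvd k then \<sigma> n * fcoeff g (k div int n) else 0)"
  proof (rule sum.cong[OF refl])
    fix n assume "n \<in> S"
    then have "n > 0" using S by (auto intro: gr0I)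
    from fcoeff_dilate[OF g this]
    show "\<sigma> n * fcoeff (\<lambda>x. g (real n * x)) k = (if int n dvd k then \<sigma> n * fcoeff g (k div int n) else 0)" by simp
  qed
  finally show ?thesis .
qed

lemma mean_norm_differences_le:
  fixes g :: "real \<Rightarrow> real"
  assumes g: "circ_fun g" and K: "mean (\<lambda>x. \<bar>\<Sum>n\<in>A. g (real n * x)\<bar>) \<le> K"
  shows "mean (\<lambda>x. cmod (\<Sum>n\<in>A. of_real (g (real n * x)) - of_real (g (real (3 * n) * x)))) \<le> 2 * K"
proof -
  define G where "G x = (\<Sum>n\<in>A. g (real n * x))" for x
  have G: "circ_fun G" unfolding G_def by (intro circ_fun_sum circ_fun_dilate g)
  have G3: "circ_fun (\<lambda>x. G (real 3 * x))" by (rule circ_fun_dilate[OF G])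
  have "(\<Sum>n\<in>A. complex_of_real (g (real n * x)) - of_real (g (real (3 * n) * x))) = of_real (G x - G (real 3 * x))" for x
    by (simp add: G_def sum_subtractf mult_ac)
  then have "mean (\<lambda>x. cmod (\<Sum>n\<in>A. of_real (g (real n * x)) - of_real (g (real (3 * n) * x)))) = mean (\<lambda>x. \<bar>G x - G (real 3 * x)\<bar>)"
    by (simp only: norm_of_real)
  also have "\<dots> \<le> mean (\<lambda>x. norm (G x) + norm (G (real 3 * x)))"
  proof (rule mean_mono)
    have "circ_fun (\<lambda>x. norm (G x - G (real 3 * x)))" by (intro circ_fun_norm circ_fun_diff G G3)
    then show "circ_fun (\<lambda>x. \<bar>G x - G (real 3 * x)\<bar>)" by simp
  qed (use circ_fun_add[OF circ_fun_norm[OF G] circ_fun_norm[OF G3]] in auto)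
  also have "\<dots> = mean (\<lambda>x. norm (G x)) + mean (\<lambda>x. norm (G (real 3 * x)))"
    by (rule mean_add) (intro circ_fun_norm G G3)+
  also have "mean (\<lambda>x. norm (G (real 3 * x))) = mean (\<lambda>x. norm (G x))"
    by (rule mean_dilate[OF circ_fun_norm[OF G]]) simp
  also have "mean (\<lambda>x. norm (G x)) \<le> K" using K by (simp add: G_def)
  finally show ?thesis by simp
qed

text \<open>The constant is 800 * 6 * 2 e^4: 800 from the test function, 2 e^4 from the Mertens
  product, and 6 from the L^1 norm 2K of each differenced sum and the normalising factors, whose
  moduli add up to at most 3.\<close>

theorem blocks_le_mean_waves:
  fixes A :: "nat set" and K :: real and q J :: nat
  assumes A: "finite A" "0 \<notin> A"
    and K: "mean (\<lambda>x. \<bar>\<Sum>n\<in>A. sixth_wave (real n * x)\<bar>) \<le> K" "mean (\<lambda>x. \<bar>\<Sum>n\<in>A. third_wave (real n * x)\<bar>) \<le> K"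
    and q: "q \<ge> 1" "2 * real (card A) \<le> exp (2 * real q)"
    and J: "J > 0" "(\<Sum>i<J. 4 ^ i) \<le> card (tripling_boundary A)"
  shows "real J \<le> 9600 * exp 4 * ln (10 ^ 10 * (real q)\<^sup>2) * K"
proof -
  define S where "S = tripling_boundary A"
  define \<sigma> :: "nat \<Rightarrow> complex" where "\<sigma> n = (if n \<in> A then 1 else -1)" for n
  have S: "finite S" "0 \<notin> S" using A by (auto simp: S_def tripling_boundary_def)
  \<comment> \<open>Meets both demands of the rough tail, P \<ge> 10^10 and
    \<open>q\<^sup>2 \<le> P\<close>, while ln P is only a constant plus 2 ln q.\<close>
  define P where "P = 10 ^ 10 * q\<^sup>2"
  have P: "P \<ge> 10 ^ 10" "q\<^sup>2 \<le> P" using q(1) by (auto simp: P_def)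
  have P3: "P \<ge> 3" by (rule order_trans[OF _ P(1)]) simp
  have K0: "K \<ge> 0"
  proof -
    have "0 \<le> mean (\<lambda>x. norm (\<Sum>n\<in>A. third_wave (real n * x)))"
      by (rule mean_nonneg) (intro circ_fun_norm circ_fun_sum circ_fun_dilate circ_fun_waves, simp)
    then show ?thesis using K(2) by simp
  qed
  define Q where "Q = {p. prime p \<and> p \<le> P}"
  have Q: "finite Q" "\<And>p. p \<in> Q \<Longrightarrow> prime p" by (auto simp: Q_def)
  define M where "M = 2 * exp 4 * ln (real P)"
  have M: "(\<Prod>p\<in>Q. 1 + 1 / real p) \<le> M"
    unfolding Q_def M_def by (rule prod_primes_one_plus_inverse_le[OF P3])
  have M': "(\<Prod>p\<in>Q - {2}. 1 + 1 / real p) \<le> M"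
  proof -
    have "(\<Prod>p\<in>Q - {2}. 1 + 1 / real p) \<le> (\<Prod>p\<in>Q. 1 + 1 / real p)"
      using Q by (intro prod_mono2) auto
    then show ?thesis using M by linarith
  qed
  have M0: "M \<ge> 0"
    using M prod_nonneg[of Q "\<lambda>p. 1 + 1 / real p"] by (metis add_nonneg_nonneg divide_nonneg_nonneg of_nat_0_le_iff order_trans zero_le_one)

  define \<gamma>q where "\<gamma>q r = fcoeff (\<lambda>x. complex_of_real (square_wave x)) r" for r
  define \<gamma>c where "\<gamma>c r = fcoeff (\<lambda>x. complex_of_real (third_wave x)) r" for r
  define wq where "wq x = (\<Sum>n\<in>S. \<sigma> n * complex_of_real (square_wave (real n * x)))" for x
  define wc where "wc x = (\<Sum>n\<in>S. \<sigma> n * complex_of_real (third_wave (real n * x)))" for x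
  have sq: "circ_fun (\<lambda>x. complex_of_real (square_wave x))" and tw: "circ_fun (\<lambda>x. complex_of_real (third_wave x))"
    by (intro circ_fun_of_real circ_fun_waves)+
  have wqc: "circ_fun wq" and wcc: "circ_fun wc"
    unfolding wq_def wc_def using circ_fun_dilate[OF sq] circ_fun_dilate[OF tw] by (auto intro!: circ_fun_sum circ_fun_cmult)
  have wqf: "fcoeff wq k = (\<Sum>n\<in>S. if int n dvd k then \<sigma> n * \<gamma>q (k div int n) else 0)" for k
    unfolding wq_def \<gamma>q_def by (rule fcoeff_dilates[OF sq S(2)])
  have wcf: "fcoeff wc k = (\<Sum>n\<in>S. if int n dvd k then \<sigma> n * \<gamma>c (k div int n) else 0)" for k
    unfolding wc_def \<gamma>c_def by (rule fcoeff_dilates[OF tw S(2)])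
  have wqm: "mean (\<lambda>x. cmod (wq x)) \<le> 2 * K"
  proof -
    have "wq x = of_real (2 * (\<Sum>n\<in>A. sixth_wave (real n * x)))" for x
    proof -
      have "wq x = (\<Sum>n\<in>A. complex_of_real (square_wave (real n * x)) - of_real (square_wave (real (3 * n) * x)))"
        unfolding wq_def S_def \<sigma>_def by (rule sum_tripling_boundary[OF A(1), symmetric])
      also have "\<dots> = (\<Sum>n\<in>A. of_real (2 * sixth_wave (real n * x)))"
        by (intro sum.cong refl) (simp add: sixth_wave_eq mult.assoc)
      finally show ?thesis by (simp add: sum_distrib_left)
    qed
    then have "cmod (wq x) = 2 * \<bar>\<Sum>n\<in>A. sixth_wave (real n * x)\<bar>" for x
      by (simp only: norm_of_real abs_mult)
    then show ?thesis using K(1) by (simp add: mean_cmult)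
  qed
  have wcm: "mean (\<lambda>x. cmod (wc x)) \<le> 2 * K"
  proof -
    have "wc x = (\<Sum>n\<in>A. complex_of_real (third_wave (real n * x)) - of_real (third_wave (real (3 * n) * x)))" for x
      unfolding wc_def S_def \<sigma>_def by (rule sum_tripling_boundary[OF A(1), symmetric])
    then show ?thesis using mean_norm_differences_le[OF circ_fun_waves(2) K(2)] by presburger
  qed

  \<comment> \<open>The square wave has no coefficient at even r, so it is sieved by odd primes
    only.\<close>
  have "\<exists>w'. circ_fun w' \<and> mean (\<lambda>x. cmod (w' x)) \<le> (\<Prod>p\<in>Q - {2}. 1 + 1 / real p) * mean (\<lambda>x. cmod (wq x)) \<and>
    (\<forall>k. fcoeff w' k = (\<Sum>n\<in>S. if int n dvd k \<and> (\<forall>p\<in>Q - {2}. \<not> int p dvd k div int n) then \<sigma> n * \<gamma>q (k div int n) else 0))"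
  proof (rule sieve_primes[where \<rho>="\<lambda>_. 1"])
    fix p r assume p: "p \<in> Q - {2}"
    then have "odd (int p)" using Q(2)[of p] prime_odd_nat[of p] prime_ge_2_nat[of p] by auto
    then show "\<gamma>q (int p * r) = 1 / of_nat p * \<gamma>q r" unfolding \<gamma>q_def fcoeff_square_wave by simp
  qed (use Q S wqc wqf in auto)
  then obtain vq where vq: "circ_fun vq" "mean (\<lambda>x. cmod (vq x)) \<le> (\<Prod>p\<in>Q - {2}. 1 + 1 / real p) * mean (\<lambda>x. cmod (wq x))"
    "\<And>k. fcoeff vq k = (\<Sum>n\<in>S. if int n dvd k \<and> (\<forall>p\<in>Q - {2}. \<not> int p dvd k div int n) then \<sigma> n * \<gamma>q (k div int n) else 0)"
    by blast
  have "\<exists>w'. circ_fun w' \<and> mean (\<lambda>x. cmod (w' x)) \<le> (\<Prod>p\<in>Q. 1 + 1 / real p) * mean (\<lambda>x. cmod (wc x)) \<and>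
    (\<forall>k. fcoeff w' k = (\<Sum>n\<in>S. if int n dvd k \<and> (\<forall>p\<in>Q. \<not> int p dvd k div int n) then \<sigma> n * \<gamma>c (k div int n) else 0))"
  proof (rule sieve_primes[where \<rho>="\<lambda>p. of_real (chi3 (int p))"])
    fix p r assume "p \<in> Q"
    show "\<gamma>c (int p * r) = of_real (chi3 (int p)) / of_nat p * \<gamma>c r" unfolding \<gamma>c_def fcoeff_third_wave by (simp add: chi3_mult mult_ac)
  qed (use Q S wcc wcf abs_chi3_le in auto)
  then obtain vc where vc: "circ_fun vc" "mean (\<lambda>x. cmod (vc x)) \<le> (\<Prod>p\<in>Q. 1 + 1 / real p) * mean (\<lambda>x. cmod (wc x))"
    "\<And>k. fcoeff vc k = (\<Sum>n\<in>S. if int n dvd k \<and> (\<forall>p\<in>Q. \<not> int p dvd k div int n) then \<sigma> n * \<gamma>c (k div int n) else 0)"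
    by blast
  have nn: "0 \<le> mean (\<lambda>x. cmod (wq x))" "0 \<le> mean (\<lambda>x. cmod (wc x))"
    by (rule mean_nonneg[OF circ_fun_norm]; (intro wqc wcc)?; simp)+
  have vqm: "mean (\<lambda>x. cmod (vq x)) \<le> M * (2 * K)"
    using vq(2) mult_mono[OF M' wqm M0 nn(1)] by linarith
  have vcm: "mean (\<lambda>x. cmod (vc x)) \<le> M * (2 * K)"
    using vc(2) mult_mono[OF M wcm M0 nn(2)] by linarith

  \<comment> \<open>These factors normalise the coefficients to 1/(2r) at odd r and to chi3(r)/(2r),
    so that they add at r = 1 and cancel at r = -1.\<close>
  define cq where "cq = \<i> * of_real pi / 4"
  define cc where "cc = complex_of_real (- (pi / sqrt 3))"
  define w where "w x = cq * vq x + cc * vc x" for x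
  define \<phi> :: "int \<Rightarrow> complex" where
    "\<phi> r = (if \<forall>p\<in>Q. \<not> int p dvd r then of_real ((1 + chi3 r) / (2 * of_int r)) else 0)" for r
  have two: "2 \<in> Q" using P3 by (simp add: Q_def)
  have wcirc: "circ_fun w" unfolding w_def by (intro circ_fun_add circ_fun_cmult vq(1) vc(1))
  have wf: "fcoeff w k = (\<Sum>n\<in>S. if int n dvd k then \<sigma> n * \<phi> (k div int n) else 0)" for k
  proof -
    have "fcoeff w k = cq * fcoeff vq k + cc * fcoeff vc k"
      unfolding w_def by (subst fcoeff_add) (intro circ_fun_cmult vq(1) vc(1) | simp add: fcoeff_cmult)+
    also have "\<dots> = (\<Sum>n\<in>S. if int n dvd k then \<sigma> n * \<phi> (k div int n) else 0)"
      unfolding vq(3) vc(3) sum_distrib_left sum.distrib[symmetric]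
    proof (rule sum.cong[OF refl])
      fix n assume "n \<in> S"
      define r where "r = k div int n"
      have 1: "cq * \<gamma>q r = (if even r then 0 else 1 / (2 * of_int r))"
        unfolding \<gamma>q_def fcoeff_square_wave cq_def by (cases "r = 0") (auto simp: field_simps)
      have 2: "cc * \<gamma>c r = of_real (chi3 r) / (2 * of_int r)"
      proof -
        have "sqrt 3 \<noteq> (0::real)" by simp
        then show ?thesis unfolding \<gamma>c_def fcoeff_third_wave cc_def by (cases "r = 0") (auto simp: field_simps)
      qed
      show "cq * (if int n dvd k \<and> (\<forall>p\<in>Q - {2}. \<not> int p dvd k div int n) then \<sigma> n * \<gamma>q (k div int n) else 0) +
          cc * (if int n dvd k \<and> (\<forall>p\<in>Q. \<not> int p dvd k div int n) then \<sigma> n * \<gamma>c (k div int n) else 0) =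
          (if int n dvd k then \<sigma> n * \<phi> (k div int n) else 0)"
        unfolding r_def[symmetric]
      proof (cases "\<forall>p\<in>Q. \<not> int p dvd r")
        case True
        then have odd: "odd r" using two by force
        have "cq * (\<sigma> n * \<gamma>q r) + cc * (\<sigma> n * \<gamma>c r) = \<sigma> n * (cq * \<gamma>q r + cc * \<gamma>c r)" by (simp add: algebra_simps)
        also have "\<dots> = \<sigma> n * \<phi> r" unfolding 1 2 using True odd by (simp add: \<phi>_def add_divide_distrib)
        finally show "cq * (if int n dvd k \<and> (\<forall>p\<in>Q - {2}. \<not> int p dvd r) then \<sigma> n * \<gamma>q r else 0) +
          cc * (if int n dvd k \<and> (\<forall>p\<in>Q. \<not> int p dvd r) then \<sigma> n * \<gamma>c r else 0) =
          (if int n dvd k then \<sigma> n * \<phi> r else 0)" using True by auto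
      next
        case False
        have "cq * (\<sigma> n * \<gamma>q r) = 0" if "\<forall>p\<in>Q - {2}. \<not> int p dvd r"
        proof -
          have "even r" using False that by force
          then show ?thesis using 1 by auto
        qed
        then have z: "cq * (if int n dvd k \<and> (\<forall>p\<in>Q - {2}. \<not> int p dvd r) then \<sigma> n * \<gamma>q r else 0) = 0" by auto
        have F: "(int n dvd k \<and> (\<forall>p\<in>Q. \<not> int p dvd r)) = False" using False by blast
        have phi0: "\<phi> r = 0" unfolding \<phi>_def using False by (rule if_not_P)
        show "cq * (if int n dvd k \<and> (\<forall>p\<in>Q - {2}. \<not> int p dvd r) then \<sigma> n * \<gamma>q r else 0) +
          cc * (if int n dvd k \<and> (\<forall>p\<in>Q. \<not> int p dvd r) then \<sigma> n * \<gamma>c r else 0) =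
          (if int n dvd k then \<sigma> n * \<phi> r else 0)" unfolding z F phi0 by simp
      qed
    qed
    finally show ?thesis .
  qed
  have "real J \<le> 800 * mean (\<lambda>x. cmod (w x))"
  proof (rule mean_norm_ge_rough[OF S])
    show "cmod (\<sigma> n) = 1" for n by (simp add: \<sigma>_def)
    have "\<not> int p dvd 1" if "p \<in> Q" for p
      using prime_gt_1_nat[OF Q(2)[OF that]] by simp
    then show "\<phi> 1 = 1" by (simp add: \<phi>_def chi3_def)
    show "cmod (\<phi> m) \<le> 1 / \<bar>real_of_int m\<bar>" for m
    proof -
      have "\<bar>1 + chi3 m\<bar> / (2 * \<bar>real_of_int m\<bar>) \<le> 2 / (2 * \<bar>real_of_int m\<bar>)"
        by (intro divide_right_mono) (auto simp: chi3_def)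
      also have "\<dots> = 1 / \<bar>real_of_int m\<bar>" by simp
      finally have "cmod (complex_of_real ((1 + chi3 m) / (2 * of_int m))) \<le> 1 / \<bar>real_of_int m\<bar>"
        by (simp only: norm_of_real abs_divide abs_mult abs_numeral)
      moreover have "cmod (\<phi> m) \<le> cmod (complex_of_real ((1 + chi3 m) / (2 * of_int m)))"
      proof (cases "\<forall>p\<in>Q. \<not> int p dvd m")
        case True
        then have "\<phi> m = of_real ((1 + chi3 m) / (2 * of_int m))" unfolding \<phi>_def by (rule if_P)
        then show ?thesis by (simp only: order_refl)
      next
        case False
        then have "\<phi> m = 0" unfolding \<phi>_def by (rule if_not_P)
        then show ?thesis by (simp only: norm_zero norm_ge_zero)
      qed
      ultimately show ?thesis by linarith
    qed
    show "\<bar>m\<bar> > 1 \<and> (\<forall>p. prime p \<longrightarrow> int p dvd m \<longrightarrow> p > P)" if "m \<noteq> 1" "\<phi> m \<noteq> 0" for m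
    proof -
      have nd: "\<forall>p\<in>Q. \<not> int p dvd m"
      proof (rule ccontr)
        assume "\<not> ?thesis"
        then have "\<phi> m = 0" unfolding \<phi>_def by (rule if_not_P)
        then show False using that(2) by simp
      qed
      have c1: "1 + chi3 m \<noteq> 0"
      proof
        assume z: "1 + chi3 m = 0"
        have "\<phi> m = 0" unfolding \<phi>_def z by simp
        then show False using that(2) by simp
      qed
      have c2: "m \<noteq> 0"
      proof
        assume z: "m = 0"
        have "\<phi> m = 0" unfolding \<phi>_def z by simp
        then show False using that(2) by simp
      qed
      \<comment> \<open>The unit -1 is the one integer besides 1 that no prime divides; it drops out
        because chi3(-1) = -1.\<close>
      have "m \<noteq> -1" using c1 by (auto simp: chi3_def)
      then show ?thesis using that(1) c2 nd by (auto simp: Q_def not_le)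
    qed
    show "P \<ge> 10 ^ 10" "q \<ge> 1" "q\<^sup>2 \<le> P" "J > 0" using P q J by auto
    have cS: "card S \<le> 2 * card A"
    proof -
      have "card S \<le> card (A - (\<lambda>n. 3 * n) ` A) + card ((\<lambda>n. 3 * n) ` A - A)"
        unfolding S_def tripling_boundary_def by (rule card_Un_le)
      also have "\<dots> \<le> card A + card ((\<lambda>n. 3 * n) ` A)" using A by (intro add_mono card_mono) auto
      also have "\<dots> \<le> 2 * card A" using card_image_le[OF A(1), of "\<lambda>n. 3 * n"] by simp
      finally show ?thesis .
    qed
    have "real (card S) \<le> real (2 * card A)" using cS by (rule of_nat_mono)
    then show cSe: "real (card S) \<le> exp (2 * real q)" using q(2) by simp
    show JS: "(\<Sum>i<J. 4 ^ i) \<le> card S" using J by (simp add: S_def)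
    show "4 * J \<le> P"
    proof -
      have "(4::nat) ^ (J - 1) \<le> (\<Sum>i<J. 4 ^ i)" using J(1) by (intro member_le_sum) auto
      then have "4 ^ (J - 1) \<le> card S" using JS by linarith
      then have "real (4 ^ (J - 1)) \<le> real (card S)" by (rule of_nat_mono)
      then have "real (4 ^ (J - 1)) \<le> exp (2 * real q)" using cSe by (rule order_trans)
      then have "(4::real) ^ (J - 1) \<le> exp (2 * real q)" by (simp only: of_nat_power of_nat_numeral)
      moreover have "exp (real (J - 1)) \<le> (4::real) ^ (J - 1)"
      proof -
        have "exp (real (J - 1)) = exp 1 ^ (J - 1)" by (simp flip: exp_of_nat_mult)
        also have "\<dots> \<le> 4 ^ (J - 1)" using e_less_272 by (intro power_mono) auto
        finally show ?thesis .
      qed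
      ultimately have "exp (real (J - 1)) \<le> exp (2 * real q)" by linarith
      then have "J - 1 \<le> 2 * q" by simp
      then have "4 * J \<le> 12 * q" using q(1) by linarith
      also have "\<dots> \<le> 10 ^ 10 * q\<^sup>2" using q(1) by (simp add: power2_eq_square)
      finally show ?thesis by (simp add: P_def)
    qed
  qed (use wcirc wf in auto)
  also have "mean (\<lambda>x. cmod (w x)) \<le> 6 * (M * K)"
  proof -
    have "mean (\<lambda>x. cmod (w x)) \<le> mean (\<lambda>x. cmod cq * cmod (vq x) + cmod cc * cmod (vc x))"
    proof (rule mean_mono)
      show "cmod (w x) \<le> cmod cq * cmod (vq x) + cmod cc * cmod (vc x)" for x
        unfolding w_def by (metis norm_mult norm_triangle_ineq)
    qed (intro circ_fun_norm circ_fun_add circ_fun_cmult wcirc vq(1) vc(1))+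
    also have "\<dots> = cmod cq * mean (\<lambda>x. cmod (vq x)) + cmod cc * mean (\<lambda>x. cmod (vc x))"
      by (subst mean_add) (simp_all only: mean_cmult circ_fun_norm circ_fun_cmult vq(1) vc(1))
    also have "\<dots> \<le> cmod cq * (M * (2 * K)) + cmod cc * (M * (2 * K))"
      by (intro add_mono mult_left_mono vqm vcm) auto
    also have "\<dots> = (cmod cq + cmod cc) * 2 * (M * K)" by (simp add: algebra_simps)
    also have "\<dots> \<le> 3 * 2 * (M * K)"
    proof (intro mult_right_mono)
      have "cmod cq = pi / 4" by (simp add: cq_def norm_mult norm_divide)
      moreover have "cmod cc = pi / sqrt 3" unfolding cc_def norm_of_real by simp
      moreover have "pi / sqrt 3 \<le> pi / 1.6"
        by (intro divide_left_mono real_le_rsqrt) (auto simp: power2_eq_square)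
      moreover have "pi < 3.2" using pi_approx by simp
      ultimately show "cmod cq + cmod cc \<le> 3" by simp
    qed (use M0 K0 in auto)
    finally show ?thesis by simp
  qed
  finally have "real J \<le> 800 * (6 * (M * K))" by simp
  also have "\<dots> = 9600 * exp 4 * ln (10 ^ 10 * (real q)\<^sup>2) * K" by (simp add: M_def P_def)
  finally show ?thesis .
qed

section \<open>Moments of sums of third waves\<close>

definition third_sum :: "nat set \<Rightarrow> real \<Rightarrow> real" where
  "third_sum A x = (\<Sum>n\<in>A. third_wave (real n * x))"

definition level :: "nat set \<Rightarrow> nat \<Rightarrow> nat set" where
  "level A a = {n\<in>A. multiplicity 3 n = a}"

lemma multiplicity_3_eq_0:
  fixes n :: nat
  assumes "n \<noteq> 0" shows "multiplicity 3 n = 0 \<longleftrightarrow> \<not> 3 dvd n"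
proof (cases "3 dvd n")
  case True
  then obtain m where m: "n = 3 * m" by (elim dvdE)
  then have "m \<noteq> 0" using assms by simp
  then have "multiplicity 3 n = Suc (multiplicity 3 m)" unfolding m by (simp add: multiplicity_times_same)
  then show ?thesis using True by simp
qed (simp add: not_dvd_imp_multiplicity_0)

lemma circ_fun_third_sum: "circ_fun (third_sum A)"
  unfolding third_sum_def by (intro circ_fun_sum circ_fun_dilate circ_fun_waves)

text \<open>The three translates of the middle third by multiples of 1/3 tile the circle.\<close>

lemma third_wave_sum: "third_wave y + third_wave (y + 1/3) + third_wave (y + 2/3) = 0"
proof -
  define z where "z = frac y"
  have z: "0 \<le> z" "z < 1" by (auto simp: z_def frac_lt_1)
  have red: "third_wave (y + s) = third_wave (z + s)" for s
  proof -
    have "y + s = (z + s) + of_int \<lfloor>y\<rfloor>" by (simp add: z_def frac_def)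
    then show ?thesis using circ_fun_period_int[OF circ_fun_waves(2)] by metis
  qed
  have y0: "third_wave y = third_wave z" using red[of 0] by simp
  consider "z < 1/3" | "1/3 \<le> z \<and> z < 2/3" | "2/3 \<le> z" by linarith
  then show ?thesis
  proof cases
    case 1
    then have "frac z = z" "frac (z + 1/3) = z + 1/3" "frac (z + 2/3) = z + 2/3"
      using z frac_eqI[of 0 z] frac_eqI[of 0 "z + 1/3"] frac_eqI[of 0 "z + 2/3"] by simp_all
    then show ?thesis using 1 z unfolding y0 red by (simp add: third_wave_def)
  next
    case 2
    then have "frac z = z" "frac (z + 1/3) = z + 1/3" "frac (z + 2/3) = z + 2/3 - 1"
      using z frac_eqI[of 0 z] frac_eqI[of 0 "z + 1/3"] frac_eqI[of 1 "z + 2/3"] by simp_all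
    then show ?thesis using 2 z unfolding y0 red by (simp add: third_wave_def)
  next
    case 3
    then have "frac z = z" "frac (z + 1/3) = z + 1/3 - 1" "frac (z + 2/3) = z + 2/3 - 1"
      using z frac_eqI[of 0 z] frac_eqI[of 1 "z + 1/3"] frac_eqI[of 1 "z + 2/3"] by simp_all
    then show ?thesis using 3 z unfolding y0 red by (simp add: third_wave_def)
  qed
qed

lemma third_wave_sum_coprime:
  assumes "\<not> 3 dvd n"
  shows "third_wave (real n * x) + third_wave (real n * (x + 1/3)) + third_wave (real n * (x + 2/3)) = 0"
proof -
  define t where "t = n div 3"
  have per: "third_wave (y + real m) = third_wave y" for y m by (rule circ_fun_period_nat[OF circ_fun_waves(2)])
  from assms have "n = 3 * t + 1 \<or> n = 3 * t + 2" unfolding t_def by presburger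
  then show ?thesis
  proof
    assume n: "n = 3 * t + 1"
    have "real n * (x + 1/3) = (real n * x + 1/3) + real t" "real n * (x + 2/3) = (real n * x + 2/3) + real (2 * t)"
      unfolding n by (simp_all add: field_simps)
    then show ?thesis using third_wave_sum[of "real n * x"] by (simp only: per)
  next
    assume n: "n = 3 * t + 2"
    have "real n * (x + 1/3) = (real n * x + 2/3) + real t" "real n * (x + 2/3) = (real n * x + 1/3) + real (2 * t + 1)"
      unfolding n by (simp_all add: field_simps)
    then show ?thesis using third_wave_sum[of "real n * x"] by (simp only: per)
  qed
qed

text \<open>Translation by 1/3 fixes w(3x), while the three translates of a sum over n prime to 3
  add up to zero. So the lowest 3-adic level is orthogonal to every function of 3x, powers of sums
  over higher levels included.\<close>

lemma mean_third_sum_orthogonal: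
  assumes A: "\<And>n. n \<in> A \<Longrightarrow> \<not> 3 dvd n" and w: "circ_fun w"
  shows "mean (\<lambda>x. third_sum A x * w (real 3 * x)) = (0::real)"
proof -
  define h where "h x = third_sum A x * w (real 3 * x)" for x
  have h: "circ_fun h" unfolding h_def by (intro circ_fun_mult circ_fun_third_sum circ_fun_dilate w)
  have "h x + h (x + 1/3) + h (x + 2/3) = 0" for x
  proof -
    have "w (real 3 * (x + 1/3)) = w (real 3 * x)" "w (real 3 * (x + 2/3)) = w (real 3 * x)"
      using circ_fun_period_nat[OF w, of "3 * x" 1] circ_fun_period_nat[OF w, of "3 * x" 2] by (simp_all add: distrib_left)
    then have "h x + h (x + 1/3) + h (x + 2/3) = (third_sum A x + third_sum A (x + 1/3) + third_sum A (x + 2/3)) * w (real 3 * x)"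
      by (simp add: h_def algebra_simps)
    also have "third_sum A x + third_sum A (x + 1/3) + third_sum A (x + 2/3) = 0"
      unfolding third_sum_def sum.distrib[symmetric] by (rule sum.neutral) (use third_wave_sum_coprime A in blast)
    finally show ?thesis by simp
  qed
  then have "mean (\<lambda>x. h x + h (x + 1/3) + h (x + 2/3)) = 0" by simp
  moreover have "mean (\<lambda>x. h x + h (x + 1/3) + h (x + 2/3)) = mean h + mean (\<lambda>x. h (x + 1/3)) + mean (\<lambda>x. h (x + 2/3))"
    by (subst mean_add mean_add; (intro circ_fun_add circ_fun_translate h)?)+ simp
  moreover have "mean (\<lambda>x. h (x + 1/3)) = mean h" "mean (\<lambda>x. h (x + 2/3)) = mean h"
    by (intro mean_translate h; simp)+
  ultimately show ?thesis by (simp add: h_def[abs_def])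
qed

lemma abs_third_sum_le: assumes "finite A" shows "\<bar>third_sum A x\<bar> \<le> real (card A)"
proof -
  have "\<bar>third_sum A x\<bar> \<le> (\<Sum>n\<in>A. \<bar>third_wave (real n * x)\<bar>)" unfolding third_sum_def by (rule sum_abs)
  also have "\<dots> \<le> (\<Sum>n\<in>A. 1)" by (intro sum_mono) (simp add: third_wave_def)
  finally show ?thesis by simp
qed

text \<open>At the least element m of A only n = m contributes to the Fourier coefficient, as no
  larger n divides m. Its modulus sqrt 3 / (2 pi) is at least 1/4, and |u| \<le> 2 u^2 + 1/8
  converts the resulting L^1 bound into one for the mean square.\<close>

lemma mean_square_third_sum_ge:
  assumes A: "finite A" "A \<noteq> {}" "0 \<notin> A"
  shows "1 / 16 \<le> mean (\<lambda>x. (third_sum A x)\<^sup>2)"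
proof -
  define m where "m = Min A"
  have m: "m \<in> A" using A by (simp add: m_def)
  then have m0: "m > 0" using A by (auto intro: gr0I)
  define G where "G x = complex_of_real (third_sum A x)" for x
  have tw: "circ_fun (\<lambda>x. complex_of_real (third_wave x))" by (intro circ_fun_of_real circ_fun_waves)
  have Gc: "circ_fun G" unfolding G_def by (intro circ_fun_of_real circ_fun_third_sum)
  have "G = (\<lambda>x. \<Sum>n\<in>A. 1 * complex_of_real (third_wave (real n * x)))"
    by (auto simp: G_def third_sum_def)
  then have "fcoeff G (int m) = (\<Sum>n\<in>A. if int n dvd int m then 1 * fcoeff (\<lambda>x. complex_of_real (third_wave x)) (int m div int n) else 0)"
    using fcoeff_dilates[OF tw A(3), of "\<lambda>_. 1" "int m"] by simp
  also have "\<dots> = (\<Sum>n\<in>{m}. fcoeff (\<lambda>x. complex_of_real (third_wave x)) 1)"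
  proof (rule sum.mono_neutral_cong_right[OF A(1)])
    show "\<forall>n\<in>A - {m}. (if int n dvd int m then 1 * fcoeff (\<lambda>x. complex_of_real (third_wave x)) (int m div int n) else 0) = 0"
    proof
      fix n assume n: "n \<in> A - {m}"
      then have "m \<le> n" using A by (simp add: m_def)
      then have "\<not> n dvd m" using n m0 by (auto dest: dvd_imp_le)
      then show "(if int n dvd int m then 1 * fcoeff (\<lambda>x. complex_of_real (third_wave x)) (int m div int n) else 0) = 0" by simp
    qed
  qed (use m m0 in auto)
  also have "\<dots> = of_real (- (sqrt 3 / (2 * pi)))" by (simp add: fcoeff_third_wave chi3_def)
  finally have "cmod (fcoeff G (int m)) = \<bar>- (sqrt 3 / (2 * pi))\<bar>" by (simp only: norm_of_real)
  moreover have "1 / 4 \<le> sqrt 3 / (2 * pi)"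
  proof -
    have "1.7 \<le> sqrt (3::real)" by (rule real_le_rsqrt) (simp add: power2_eq_square)
    moreover have "pi < 3.2" using pi_approx by simp
    ultimately show ?thesis by (simp add: field_simps)
  qed
  ultimately have "1 / 4 \<le> cmod (fcoeff G (int m))" by simp
  also have "\<dots> \<le> mean (\<lambda>x. cmod (G x))" by (rule norm_fcoeff_le[OF Gc])
  also have "\<dots> \<le> mean (\<lambda>x. 2 * (third_sum A x)\<^sup>2 + 1 / 8)"
  proof (rule mean_mono)
    fix x
    have "0 \<le> 2 * (\<bar>third_sum A x\<bar> - 1 / 4)\<^sup>2" by simp
    then show "cmod (G x) \<le> 2 * (third_sum A x)\<^sup>2 + 1 / 8"
      by (simp add: G_def power2_diff power_divide)
  qed (intro circ_fun_norm circ_fun_add circ_fun_cmult circ_fun_power circ_fun_const circ_fun_third_sum Gc)+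
  also have "\<dots> = 2 * mean (\<lambda>x. (third_sum A x)\<^sup>2) + 1 / 8"
    by (subst mean_add) (simp_all only: mean_cmult mean_const circ_fun_cmult circ_fun_power circ_fun_const circ_fun_third_sum)
  finally show ?thesis by simp
qed

text \<open>The levels behave like martingale differences. Splitting A into the part A0 prime to 3
  and 3A' writes the sum as g(x) + F(3x), and the terms linear in g integrate to zero. Hence second
  moments add over the V occupied levels, and the fourth moment grows like V^2. The induction runs
  on the sum of the elements, which decreases from A to A'.\<close>

lemma third_moments:
  fixes A :: "nat set" and h :: nat
  assumes "finite A" "0 \<notin> A" "\<And>a. card (level A a) \<le> h"
  defines "V \<equiv> real (card (multiplicity 3 ` A))"
  shows "V / 16 \<le> mean (\<lambda>x. (third_sum A x)\<^sup>2) \<and> mean (\<lambda>x. (third_sum A x)\<^sup>2) \<le> (real h)\<^sup>2 * V \<and>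
    mean (\<lambda>x. (third_sum A x) ^ 4) \<le> 11 * (real h) ^ 4 * V\<^sup>2"
  unfolding V_def using assms(1-3)
proof (induction "\<Sum>A" arbitrary: A rule: less_induct)
  case less
  show ?case
  proof (cases "A = {}")
    case True
    then show ?thesis by (simp add: third_sum_def)
  next
    case False
    define A0 where "A0 = {n\<in>A. \<not> 3 dvd n}"
    define A' where "A' = {n. 3 * n \<in> A}"
    have v3: "multiplicity 3 (3 * n) = Suc (multiplicity 3 n)" if "n > 0" for n :: nat
      using that by (simp add: multiplicity_times_same)
    have v0: "multiplicity 3 n = 0" if "n \<in> A0" for n
      using that by (simp add: A0_def not_dvd_imp_multiplicity_0)
    have fin: "finite A0" "finite A'" using less.prems(1) unfolding A0_def A'_def
      by (auto intro: finite_vimageI[of A "\<lambda>n. 3 * n", unfolded vimage_def] simp: inj_on_def)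
    have A'0: "0 \<notin> A'" using less.prems(2) by (simp add: A'_def)
    have A'pos: "n > 0" if "n \<in> A'" for n using that A'0 by (auto intro: gr0I)
    have split: "A = A0 \<union> (\<lambda>n. 3 * n) ` A'" "A0 \<inter> (\<lambda>n. 3 * n) ` A' = {}"
      unfolding A0_def A'_def by (auto elim!: dvdE)
    have sumA: "\<Sum>A' < \<Sum>A"
    proof (cases "A' = {}")
      case True
      obtain n where n: "n \<in> A" using False by blast
      then have "0 < n" using less.prems(2) by (auto intro: gr0I)
      then have "0 < \<Sum>A" using n less.prems(1) by (metis bot_nat_0.not_eq_extremum sum_eq_0_iff)
      then show ?thesis using True by simp
    next
      case False
      have "\<Sum>A' < 3 * \<Sum>A'"
      proof -
        obtain n where n: "n \<in> A'" using False by blast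
        then have "0 < \<Sum>A'" using A'pos fin(2) by (metis bot_nat_0.not_eq_extremum sum_eq_0_iff)
        then show ?thesis by simp
      qed
      also have "3 * \<Sum>A' = \<Sum>((\<lambda>n. 3 * n) ` A')" by (simp add: sum.reindex inj_on_def sum_distrib_left)
      also have "\<dots> \<le> \<Sum>A" using split(1) less.prems(1) by (intro sum_mono2) auto
      finally show ?thesis .
    qed
    have lev: "card (level A' a) \<le> h" for a
    proof -
      have "(\<lambda>n. 3 * n) ` level A' a \<subseteq> level A (Suc a)" using v3 A'pos by (auto simp: level_def A'_def)
      then have "card (level A' a) \<le> card (level A (Suc a))"
        using less.prems(1) by (intro card_inj_on_le[of "\<lambda>n. 3 * n"]) (auto simp: inj_on_def level_def)
      then show ?thesis using less.prems(3)[of "Suc a"] by simp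
    qed
    note IH = less.hyps[OF sumA fin(2) A'0 lev]
    define V' where "V' = real (card (multiplicity 3 ` A'))"
    \<comment> \<open>Equals 1 exactly if the lowest level is occupied, that is, if this step
      increases the number of levels.\<close>
    define \<delta> where "\<delta> = (if A0 = {} then 0 else 1 :: real)"
    have V: "real (card (multiplicity 3 ` A)) = V' + \<delta>"
    proof -
      have "multiplicity 3 ` A = multiplicity 3 ` A0 \<union> Suc ` multiplicity 3 ` A'"
        unfolding split(1) image_Un image_image using v3 A'pos by auto
      also have "multiplicity 3 ` A0 = (if A0 = {} then {} else {0})" using v0 by auto
      finally have "multiplicity 3 ` A = (if A0 = {} then {} else {0}) \<union> Suc ` multiplicity 3 ` A'" .
      then show ?thesis using fin(2) by (auto simp: V'_def \<delta>_def card_image card_insert_if)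
    qed
    define g F where "g = third_sum A0" and "F = third_sum A'"
    have gc: "circ_fun g" and Fc: "circ_fun F" by (simp_all add: g_def F_def circ_fun_third_sum)
    have F3: "circ_fun (\<lambda>x. F (real 3 * x))" by (rule circ_fun_dilate[OF Fc])
    have eq: "third_sum A x = g x + F (real 3 * x)" for x
    proof -
      have "third_sum A x = third_sum A0 x + (\<Sum>n\<in>(\<lambda>n. 3 * n) ` A'. third_wave (real n * x))"
        unfolding third_sum_def by (subst split(1)) (rule sum.union_disjoint, use fin split in auto)
      then show ?thesis by (simp add: g_def F_def third_sum_def sum.reindex inj_on_def mult_ac)
    qed
    have g_le: "\<bar>g x\<bar> \<le> real h" for x
    proof -
      have ne: "n \<noteq> 0" if "n \<in> A" for n using less.prems(2) that by metis
      have "A0 = level A 0" by (auto simp: A0_def level_def multiplicity_3_eq_0[OF ne])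
      then have "card A0 \<le> h" using less.prems(3)[of 0] by simp
      then show ?thesis using abs_third_sum_le[OF fin(1), of x] by (simp add: g_def)
    qed
    have g_le_d: "(g x)\<^sup>2 \<le> (real h)\<^sup>2 * \<delta>" "(g x) ^ 4 \<le> (real h) ^ 4 * \<delta>" for x
    proof -
      have "(g x)\<^sup>2 \<le> (real h)\<^sup>2" using g_le[of x] by (simp add: abs_le_square_iff[symmetric])
      moreover have "(g x) ^ 4 \<le> (real h) ^ 4"
        using power_mono[OF g_le[of x], of 4] by (simp add: power_even_abs)
      ultimately show "(g x)\<^sup>2 \<le> (real h)\<^sup>2 * \<delta>" "(g x) ^ 4 \<le> (real h) ^ 4 * \<delta>"
        by (auto simp: \<delta>_def g_def third_sum_def)
    qed
    have orth: "mean (\<lambda>x. g x * (F (real 3 * x)) ^ j) = 0" for j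
      unfolding g_def using mean_third_sum_orthogonal[of A0 "\<lambda>x. F x ^ j"] circ_fun_power[OF Fc] by (simp add: A0_def)
    have dil: "mean (\<lambda>x. (F (real 3 * x)) ^ j) = mean (\<lambda>x. F x ^ j)" for j
      using mean_dilate[OF circ_fun_power[OF Fc], of 3 j] by simp
    note cs = circ_fun_add circ_fun_mult circ_fun_cmult circ_fun_power circ_fun_const gc F3
    have m2: "mean (\<lambda>x. (third_sum A x)\<^sup>2) = mean (\<lambda>x. (g x)\<^sup>2) + mean (\<lambda>x. (F x)\<^sup>2)"
    proof -
      have "mean (\<lambda>x. (third_sum A x)\<^sup>2) = mean (\<lambda>x. ((g x)\<^sup>2 + 2 * (g x * (F (real 3 * x)) ^ 1)) + (F (real 3 * x))\<^sup>2)"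
        by (rule arg_cong[where f=mean]) (auto simp: eq power2_sum fun_eq_iff)
      also have "\<dots> = mean (\<lambda>x. (g x)\<^sup>2) + mean (\<lambda>x. 2 * (g x * (F (real 3 * x)) ^ 1)) + mean (\<lambda>x. (F (real 3 * x))\<^sup>2)"
        by (subst mean_add, (intro cs)+, subst mean_add, (intro cs)+) simp
      also have "mean (\<lambda>x. 2 * (g x * (F (real 3 * x)) ^ 1)) = 0" unfolding mean_cmult orth by simp
      finally show ?thesis using dil[of 2] by simp
    qed
    have "mean (\<lambda>x. (g x)\<^sup>2) \<le> mean (\<lambda>x. (real h)\<^sup>2 * \<delta>)"
      by (intro mean_mono g_le_d circ_fun_power circ_fun_const gc)
    then have g2: "mean (\<lambda>x. (g x)\<^sup>2) \<le> (real h)\<^sup>2 * \<delta>" by simp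
    have g2': "\<delta> / 16 \<le> mean (\<lambda>x. (g x)\<^sup>2)"
    proof (cases "A0 = {}")
      case True
      then show ?thesis by (simp add: \<delta>_def g_def third_sum_def)
    next
      case False
      then show ?thesis using mean_square_third_sum_ge[OF fin(1) False] less.prems(2) by (simp add: \<delta>_def g_def A0_def)
    qed
    have m4: "mean (\<lambda>x. (third_sum A x) ^ 4) \<le> 11 * (real h) ^ 4 * (V' + \<delta>)\<^sup>2"
    proof -
      have "mean (\<lambda>x. (third_sum A x) ^ 4) \<le> mean (\<lambda>x. (3 * (real h) ^ 4 * \<delta> + 8 * (real h)\<^sup>2 * \<delta> * (F (real 3 * x))\<^sup>2 + 4 * (g x * (F (real 3 * x)) ^ 3)) + (F (real 3 * x)) ^ 4)"
      proof (rule mean_mono)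
        fix x
        define u v where "u = g x" and "v = F (real 3 * x)"
        \<comment> \<open>The term linear in u vanishes in the mean but u^3 v need not; it is
          absorbed by its even neighbours, and so 3 and 8 replace the binomial coefficients 1 and
          6.\<close>
        have "4 * u ^ 3 * v \<le> 2 * u ^ 4 + 2 * u\<^sup>2 * v\<^sup>2"
        proof -
          have "0 \<le> 2 * u\<^sup>2 * (u - v)\<^sup>2" by simp
          also have "\<dots> = 2 * u ^ 4 + 2 * u\<^sup>2 * v\<^sup>2 - 4 * u ^ 3 * v"
            by (simp add: power2_eq_square power3_eq_cube power4_eq_xxxx algebra_simps)
          finally show ?thesis by simp
        qed
        moreover have "(u + v) ^ 4 = u ^ 4 + 4 * u ^ 3 * v + 6 * u\<^sup>2 * v\<^sup>2 + 4 * (u * v ^ 3) + v ^ 4"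
          by (simp add: power2_eq_square power3_eq_cube power4_eq_xxxx algebra_simps)
        ultimately have "(u + v) ^ 4 \<le> 3 * u ^ 4 + 8 * (u\<^sup>2 * v\<^sup>2) + 4 * (u * v ^ 3) + v ^ 4" by simp
        also have "3 * u ^ 4 \<le> 3 * ((real h) ^ 4 * \<delta>)" using g_le_d(2)[of x] by (simp add: u_def)
        also have "u\<^sup>2 * v\<^sup>2 \<le> ((real h)\<^sup>2 * \<delta>) * v\<^sup>2"
          using g_le_d(1)[of x] by (intro mult_right_mono) (simp_all add: u_def)
        finally show "(third_sum A x) ^ 4 \<le> (3 * (real h) ^ 4 * \<delta> + 8 * (real h)\<^sup>2 * \<delta> * (F (real 3 * x))\<^sup>2 + 4 * (g x * (F (real 3 * x)) ^ 3)) + (F (real 3 * x)) ^ 4"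
          by (simp add: eq u_def v_def mult.assoc)
      qed (intro cs circ_fun_third_sum)+
      also have "\<dots> = 3 * (real h) ^ 4 * \<delta> + 8 * (real h)\<^sup>2 * \<delta> * mean (\<lambda>x. (F (real 3 * x))\<^sup>2) + mean (\<lambda>x. 4 * (g x * (F (real 3 * x)) ^ 3)) + mean (\<lambda>x. (F (real 3 * x)) ^ 4)"
        by (subst mean_add, (intro cs)+, subst mean_add, (intro cs)+, subst mean_add, (intro cs)+) (simp add: mean_cmult)
      also have "mean (\<lambda>x. 4 * (g x * (F (real 3 * x)) ^ 3)) = 0" unfolding mean_cmult orth by simp
      also have "3 * (real h) ^ 4 * \<delta> + 8 * (real h)\<^sup>2 * \<delta> * mean (\<lambda>x. (F (real 3 * x))\<^sup>2) + 0 + mean (\<lambda>x. (F (real 3 * x)) ^ 4)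
        \<le> 3 * (real h) ^ 4 * \<delta> + 8 * (real h)\<^sup>2 * \<delta> * ((real h)\<^sup>2 * V') + 0 + 11 * (real h) ^ 4 * V'\<^sup>2"
      proof -
        have "mean (\<lambda>x. (F (real 3 * x))\<^sup>2) \<le> (real h)\<^sup>2 * V'" "mean (\<lambda>x. (F (real 3 * x)) ^ 4) \<le> 11 * (real h) ^ 4 * V'\<^sup>2"
          using IH unfolding dil by (simp_all only: F_def V'_def)
        then show ?thesis by (intro add_mono mult_left_mono order_refl) (auto simp: \<delta>_def)
      qed
      also have "\<dots> = 11 * (real h) ^ 4 * (3 / 11 * \<delta> + 8 / 11 * \<delta> * V' + V'\<^sup>2)"
        by (simp add: power2_eq_square power4_eq_xxxx algebra_simps)
      also have "\<dots> \<le> 11 * (real h) ^ 4 * (V' + \<delta>)\<^sup>2"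
        by (intro mult_left_mono) (auto simp: \<delta>_def power2_sum V'_def)
      finally show ?thesis .
    qed
    show ?thesis
      unfolding V using m2 g2 g2' m4 IH by (simp add: F_def V'_def distrib_left add_divide_distrib)
  qed
qed

text \<open>Divide n by 3 as long as the quotient stays in A. This ends in A - 3A at a level not
  above a, and two elements of the same level cannot end at the same place. The induction on a
  carries this out.\<close>

lemma card_level_le_boundary:
  assumes A: "finite A" "0 \<notin> A"
  shows "card (level A a) \<le> card (tripling_boundary A)"
proof -
  let ?B = "(\<lambda>n. 3 * n) ` A"
  have "card (level A a) \<le> card {n\<in>A - ?B. multiplicity 3 n \<le> a}"
  proof (induction a)
    case 0
    have "level A 0 \<subseteq> {n\<in>A - ?B. multiplicity 3 n \<le> 0}"
    proof
      fix n assume "n \<in> level A 0"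
      then have n: "n \<in> A" "multiplicity 3 n = 0" by (auto simp: level_def)
      then have "\<not> 3 dvd n" using A(2) multiplicity_3_eq_0[of n] by metis
      then show "n \<in> {n\<in>A - ?B. multiplicity 3 n \<le> 0}" using n by auto
    qed
    then show ?case using A by (intro card_mono) auto
  next
    case (Suc a)
    have "level A (Suc a) \<subseteq> {n\<in>A - ?B. multiplicity 3 n = Suc a} \<union> (\<lambda>n. 3 * n) ` level A a"
    proof
      fix n assume n: "n \<in> level A (Suc a)"
      show "n \<in> {n\<in>A - ?B. multiplicity 3 n = Suc a} \<union> (\<lambda>n. 3 * n) ` level A a"
      proof (cases "n \<in> ?B")
        case True
        then obtain m where m: "n = 3 * m" "m \<in> A" by auto
        then have "m \<noteq> 0" using A(2) by metis
        then have "multiplicity 3 n = Suc (multiplicity 3 m)" unfolding m(1) by (simp add: multiplicity_times_same)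
        then show ?thesis using m n by (auto simp: level_def)
      next
        case False
        then show ?thesis using n by (auto simp: level_def)
      qed
    qed
    then have "card (level A (Suc a)) \<le> card ({n\<in>A - ?B. multiplicity 3 n = Suc a} \<union> (\<lambda>n. 3 * n) ` level A a)"
      using A by (intro card_mono) (auto simp: level_def)
    also have "\<dots> \<le> card {n\<in>A - ?B. multiplicity 3 n = Suc a} + card ((\<lambda>n. 3 * n) ` level A a)" by (rule card_Un_le)
    also have "card ((\<lambda>n. 3 * n) ` level A a) \<le> card (level A a)"
      using A by (intro card_image_le) (simp add: level_def)
    also have "\<dots> \<le> card {n\<in>A - ?B. multiplicity 3 n \<le> a}" by (rule Suc)
    also have "card {n\<in>A - ?B. multiplicity 3 n = Suc a} + card {n\<in>A - ?B. multiplicity 3 n \<le> a} =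
      card ({n\<in>A - ?B. multiplicity 3 n = Suc a} \<union> {n\<in>A - ?B. multiplicity 3 n \<le> a})"
      using A by (intro card_Un_disjoint[symmetric]) auto
    also have "{n\<in>A - ?B. multiplicity 3 n = Suc a} \<union> {n\<in>A - ?B. multiplicity 3 n \<le> a} = {n\<in>A - ?B. multiplicity 3 n \<le> Suc a}" by auto
    finally show ?case by simp
  qed
  also have "\<dots> \<le> card (tripling_boundary A)"
    using A unfolding tripling_boundary_def by (intro card_mono) auto
  finally show ?thesis .
qed

text \<open>Each level has at most s elements, so |A| \<le> s V: a small boundary forces many
  occupied levels. Comparing second and fourth moments then shows that the L^1 norm is at least of
  order sqrt V / s^2.\<close>

lemma mean_third_sum_ge:
  assumes A: "finite A" "0 \<notin> A" "A \<noteq> {}" and s: "card (tripling_boundary A) \<le> s"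
  shows "sqrt (real (card A)) \<le> 640 * (real s) ^ 3 * mean (\<lambda>x. \<bar>third_sum A x\<bar>)"
proof -
  define V where "V = real (card (multiplicity 3 ` A))"
  define E where "E = mean (\<lambda>x. \<bar>third_sum A x\<bar>)"
  have lev: "card (level A a) \<le> s" for a using card_level_le_boundary[OF A(1,2), of a] s by simp
  have V1: "V \<ge> 1" using A by (simp add: V_def Suc_leI card_gt_0_iff)
  have cA: "real (card A) \<le> real s * V"
  proof -
    have "A = (\<Union>a\<in>multiplicity 3 ` A. level A a)" by (auto simp: level_def)
    then have "card A \<le> (\<Sum>a\<in>multiplicity 3 ` A. card (level A a))"
      using card_UN_le[of "multiplicity 3 ` A" "level A"] A by simp
    also have "\<dots> \<le> (\<Sum>a\<in>multiplicity 3 ` A. s)" by (intro sum_mono lev)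
    also have "\<dots> = s * card (multiplicity 3 ` A)" by simp
    finally have "real (card A) \<le> real (s * card (multiplicity 3 ` A))" by (rule of_nat_mono)
    then show ?thesis by (simp only: V_def of_nat_mult)
  qed
  have s1: "real s \<ge> 1"
  proof -
    have "card A > 0" using A by (simp add: card_gt_0_iff)
    then have "s \<noteq> 0" using cA by (intro notI) simp
    then show ?thesis by simp
  qed
  have c3: "circ_fun (third_sum A)" by (rule circ_fun_third_sum)
  have ca: "circ_fun (\<lambda>x. \<bar>third_sum A x\<bar>)" using circ_fun_norm[OF c3] by simp
  \<comment> \<open>The truncation height: values above l enter through the fourth moment, which
    this choice makes at most (11/400) V, less than half of the lower bound V/16 for the second
    moment.\<close>
  define l where "l = 20 * (real s)\<^sup>2 * sqrt V"
  have l0: "l > 0" using s1 V1 by (simp add: l_def)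
  have l2: "l\<^sup>2 = 400 * (real s) ^ 4 * V"
    using V1 by (simp add: l_def power_mult_distrib flip: power_mult)
  note m = third_moments[OF A(1,2) lev, folded V_def]
  have "V / 16 \<le> mean (\<lambda>x. (third_sum A x)\<^sup>2)" using m by simp
  also have "\<dots> \<le> mean (\<lambda>x. l * \<bar>third_sum A x\<bar> + (1 / l\<^sup>2) * (third_sum A x) ^ 4)"
  proof (rule mean_mono)
    fix x
    define u where "u = \<bar>third_sum A x\<bar>"
    have u: "u \<ge> 0" "(third_sum A x)\<^sup>2 = u\<^sup>2" "(third_sum A x) ^ 4 = u ^ 4" by (auto simp: u_def power_even_abs)
    show "(third_sum A x)\<^sup>2 \<le> l * \<bar>third_sum A x\<bar> + (1 / l\<^sup>2) * (third_sum A x) ^ 4"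
      unfolding u(2,3) u_def[symmetric]
    proof (cases "u \<le> l")
      case True
      then have "u\<^sup>2 \<le> l * u" using u by (simp add: power2_eq_square mult_right_mono)
      moreover have "0 \<le> (1 / l\<^sup>2) * u ^ 4" by simp
      ultimately show "u\<^sup>2 \<le> l * u + (1 / l\<^sup>2) * u ^ 4" by linarith
    next
      case False
      then have "l\<^sup>2 \<le> u\<^sup>2" using l0 by (intro power_mono) auto
      then have "u\<^sup>2 * l\<^sup>2 \<le> u\<^sup>2 * u\<^sup>2" by (intro mult_left_mono) auto
      then have "u\<^sup>2 \<le> (1 / l\<^sup>2) * u ^ 4" using l0 by (simp add: field_simps power2_eq_square power4_eq_xxxx)
      moreover have "0 \<le> l * u" using l0 u by simp
      ultimately show "u\<^sup>2 \<le> l * u + (1 / l\<^sup>2) * u ^ 4" by linarith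
    qed
  qed (intro circ_fun_add circ_fun_cmult circ_fun_power c3 ca)+
  also have "\<dots> = l * E + (1 / l\<^sup>2) * mean (\<lambda>x. (third_sum A x) ^ 4)"
    unfolding E_def by (subst mean_add) (simp_all only: mean_cmult circ_fun_cmult circ_fun_power c3 ca)
  also have "\<dots> \<le> l * E + (1 / l\<^sup>2) * (11 * (real s) ^ 4 * V\<^sup>2)"
    using m l0 by (intro add_left_mono mult_left_mono) auto
  also have "(1 / l\<^sup>2) * (11 * (real s) ^ 4 * V\<^sup>2) = 11 / 400 * V"
    unfolding l2 using s1 V1 by (simp add: power2_eq_square)
  finally have "V / 32 \<le> l * E" using V1 by simp
  then have "sqrt V * sqrt V \<le> 640 * (real s)\<^sup>2 * E * sqrt V" using V1 by (simp add: l_def mult_ac)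
  then have sV: "sqrt V \<le> 640 * (real s)\<^sup>2 * E" by (rule mult_right_le_imp_le) (use V1 in simp)
  have "sqrt (real (card A)) \<le> sqrt (real s * V)" using cA by (rule real_sqrt_le_mono)
  also have "\<dots> = sqrt (real s) * sqrt V" by (rule real_sqrt_mult)
  also have "\<dots> \<le> real s * (640 * (real s)\<^sup>2 * E)"
  proof (rule mult_mono[OF _ sV])
    have "real s \<le> (real s)\<^sup>2" using s1 by (simp add: power2_eq_square)
    then show "sqrt (real s) \<le> real s" by (intro real_le_lsqrt) auto
  qed (use V1 in auto)
  finally show ?thesis by (simp add: E_def power2_eq_square power3_eq_cube mult_ac)
qed

section \<open>Raikov's inequality on the circle\<close>

text \<open>Closed subsets of the circle, lifted to the line. Closedness is preserved under sumsets,
  whereas a sumset of merely measurable sets may fail to be measurable.\<close>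

definition closed_periodic :: "real set \<Rightarrow> bool" where
  "closed_periodic A \<longleftrightarrow> closed A \<and> (\<forall>x. x + 1 \<in> A \<longleftrightarrow> x \<in> A)"

definition per_measure :: "real set \<Rightarrow> real" where
  "per_measure A = mean (indicat_real A)"

definition sumset :: "real set \<Rightarrow> real set \<Rightarrow> real set" where
  "sumset A B = {a + b | a b. a \<in> A \<and> b \<in> B}"

lemma per_measure_empty: "per_measure {} = 0"
proof -
  have "indicat_real {} = (\<lambda>_. 0)" by auto
  then have "per_measure {} = mean (\<lambda>_. 0)" unfolding per_measure_def by (rule arg_cong)
  then show ?thesis by (simp only: mean_const)
qed

lemma closed_periodic_borel: "closed_periodic A \<Longrightarrow> A \<in> sets borel"
  by (auto simp: closed_periodic_def)

lemma closed_periodic_period_int: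
  assumes "closed_periodic A" shows "x + of_int n \<in> A \<longleftrightarrow> x \<in> A"
proof -
  have 1: "x + real m \<in> A \<longleftrightarrow> x \<in> A" for x m
  proof (induction m)
    case (Suc m)
    then show ?case using assms unfolding closed_periodic_def by (metis add.assoc add.commute of_nat_Suc)
  qed simp
  show ?thesis
  proof (cases "n \<ge> 0")
    case True
    then show ?thesis using 1[of x "nat n"] by simp
  next
    case False
    then show ?thesis using 1[of "x + of_int n" "nat (- n)"] by simp
  qed
qed

lemma circ_fun_indicator:
  assumes "A \<in> sets borel" "\<And>x. x + 1 \<in> A \<longleftrightarrow> x \<in> A" shows "circ_fun (indicat_real A)"
  by (rule circ_funI[where C=1]) (use assms in \<open>auto simp: indicator_def\<close>)

lemma circ_fun_closed_periodic: "closed_periodic A \<Longrightarrow> circ_fun (indicat_real A)"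
  by (intro circ_fun_indicator closed_periodic_borel) (auto simp: closed_periodic_def)

lemma closed_periodic_Un: "closed_periodic A \<Longrightarrow> closed_periodic B \<Longrightarrow> closed_periodic (A \<union> B)"
  and closed_periodic_Int: "closed_periodic A \<Longrightarrow> closed_periodic B \<Longrightarrow> closed_periodic (A \<inter> B)"
  by (auto simp: closed_periodic_def)

lemma closed_periodic_translate:
  assumes "closed_periodic A" shows "closed_periodic {x. x + t \<in> A}"
proof -
  have "closed ((\<lambda>x. x + t) -` A)"
    using assms by (intro continuous_closed_vimage) (auto simp: closed_periodic_def)
  moreover have "x + 1 + t \<in> A \<longleftrightarrow> x + t \<in> A" for x
    using assms unfolding closed_periodic_def by (metis add.assoc add.commute)
  ultimately show ?thesis by (simp add: closed_periodic_def vimage_def)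
qed

lemma mean_translate_real:
  assumes g: "circ_fun g" shows "mean (\<lambda>x. g (x + t)) = mean g"
proof -
  have "mean (\<lambda>x. g (x + t)) = mean (\<lambda>x. g (x + frac t))"
  proof -
    have "g (x + t) = g (x + frac t)" for x
      using circ_fun_period_int[OF g, of "x + frac t" "\<lfloor>t\<rfloor>"] by (simp add: frac_def algebra_simps)
    then show ?thesis by simp
  qed
  also have "\<dots> = mean g" by (rule mean_translate[OF g]) (auto simp: frac_lt_1 less_imp_le)
  finally show ?thesis .
qed

lemma per_measure_translate:
  assumes "closed_periodic A" shows "per_measure {x. x + t \<in> A} = per_measure A"
proof -
  have "indicat_real {x. x + t \<in> A} = (\<lambda>x. indicat_real A (x + t))" by (auto simp: indicator_def)
  then show ?thesis unfolding per_measure_def using mean_translate_real[OF circ_fun_closed_periodic[OF assms]] by simp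
qed

lemma per_measure_mono: "closed_periodic A \<Longrightarrow> closed_periodic B \<Longrightarrow> A \<subseteq> B \<Longrightarrow> per_measure A \<le> per_measure B"
  unfolding per_measure_def by (intro mean_mono circ_fun_closed_periodic) (auto simp: indicator_def)

lemma per_measure_bounds: assumes "closed_periodic A" shows "0 \<le> per_measure A" "per_measure A \<le> 1"
proof -
  show "0 \<le> per_measure A" unfolding per_measure_def by (rule mean_nonneg[OF circ_fun_closed_periodic[OF assms]]) simp
  have "mean (indicat_real A) \<le> mean (\<lambda>x. 1)"
    by (rule mean_mono[OF circ_fun_closed_periodic[OF assms] circ_fun_const]) (simp add: indicator_def)
  then show "per_measure A \<le> 1" by (simp add: per_measure_def)
qed

lemma per_measure_Un_Int:
  assumes "closed_periodic A" "closed_periodic B" shows "per_measure (A \<union> B) + per_measure (A \<inter> B) = per_measure A + per_measure B"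
proof -
  have "per_measure (A \<union> B) + per_measure (A \<inter> B) = mean (\<lambda>x. indicat_real (A \<union> B) x + indicat_real (A \<inter> B) x)"
    unfolding per_measure_def by (rule mean_add[symmetric]) (intro circ_fun_closed_periodic closed_periodic_Un closed_periodic_Int assms)+
  also have "\<dots> = mean (\<lambda>x. indicat_real A x + indicat_real B x)"
    by (rule arg_cong[where f=mean]) (auto simp: indicator_def fun_eq_iff)
  also have "\<dots> = per_measure A + per_measure B"
    unfolding per_measure_def by (rule mean_add) (intro circ_fun_closed_periodic assms)+
  finally show ?thesis .
qed

text \<open>By periodicity one summand can be moved into [0,1], and the sum of a compact and a
  closed set is closed.\<close>

lemma closed_periodic_sumset:
  assumes A: "closed_periodic A" and B: "closed_periodic B" shows "closed_periodic (sumset A B)"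
proof -
  have 1: "sumset A B = (\<Union>x\<in>A \<inter> {0..1}. \<Union>y\<in>B. {x + y})"
  proof
    show "sumset A B \<subseteq> (\<Union>x\<in>A \<inter> {0..1}. \<Union>y\<in>B. {x + y})"
    proof
      fix z assume "z \<in> sumset A B"
      then obtain a b where ab: "z = a + b" "a \<in> A" "b \<in> B" by (auto simp: sumset_def)
      have "frac a \<in> A \<inter> {0..1}"
        using closed_periodic_period_int[OF A, of a "- \<lfloor>a\<rfloor>"] ab by (auto simp: frac_def frac_lt_1 less_imp_le[OF frac_lt_1[unfolded frac_def]])
      moreover have "b + of_int \<lfloor>a\<rfloor> \<in> B" using closed_periodic_period_int[OF B] ab by simp
      moreover have "z = frac a + (b + of_int \<lfloor>a\<rfloor>)" using ab by (simp add: frac_def)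
      ultimately show "z \<in> (\<Union>x\<in>A \<inter> {0..1}. \<Union>y\<in>B. {x + y})" by blast
    qed
  qed (auto simp: sumset_def)
  have "closed (sumset A B)"
    unfolding 1 by (rule compact_closed_sums) (use A B in \<open>auto simp: closed_periodic_def intro: closed_Int_compact\<close>)
  moreover have "x + 1 \<in> sumset A B \<longleftrightarrow> x \<in> sumset A B" for x
  proof
    assume "x + 1 \<in> sumset A B"
    then obtain a b where ab: "x + 1 = a + b" "a \<in> A" "b \<in> B" by (auto simp: sumset_def)
    moreover have "b - 1 \<in> B" using B ab(3) unfolding closed_periodic_def by (metis diff_add_cancel)
    moreover have "x = a + (b - 1)" using ab by simp
    ultimately show "x \<in> sumset A B" unfolding sumset_def by blast
  next
    assume "x \<in> sumset A B"
    then obtain a b where ab: "x = a + b" "a \<in> A" "b \<in> B" by (auto simp: sumset_def)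
    moreover have "b + 1 \<in> B" using B ab(3) unfolding closed_periodic_def by blast
    moreover have "x + 1 = a + (b + 1)" using ab by simp
    ultimately show "x + 1 \<in> sumset A B" unfolding sumset_def by blast
  qed
  ultimately show ?thesis by (simp add: closed_periodic_def)
qed

lemma mean_correlation:
  assumes f: "circ_fun f" and g: "circ_fun (g :: real \<Rightarrow> real)"
  shows "mean (\<lambda>t. mean (\<lambda>x. f x * g (x + t))) = mean f * mean g"
proof -
  have fm [measurable]: "f \<in> borel_measurable borel" "g \<in> borel_measurable borel"
    using f g by (auto simp: circ_fun_def)
  obtain C D where C: "\<And>x. norm (f x) \<le> C" "C > 0" and D: "\<And>x. norm (g x) \<le> D" "D > 0"
    using circ_fun_bound[OF f] circ_fun_bound[OF g] by metis
  define h where "h x t = (indicat_real {0..<1} x * indicat_real {0..<1} t) * (f x * g (x + t))" for x t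
  have hm: "case_prod h \<in> borel_measurable (lborel \<Otimes>\<^sub>M lborel)"
    unfolding h_def case_prod_unfold by measurable
  have bnd: "norm (h x t) \<le> C * D * (indicat_real {0..<1} x * indicat_real {0..<1} t)" for x t
  proof -
    have "\<bar>f x * g (x + t)\<bar> \<le> C * D" using C(1)[of x] D(1)[of "x + t"] C(2) D(2) by (auto simp: abs_mult intro!: mult_mono)
    then show ?thesis by (auto simp: h_def indicator_def)
  qed
  have "integrable (lborel \<Otimes>\<^sub>M lborel) (\<lambda>p. C * D * (indicat_real {0..<1::real} (fst p) * indicat_real {0..<1::real} (snd p)))"
  proof -
    have "integrable (lborel \<Otimes>\<^sub>M lborel) (\<lambda>p. indicat_real {0..<1::real} (fst p) * indicat_real {0..<1::real} (snd p))"
    proof -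
      have "(\<lambda>p. indicat_real {0..<1} (fst p) * indicat_real {0..<1} (snd p)) = indicat_real ({0..<1::real} \<times> {0..<1::real})"
        by (auto simp: indicator_def fun_eq_iff)
      moreover have "emeasure (lborel \<Otimes>\<^sub>M lborel) ({0..<1::real} \<times> {0..<1::real}) = 1"
        by (simp add: lborel.emeasure_pair_measure_Times)
      ultimately show ?thesis by (simp add: integrable_indicator_iff)
    qed
    then show ?thesis by simp
  qed
  then have hi: "integrable (lborel \<Otimes>\<^sub>M lborel) (case_prod h)"
    by (rule Bochner_Integration.integrable_bound[OF _ hm]) (use bnd C D in \<open>auto simp: abs_mult intro!: AE_I2 order_trans[OF _ abs_ge_self]\<close>)
  have "mean (\<lambda>t. mean (\<lambda>x. f x * g (x + t))) = (LINT t|lborel. LINT x|lborel. h x t)"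
    unfolding mean_def set_lebesgue_integral_def h_def by (simp add: mult_ac flip: integral_mult_right_zero)
  also have "\<dots> = (LINT x|lborel. LINT t|lborel. h x t)"
    by (rule lborel_pair.Fubini_integral[OF hi])
  also have "\<dots> = mean (\<lambda>x. f x * mean (\<lambda>t. g (x + t)))"
    unfolding mean_def set_lebesgue_integral_def h_def by (simp add: mult_ac flip: integral_mult_right_zero)
  also have "\<dots> = mean (\<lambda>x. f x * mean g)"
    using mean_translate_real[OF g] by (simp add: add.commute)
  finally show ?thesis by (simp add: mean_multc)
qed

text \<open>The indicator of A is approached from above by Lipschitz functions of the distance to A.
  The correlation error is at most mean(g_n) - |A|, which does not depend on t, so the convergence
  is uniform and continuity passes to the limit.\<close>

lemma continuous_correlation:
  assumes A: "closed_periodic A" "A \<noteq> {}" and B: "closed_periodic B"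
  shows "continuous_on UNIV (\<lambda>t. mean (\<lambda>x. indicat_real B x * indicat_real A (x + t)))"
proof -
  define g where "g n x = max 0 (1 - real n * infdist x A)" for n x
  have per: "infdist (x + 1) A = infdist x A" for x
  proof -
    have le: "infdist (y + c) A \<le> infdist y A" if c: "\<And>a. a \<in> A \<Longrightarrow> a + c \<in> A" for y c
      unfolding infdist_notempty[OF A(2)]
    proof (rule cINF_mono[OF A(2)])
      show "\<exists>n\<in>A. dist (y + c) n \<le> dist y m" if "m \<in> A" for m
        using c[OF that] by (intro bexI[of _ "m + c"]) (auto simp: dist_real_def)
    qed (auto intro: bdd_belowI[of _ 0])
    have "infdist (x + 1) A \<le> infdist x A" by (rule le) (use A in \<open>auto simp: closed_periodic_def\<close>)
    moreover have "a + (- 1) \<in> A" if "a \<in> A" for a using closed_periodic_period_int[OF A(1), of a "-1"] that by simp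
    then have "infdist (x + 1 + (- 1)) A \<le> infdist (x + 1) A" by (rule le)
    ultimately show ?thesis by simp
  qed
  have gc: "circ_fun (g n)" for n
  proof (rule circ_funI[where C=1])
    show "g n \<in> borel_measurable borel"
      unfolding g_def by (intro borel_measurable_continuous_onI continuous_intros)
    show "norm (g n x) \<le> 1" for x using infdist_nonneg[of x A] by (auto simp: g_def)
    show "g n (x + 1) = g n x" for x by (simp add: g_def per)
  qed
  have ic: "circ_fun (indicat_real A)" "circ_fun (indicat_real B)" by (intro circ_fun_closed_periodic A B)+
  have ge: "indicat_real A x \<le> g n x" for n x by (auto simp: g_def indicator_def)
  have lim: "(\<lambda>n. mean (g n)) \<longlonglongrightarrow> per_measure A"
    unfolding mean_def per_measure_def set_lebesgue_integral_def
  proof (rule integral_dominated_convergence[where w="indicat_real {0..<1}"])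
    show "integrable lborel (indicat_real {0..<1::real})" by simp
    show "AE x in lborel. (\<lambda>n. indicat_real {0..<1} x *\<^sub>R g n x) \<longlonglongrightarrow> indicat_real {0..<1} x *\<^sub>R indicat_real A x"
    proof (rule AE_I2, rule tendsto_scaleR[OF tendsto_const])
      fix x
      show "(\<lambda>n. g n x) \<longlonglongrightarrow> indicat_real A x"
      proof (cases "x \<in> A")
        case True
        then show ?thesis by (simp add: g_def)
      next
        case False
        then have d: "infdist x A > 0"
          using A in_closed_iff_infdist_zero[of A x] infdist_nonneg[of x A] by (auto simp: closed_periodic_def)
        obtain N where N: "real N > 1 / infdist x A" using reals_Archimedean2 by blast
        have "g n x = indicat_real A x" if "n \<ge> N" for n
        proof -
          have "1 / infdist x A \<le> real n" using N that by linarith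
          then have "1 \<le> real n * infdist x A" using d by (simp add: field_simps)
          then show ?thesis using False by (simp add: g_def)
        qed
        then show ?thesis by (intro tendsto_eventually) (auto simp: eventually_sequentially)
      qed
    qed
    show "AE x in lborel. norm (indicat_real {0..<1} x *\<^sub>R g n x) \<le> indicat_real {0..<1} x" for n
      using infdist_nonneg[of _ A] by (intro AE_I2) (auto simp: g_def indicator_def)
  qed (use circ_fun_measurable[OF gc] circ_fun_measurable[OF ic(1)] in auto)
  define h where "h t = mean (\<lambda>x. indicat_real B x * indicat_real A (x + t))" for t
  define hn where "hn n t = mean (\<lambda>x. indicat_real B x * g n (x + t))" for n t
  have hnc: "continuous_on UNIV (hn n)" for n
  proof (rule continuous_onI)
    fix t e :: real assume e: "e > 0"
    show "\<exists>d>0. \<forall>t'\<in>UNIV. dist t' t < d \<longrightarrow> dist (hn n t') (hn n t) \<le> e"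
    proof (intro exI[of _ "e / (real n + 1)"] conjI ballI impI)
      fix t' assume tt: "dist t' t < e / (real n + 1)"
      have 1: "\<bar>g n (x + t') - g n (x + t)\<bar> \<le> e" for x
      proof -
        have "\<bar>g n (x + t') - g n (x + t)\<bar> \<le> real n * \<bar>infdist (x + t') A - infdist (x + t) A\<bar>"
        proof -
          have "\<bar>g n (x + t') - g n (x + t)\<bar> \<le> \<bar>real n * infdist (x + t') A - real n * infdist (x + t) A\<bar>"
            unfolding g_def by linarith
          then show ?thesis by (simp add: abs_mult flip: right_diff_distrib)
        qed
        also have "\<dots> \<le> real n * dist (x + t') (x + t)"
          using infdist_triangle_abs[of "x + t'" A "x + t"] by (intro mult_left_mono) auto
        also have "\<dots> \<le> (real n + 1) * dist t' t" by (intro mult_mono) (auto simp: dist_real_def)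
        also have "\<dots> \<le> e" using tt by (simp add: field_simps)
        finally show ?thesis .
      qed
      have eq: "hn n t' - hn n t = mean (\<lambda>x. indicat_real B x * g n (x + t') - indicat_real B x * g n (x + t))"
        unfolding hn_def by (rule mean_diff[symmetric]) (intro circ_fun_mult ic circ_fun_translate gc)+
      have "norm (hn n t' - hn n t) \<le> mean (\<lambda>x. norm (indicat_real B x * g n (x + t') - indicat_real B x * g n (x + t)))"
        unfolding eq by (rule norm_mean_le)
      also have "\<dots> \<le> mean (\<lambda>x. e)"
      proof (rule mean_mono)
        show "norm (indicat_real B x * g n (x + t') - indicat_real B x * g n (x + t)) \<le> e" for x
          using 1[of x] e by (auto simp: indicator_def)
      qed (intro circ_fun_const circ_fun_norm circ_fun_diff circ_fun_mult ic circ_fun_translate gc)+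
      finally show "dist (hn n t') (hn n t) \<le> e" by (simp add: dist_real_def)
    qed (use e in simp)
  qed
  have "uniform_limit UNIV hn h sequentially"
  proof (rule uniform_limitI)
    fix e :: real assume e: "e > 0"
    have "\<forall>\<^sub>F n in sequentially. \<bar>mean (g n) - per_measure A\<bar> < e"
      using lim e by (auto simp: tendsto_iff dist_real_def)
    then show "\<forall>\<^sub>F n in sequentially. \<forall>t\<in>UNIV. dist (hn n t) (h t) < e"
    proof (rule eventually_mono, intro ballI)
      fix n t assume n: "\<bar>mean (g n) - per_measure A\<bar> < e"
      have eq: "hn n t - h t = mean (\<lambda>x. indicat_real B x * g n (x + t) - indicat_real B x * indicat_real A (x + t))"
        unfolding hn_def h_def by (rule mean_diff[symmetric]) (intro circ_fun_mult ic circ_fun_translate gc)+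
      have "norm (hn n t - h t) \<le> mean (\<lambda>x. norm (indicat_real B x * g n (x + t) - indicat_real B x * indicat_real A (x + t)))"
        unfolding eq by (rule norm_mean_le)
      also have "\<dots> \<le> mean (\<lambda>x. g n (x + t) - indicat_real A (x + t))"
      proof (rule mean_mono)
        show "norm (indicat_real B x * g n (x + t) - indicat_real B x * indicat_real A (x + t)) \<le> g n (x + t) - indicat_real A (x + t)" for x
          using ge[of "x + t" n] by (auto simp: indicator_def[of B])
      qed (intro circ_fun_norm circ_fun_diff circ_fun_mult ic circ_fun_translate gc)+
      also have "\<dots> = mean (g n) - per_measure A"
        by (subst mean_diff) (auto simp: mean_translate_real gc ic per_measure_def intro!: circ_fun_translate gc ic)
      finally show "dist (hn n t) (h t) < e" using n by (simp add: dist_real_def)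
    qed
  qed
  from uniform_limit_theorem[OF _ this] have "continuous_on UNIV h" using hnc by simp
  then show ?thesis unfolding h_def[abs_def] .
qed

text \<open>As a function of t the measure of the intersection is continuous and has mean |A| |B|,
  so by the intermediate value theorem it attains its mean.\<close>

lemma exists_translate_Int:
  assumes A: "closed_periodic A" and B: "closed_periodic B"
  obtains t where "per_measure (B \<inter> {x. x + t \<in> A}) = per_measure A * per_measure B"
proof (cases "A = {}")
  case True
  have "per_measure {} = 0" by (rule per_measure_empty)
  then show ?thesis using True that by simp
next
  case False
  define h where "h t = mean (\<lambda>x. indicat_real B x * indicat_real A (x + t))" for t
  have hpm: "h t = per_measure (B \<inter> {x. x + t \<in> A})" for t
    unfolding h_def per_measure_def by (rule arg_cong[where f=mean]) (auto simp: indicator_def fun_eq_iff)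
  have hc: "continuous_on UNIV h"
    using continuous_correlation[OF A False B] by (simp add: h_def[abs_def])
  have "circ_fun h"
  proof (rule circ_funI[where C=1])
    show "h \<in> borel_measurable borel" by (rule borel_measurable_continuous_onI[OF hc])
    show "norm (h t) \<le> 1" for t
      using per_measure_bounds[OF closed_periodic_Int[OF B closed_periodic_translate[OF A]], of t] by (simp add: hpm)
    have "x + (t + 1) \<in> A \<longleftrightarrow> x + t \<in> A" for x t
      using A unfolding closed_periodic_def by (metis add.assoc)
    then show "h (t + 1) = h t" for t by (simp add: h_def indicator_def)
  qed
  have mh: "mean h = per_measure A * per_measure B"
    using mean_correlation[OF circ_fun_closed_periodic[OF B] circ_fun_closed_periodic[OF A]] by (simp add: h_def[abs_def] per_measure_def mult.commute)
  have "\<exists>t. h t \<le> per_measure A * per_measure B"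
  proof (rule ccontr)
    assume "\<not> ?thesis"
    then have gt: "h t > per_measure A * per_measure B" for t by (simp add: not_le)
    have "\<exists>m\<in>{0..1}. \<forall>t\<in>{0..1}. h m \<le> h t"
      by (rule continuous_attains_inf) (use hc in \<open>auto intro: continuous_on_subset\<close>)
    then obtain m where m: "\<And>t. t \<in> {0..1} \<Longrightarrow> h m \<le> h t" by blast
    have "h m \<le> h t" for t
    proof -
      have "h (frac t + of_int \<lfloor>t\<rfloor>) = h (frac t)" by (rule circ_fun_period_int[OF \<open>circ_fun h\<close>])
      moreover have "frac t + of_int \<lfloor>t\<rfloor> = t" by (simp add: frac_def)
      moreover have "frac t \<in> {0..1}" using frac_lt_1[of t] by simp
      ultimately show ?thesis using m[of "frac t"] by simp
    qed
    then have "mean (\<lambda>_. h m) \<le> mean h" by (intro mean_mono circ_fun_const \<open>circ_fun h\<close>)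
    then show False using gt[of m] mh by simp
  qed
  then obtain t1 where t1: "h t1 \<le> per_measure A * per_measure B" by blast
  have "\<exists>t. h t \<ge> per_measure A * per_measure B"
  proof (rule ccontr)
    assume "\<not> ?thesis"
    then have gt: "h t < per_measure A * per_measure B" for t by (simp add: not_le)
    have "\<exists>m\<in>{0..1}. \<forall>t\<in>{0..1}. h t \<le> h m"
      by (rule continuous_attains_sup) (use hc in \<open>auto intro: continuous_on_subset\<close>)
    then obtain m where m: "\<And>t. t \<in> {0..1} \<Longrightarrow> h t \<le> h m" by blast
    have "h t \<le> h m" for t
    proof -
      have "h (frac t + of_int \<lfloor>t\<rfloor>) = h (frac t)" by (rule circ_fun_period_int[OF \<open>circ_fun h\<close>])
      moreover have "frac t + of_int \<lfloor>t\<rfloor> = t" by (simp add: frac_def)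
      moreover have "frac t \<in> {0..1}" using frac_lt_1[of t] by simp
      ultimately show ?thesis using m[of "frac t"] by simp
    qed
    then have "mean h \<le> mean (\<lambda>_. h m)" by (intro mean_mono circ_fun_const \<open>circ_fun h\<close>)
    then show False using gt[of m] mh by simp
  qed
  then obtain t2 where t2: "h t2 \<ge> per_measure A * per_measure B" by blast
  have "connected (range h)" by (rule connected_continuous_image[OF hc]) simp
  then have "per_measure A * per_measure B \<in> range h" using t1 t2 connectedD_interval[of "range h" "h t1" "h t2"] by blast
  then show ?thesis using that hpm by (metis imageE)
qed

text \<open>Raikov's inequality, by iterating Dyson's transform \<open>(A, B) \<mapsto> (A \<union> (B + t), B \<inter> (A - t))\<close>:
  at each step \<open>t\<close> is chosen so that the measure of \<open>B\<close> is multiplied by that of \<open>A\<close>.\<close>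

lemma raikov_step:
  assumes "closed_periodic A" "closed_periodic B" "per_measure B > 0" "per_measure A > 0" "per_measure A + per_measure B \<le> 1"
  shows "per_measure (sumset A B) \<ge> per_measure A + per_measure B - per_measure B / (1 + real n * per_measure B)"
  using assms
proof (induction n arbitrary: A B)
  case 0
  have "B \<noteq> {}"
  proof
    assume "B = {}"
    then have "per_measure B = 0" by (simp add: per_measure_empty)
    then show False using 0 by simp
  qed
  then obtain b where b: "b \<in> B" by blast
  have "{x. x + (- b) \<in> A} \<subseteq> sumset A B"
  proof
    fix x assume "x \<in> {x. x + (- b) \<in> A}"
    then have "x - b \<in> A" "x = (x - b) + b" by simp_all
    then show "x \<in> sumset A B" using b unfolding sumset_def by blast
  qed
  then have "per_measure {x. x + (- b) \<in> A} \<le> per_measure (sumset A B)"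
    using 0 by (intro per_measure_mono closed_periodic_translate closed_periodic_sumset) auto
  then show ?case using per_measure_translate[of A "- b"] 0 by simp
next
  case (Suc n)
  obtain t where t: "per_measure (B \<inter> {x. x + t \<in> A}) = per_measure A * per_measure B"
    using exists_translate_Int[OF Suc.prems(1,2)] by blast
  define B' where "B' = B \<inter> {x. x + t \<in> A}"
  define A' where "A' = A \<union> {x. x + (- t) \<in> B}"
  have cp': "closed_periodic A'" "closed_periodic B'" unfolding A'_def B'_def
    using Suc.prems(1,2) closed_periodic_translate[OF Suc.prems(1), of t] closed_periodic_translate[OF Suc.prems(2), of "- t"]
    by (auto intro!: closed_periodic_Un closed_periodic_Int)
  have "per_measure (A \<inter> {x. x + (- t) \<in> B}) = per_measure B'"
  proof -
    have "per_measure {x. x + (- t) \<in> B'} = per_measure B'" by (rule per_measure_translate[OF cp'(2)])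
    moreover have "{x. x + (- t) \<in> B'} = A \<inter> {x. x + (- t) \<in> B}" by (auto simp: B'_def)
    ultimately show ?thesis by simp
  qed
  then have A': "per_measure A' = per_measure A + per_measure B - per_measure B'"
    using per_measure_Un_Int[OF Suc.prems(1) closed_periodic_translate[OF Suc.prems(2)], of "- t"] per_measure_translate[OF Suc.prems(2), of "- t"]
    by (simp add: A'_def)
  have B': "per_measure B' = per_measure A * per_measure B" using t by (simp add: B'_def)
  have B'pos: "per_measure B' > 0" using B' Suc.prems by simp
  have "per_measure A * per_measure B \<le> 1 * per_measure B" using Suc.prems per_measure_bounds by (intro mult_right_mono) auto
  then have A'pos: "per_measure A' > 0" using A' B' Suc.prems(4) by linarith
  have sub: "sumset A' B' \<subseteq> sumset A B"
  proof
    fix z assume "z \<in> sumset A' B'"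
    then obtain a b where ab: "z = a + b" "a \<in> A'" "b \<in> B'" by (auto simp: sumset_def)
    from ab(2) consider "a \<in> A" | "a + (- t) \<in> B" by (auto simp: A'_def)
    then show "z \<in> sumset A B"
    proof cases
      case 1
      then show ?thesis using ab by (auto simp: sumset_def B'_def)
    next
      case 2
      moreover have "b + t \<in> A" using ab by (simp add: B'_def)
      moreover have "z = (b + t) + (a + (- t))" using ab by simp
      ultimately show ?thesis unfolding sumset_def by blast
    qed
  qed
  have "per_measure A' + per_measure B' - per_measure B' / (1 + real n * per_measure B') \<le> per_measure (sumset A' B')"
    using A' Suc.prems by (intro Suc.IH cp' B'pos A'pos) simp
  also have "\<dots> \<le> per_measure (sumset A B)" using sub Suc.prems cp' by (intro per_measure_mono closed_periodic_sumset) auto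
  finally have 1: "per_measure A + per_measure B - per_measure B' / (1 + real n * per_measure B') \<le> per_measure (sumset A B)" using A' by simp
  define b where "b = per_measure B"
  have b: "0 < b" using Suc.prems by (simp add: b_def)
  have b1: "b < 1" using Suc.prems by (simp add: b_def)
  have b'le: "per_measure B' \<le> b * (1 - b)"
    unfolding B' b_def using Suc.prems by (subst mult.commute) (intro mult_left_mono, auto)
  \<comment> \<open>In reciprocals: |B'| \<le> b (1 - b) gives 1/|B'| \<ge> 1/b + 1/(1 - b) \<ge>
    1/b + 1, so each transform adds at least 1 to the reciprocal of the deficit.\<close>
  have "per_measure B' / (1 + real n * per_measure B') \<le> b / (1 + real (Suc n) * b)"
  proof -
    have "per_measure B' * (1 + real (Suc n) * b) \<le> b * (1 + real n * per_measure B')"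
    proof -
      have "per_measure B' * (1 + b) \<le> b * (1 - b) * (1 + b)" using b'le b by (intro mult_right_mono) auto
      also have "\<dots> = b - b * b * b" by (simp add: algebra_simps)
      also have "\<dots> \<le> b" using b by simp
      finally show ?thesis by (simp add: algebra_simps)
    qed
    moreover have "0 < 1 + real n * per_measure B'" "0 < 1 + real (Suc n) * b"
      using b B'pos by (auto intro: add_pos_nonneg)
    ultimately show ?thesis by (simp add: frac_le_eq divide_le_eq pos_le_divide_eq mult.commute)
  qed
  then show ?case using 1 by (simp add: b_def)
qed

text \<open>If the measures add up to at most 1, the deficit in \<open>raikov_step\<close> tends to
  0 as n grows. Otherwise A and z - B must meet for every z, and the sumset is everything.\<close>

lemma raikov:
  assumes A: "closed_periodic A" "per_measure A > 0" and B: "closed_periodic B" "per_measure B > 0"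
  shows "per_measure (sumset A B) \<ge> min 1 (per_measure A + per_measure B)"
proof (cases "per_measure A + per_measure B \<le> 1")
  case True
  have "per_measure A + per_measure B \<le> per_measure (sumset A B) + e" if e: "e > 0" for e
  proof -
    obtain n where n: "real n > 1 / e" using reals_Archimedean2 by blast
    then have n0: "real n > 0" using e by (meson less_trans zero_less_divide_1_iff)
    have "per_measure B / (1 + real n * per_measure B) \<le> per_measure B / (real n * per_measure B)"
      using n0 B by (intro divide_left_mono) (auto intro!: mult_pos_pos add_pos_pos)
    also have "\<dots> = 1 / real n" using B by simp
    also have "\<dots> \<le> e" using n n0 e by (simp add: field_simps)
    finally show ?thesis using raikov_step[OF A(1) B(1) B(2) A(2) True, of n] by linarith
  qed
  then have "per_measure A + per_measure B \<le> per_measure (sumset A B)" by (rule field_le_epsilon)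
  then show ?thesis by simp
next
  case False
  have "z \<in> sumset A B" for z
  proof (rule ccontr)
    assume z: "z \<notin> sumset A B"
    have neg: "y \<in> (\<lambda>x. - x) ` B \<longleftrightarrow> - y \<in> B" for y by (auto intro: image_eqI[of _ _ "- y"])
    have cr: "closed_periodic ((\<lambda>x. - x) ` B)"
    proof -
      have "closed ((\<lambda>x. - x) ` B)" using B(1) by (auto simp: closed_periodic_def intro: closed_negations)
      moreover have "x + 1 \<in> (\<lambda>x. - x) ` B \<longleftrightarrow> x \<in> (\<lambda>x. - x) ` B" for x
      proof -
        have "- (x + 1) \<in> B \<longleftrightarrow> - x \<in> B"
          using closed_periodic_period_int[OF B(1), of "- (x + 1)" 1] by simp
        then show ?thesis unfolding neg .
      qed
      ultimately show ?thesis by (simp add: closed_periodic_def)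
    qed
    define C where "C = {x. x + (- z) \<in> (\<lambda>x. - x) ` B}"
    have C: "C = {x. z - x \<in> B}" unfolding C_def neg by simp
    have cC: "closed_periodic C" unfolding C_def by (rule closed_periodic_translate[OF cr])
    have refl: "mean (\<lambda>x. f (- x)) = mean f" if f: "circ_fun f" for f :: "real \<Rightarrow> real"
    proof -
      have "mean (\<lambda>x. f (- x)) = (LINT x|lborel. indicat_real {0..<1} (- x) *\<^sub>R f x)"
        unfolding mean_def set_lebesgue_integral_def
        by (subst lborel_integral_real_affine[where c="-1" and t=0]) auto
      also have "\<dots> = (LINT x|lborel. indicat_real {-1..<0} x *\<^sub>R f x)"
      proof (rule integral_cong_AE)
        show "AE x in lborel. indicat_real {0..<1} (- x) *\<^sub>R f x = indicat_real {-1..<0} x *\<^sub>R f x"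
          using AE_lborel_singleton[of 0] AE_lborel_singleton[of "-1"]
          by eventually_elim (auto simp: indicator_def)
      qed (use circ_fun_measurable[OF f] in auto)
      also have "\<dots> = mean f"
        using set_integral_Ico_translate[of 0 "-1" 1 f] circ_fun_period_int[OF f, of _ "-1"]
        by (simp add: mean_def set_lebesgue_integral_def)
      finally show ?thesis .
    qed
    have "per_measure C = per_measure ((\<lambda>x. - x) ` B)" unfolding C_def by (rule per_measure_translate[OF cr])
    also have "\<dots> = per_measure B"
    proof -
      have "indicat_real ((\<lambda>x. - x) ` B) = (\<lambda>x. indicat_real B (- x))"
        by (intro ext) (simp add: indicator_def neg)
      then show ?thesis unfolding per_measure_def using refl[OF circ_fun_closed_periodic[OF B(1)]] by simp
    qed
    finally have "per_measure C = per_measure B" .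
    moreover have "A \<inter> C = {}"
    proof (rule equals0I)
      fix x assume "x \<in> A \<inter> C"
      then have "x \<in> A" "z - x \<in> B" "z = x + (z - x)" by (auto simp: C)
      then show False using z unfolding sumset_def by blast
    qed
    moreover have "per_measure {} = 0" by (rule per_measure_empty)
    ultimately have "per_measure (A \<union> C) = per_measure A + per_measure B" using per_measure_Un_Int[OF A(1) cC] by simp
    then show False using per_measure_bounds(2)[OF closed_periodic_Un[OF A(1) cC]] False by simp
  qed
  then have "sumset A B = UNIV" by auto
  then show ?thesis by (simp add: per_measure_def)
qed

section \<open>Maximal sum-free arcs\<close>

lemma frac_add_int: "frac (x + of_int n) = frac (x :: real)"
  by (simp add: frac_def)

lemma to_circle_eq_iff: "to_circle x = to_circle y \<longleftrightarrow> x - y \<in> \<int>"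
  by transfer (simp add: int_cong_def)

lemma to_circle_surj: obtains x where "c = to_circle x"
proof -
  have "\<exists>x. c = to_circle x" by transfer (blast intro: equivp_reflp[OF equivp_int_cong])
  then show ?thesis using that by blast
qed

lemma to_circle_frac: "to_circle (frac x) = to_circle x"
  unfolding to_circle_eq_iff by (simp add: frac_def)

lemma to_circle_add: "to_circle (x + y) = to_circle x + to_circle y"
  by transfer (simp add: int_cong_def)

lemma to_circle_0: "to_circle 0 = 0"
  by transfer (simp add: int_cong_def)

lemma to_circle_sum: "to_circle (\<Sum>i\<in>I. f i) = (\<Sum>i\<in>I. to_circle (f i))"
  by (induction I rule: infinite_finite_induct) (simp_all add: to_circle_0 to_circle_add)

lemma circle_nmult_to_circle: "circle_nmult n (to_circle x) = to_circle (real n * x)"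
  by transfer (simp add: int_cong_def)

lemma circle_nmult_sum: "circle_nmult (\<Sum>i\<in>I. f i) c = (\<Sum>i\<in>I. circle_nmult (f i) c)"
proof -
  obtain x where c: "c = to_circle x" by (rule to_circle_surj)
  show ?thesis unfolding c circle_nmult_to_circle to_circle_sum[symmetric]
    by (simp add: sum_distrib_right)
qed

lemma inj_on_to_circle: "inj_on to_circle {0..<1}"
proof (rule inj_onI)
  fix x y assume xy: "x \<in> {0..<1}" "y \<in> {0..<1}" "to_circle x = to_circle y"
  then have "x - y \<in> \<int>" by (simp add: to_circle_eq_iff)
  moreover have "\<bar>x - y\<bar> < 1" using xy by auto
  ultimately have "x - y = 0" by (rule Ints_nonzero_abs_less1)
  then show "x = y" by simp
qed

lemma sets_circle_measure:
  "X \<in> sets circle_measure \<longleftrightarrow> (\<exists>Y. Y \<in> sets lebesgue \<and> Y \<subseteq> {0..<1} \<and> X = to_circle ` Y)"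
  unfolding circle_measure_def
  by (subst sets_embed_measure') (auto simp: inj_on_to_circle sets_restrict_space_iff)

lemma measure_circle_image:
  assumes "Y \<in> sets lebesgue" "Y \<subseteq> {0..<1}"
  shows "measure circle_measure (to_circle ` Y) = measure lebesgue Y"
proof -
  have "to_circle ` Y \<in> sets circle_measure" using assms sets_circle_measure by blast
  then have "emeasure circle_measure (to_circle ` Y) = emeasure (lebesgue_on {0..<1}) (to_circle -` to_circle ` Y \<inter> {0..<1})"
    unfolding circle_measure_def by (subst emeasure_embed_measure') (auto simp: inj_on_to_circle)
  also have "to_circle -` to_circle ` Y \<inter> {0..<1} = Y"
    using assms(2) inj_on_to_circle by (auto simp: inj_on_def)
  also have "emeasure (lebesgue_on {0..<1}) Y = emeasure lebesgue Y"
    using assms by (subst emeasure_restrict_space) auto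
  finally show ?thesis by (simp add: measure_def)
qed

text \<open>Index j stands for the (j+1)-fold sumset; starting from A itself keeps the measure
  positive, as Raikov's inequality requires.\<close>

primrec iterated_sumset :: "real set \<Rightarrow> nat \<Rightarrow> real set" where
  "iterated_sumset A 0 = A"
| "iterated_sumset A (Suc j) = sumset (iterated_sumset A j) A"

lemma iterated_sumset_measure:
  assumes A: "closed_periodic A" "per_measure A > 0"
  shows "closed_periodic (iterated_sumset A j) \<and> min 1 (real (Suc j) * per_measure A) \<le> per_measure (iterated_sumset A j)"
proof (induction j)
  case (Suc j)
  have pos: "0 < per_measure (iterated_sumset A j)" using Suc A(2) by (smt (verit) min_def mult_pos_pos of_nat_0_less_iff zero_less_Suc)
  have "min 1 (per_measure (iterated_sumset A j) + per_measure A) \<le> per_measure (iterated_sumset A (Suc j))"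
    using raikov[of "iterated_sumset A j" A] Suc A pos by simp
  moreover have "min 1 (real (Suc (Suc j)) * per_measure A) \<le> min 1 (per_measure (iterated_sumset A j) + per_measure A)"
    using Suc A(2) by (auto simp: min_def distrib_right split: if_splits)
  ultimately show ?case using closed_periodic_sumset[of "iterated_sumset A j" A] Suc A by simp
qed (use A in simp)

lemma iterated_sumset_elem:
  "z \<in> iterated_sumset A j \<Longrightarrow> \<exists>x. (\<forall>i<Suc j. x i \<in> A) \<and> z = (\<Sum>i<Suc j. x i)"
proof (induction j arbitrary: z)
  case 0
  then show ?case by (intro exI[of _ "\<lambda>_. z"]) auto
next
  case (Suc j)
  then obtain a b where ab: "a \<in> iterated_sumset A j" "b \<in> A" "z = a + b" by (auto simp: sumset_def)
  obtain x where x: "\<forall>i<Suc j. x i \<in> A" "a = (\<Sum>i<Suc j. x i)" using Suc.IH[OF ab(1)] by blast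
  define x' where "x' = x(Suc j := b)"
  have "(\<Sum>i<Suc j. x' i) = a" unfolding x(2) by (rule sum.cong) (auto simp: x'_def)
  then have "z = (\<Sum>i<Suc (Suc j). x' i)" using ab(3) by (simp add: x'_def)
  moreover have "\<forall>i<Suc (Suc j). x' i \<in> A" using x(1) ab(2) by (auto simp: x'_def less_Suc_eq)
  ultimately show ?case by blast
qed

text \<open>By inner regularity a larger set would contain a closed part still of measure above
  1/6k. The 2k-fold and 4k-fold sumsets of that part have measures adding up to more than 1, so they
  meet, which is a forbidden equation.\<close>

lemma measure_sum_free_le:
  fixes k :: nat
  assumes k: "k \<ge> 1" and X: "X \<in> sets circle_measure" "sum_free (2 * k) (4 * k) X"
  shows "measure circle_measure X \<le> 1 / (6 * real k)"
proof (rule ccontr)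
  assume "\<not> ?thesis"
  then have gt: "1 / (6 * real k) < measure circle_measure X" by simp
  obtain Y where Y: "Y \<in> sets lebesgue" "Y \<subseteq> {0..<1}" "X = to_circle ` Y"
    using X(1) sets_circle_measure by blast
  have Ym: "Y \<in> lmeasurable" using Y by (intro bounded_set_imp_lmeasurable) (auto intro: bounded_subset[of "{0..<1}"])
  define \<epsilon> where "\<epsilon> = measure lebesgue Y - 1 / (6 * real k)"
  have eps: "\<epsilon> > 0" using gt measure_circle_image[OF Y(1,2)] Y(3) by (simp add: \<epsilon>_def)
  obtain C where C: "closed C" "C \<subseteq> Y" "Y - C \<in> lmeasurable" "emeasure lebesgue (Y - C) < ennreal \<epsilon>"
    using sets_lebesgue_inner_closed[OF Y(1) eps] by metis
  have C01: "C \<subseteq> {0..<1}" using C Y by blast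
  have Cm: "C \<in> lmeasurable" using C(1) C01 by (intro bounded_set_imp_lmeasurable) (auto intro: bounded_subset[of "{0..<1}"])
  have "measure lebesgue (Y - C) < \<epsilon>"
  proof -
    have "ennreal (measure lebesgue (Y - C)) < ennreal \<epsilon>"
      using C(4) unfolding emeasure_eq_measure2[OF C(3)] .
    then show ?thesis by (simp only: ennreal_less_iff[OF measure_nonneg])
  qed
  moreover have "measure lebesgue (Y - C) = measure lebesgue Y - measure lebesgue C"
    by (rule measurable_measure_Diff[OF Ym _ C(2)]) (use Cm in auto)
  ultimately have mC: "measure lebesgue C > 1 / (6 * real k)" by (simp add: \<epsilon>_def)
  define A where "A = {x. frac x \<in> C}"
  have cA: "closed_periodic A"
  proof -
    have "A = (\<Union>x\<in>C. \<Union>y\<in>\<int>. {x + y})"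
    proof
      show "A \<subseteq> (\<Union>x\<in>C. \<Union>y\<in>\<int>. {x + y})"
      proof
        fix x assume "x \<in> A"
        then have "frac x \<in> C" "x = frac x + of_int \<lfloor>x\<rfloor>" by (auto simp: A_def frac_def)
        then show "x \<in> (\<Union>x\<in>C. \<Union>y\<in>\<int>. {x + y})" using Ints_of_int by blast
      qed
      show "(\<Union>x\<in>C. \<Union>y\<in>\<int>. {x + y}) \<subseteq> A"
      proof clarify
        fix x y :: real assume xy: "x \<in> C" "y \<in> \<int>"
        then obtain j where "y = of_int j" by (auto elim: Ints_cases)
        moreover have "0 \<le> x" "x < 1" using xy C01 by auto
        ultimately have "frac (x + y) = x" using frac_eqI[of j "x + y"] by simp
        then show "x + y \<in> A" using xy by (simp add: A_def)
      qed
    qed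
    moreover have "closed (\<Union>x\<in>C. \<Union>y\<in>(\<int>::real set). {x + y})"
      by (rule compact_closed_sums)
         (use C C01 in \<open>auto simp: compact_eq_bounded_closed intro: bounded_subset[of "{0..<1::real}"]\<close>)
    ultimately have "closed A" by (simp only:)
    then show ?thesis by (simp add: closed_periodic_def A_def frac_1_eq)
  qed
  have pA: "per_measure A = measure lebesgue C"
  proof -
    have "per_measure A = (LINT x|lborel. indicat_real C x)"
      unfolding per_measure_def mean_def set_lebesgue_integral_def
      by (rule Bochner_Integration.integral_cong) (use C01 in \<open>auto simp: indicator_def A_def frac_eq\<close>)
    also have "\<dots> = measure lborel C" by simp
    finally show ?thesis using C(1) by simp
  qed
  have "0 < 1 / (6 * real k)" using k by simp
  then have pA0: "per_measure A > 0" using mC unfolding pA by linarith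
  have big: "6 * real k * per_measure A > 1" using mC k by (simp add: pA field_simps)
  note m2 = iterated_sumset_measure[OF cA pA0, of "2 * k - 1"] and m4 = iterated_sumset_measure[OF cA pA0, of "4 * k - 1"]
  have k1: "Suc (2 * k - 1) = 2 * k" "Suc (4 * k - 1) = 4 * k" using k by auto
  \<comment> \<open>If neither minimum is 1, the sum is 6k times the measure; if one of them is 1,
    the other is still positive.\<close>
  have "1 < min 1 (real (2 * k) * per_measure A) + min 1 (real (4 * k) * per_measure A)"
    using big k pA0 by (auto simp: min_def)
  then have "1 < per_measure (iterated_sumset A (2 * k - 1)) + per_measure (iterated_sumset A (4 * k - 1))"
    using m2 m4 unfolding k1 by linarith
  moreover have "per_measure (iterated_sumset A (2 * k - 1) \<union> iterated_sumset A (4 * k - 1)) \<le> 1"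
    using m2 m4 by (intro per_measure_bounds closed_periodic_Un) auto
  ultimately have "iterated_sumset A (2 * k - 1) \<inter> iterated_sumset A (4 * k - 1) \<noteq> {}"
    using per_measure_Un_Int[of "iterated_sumset A (2 * k - 1)" "iterated_sumset A (4 * k - 1)"] m2 m4 per_measure_empty by auto
  then obtain z where "z \<in> iterated_sumset A (2 * k - 1)" "z \<in> iterated_sumset A (4 * k - 1)" by blast
  then obtain x y where xy: "\<forall>i<2 * k. x i \<in> A" "z = (\<Sum>i<2 * k. x i)" "\<forall>j<4 * k. y j \<in> A" "z = (\<Sum>j<4 * k. y j)"
    using iterated_sumset_elem[of z A "2 * k - 1"] iterated_sumset_elem[of z A "4 * k - 1"] unfolding k1 by blast
  have inX: "to_circle a \<in> X" if "a \<in> A" for a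
  proof -
    have "frac a \<in> Y" using that C(2) by (auto simp: A_def)
    then show ?thesis using Y(3) to_circle_frac[of a] by (metis imageI)
  qed
  have "(\<Sum>i<2 * k. to_circle (x i)) = (\<Sum>j<4 * k. to_circle (y j))"
    using xy by (metis to_circle_sum)
  then show False
    using X(2) xy(1,3) inX unfolding sum_free_def
    by (metis (no_types, lifting))
qed

section \<open>Extremal arcs and the waves they generate\<close>

definition arc :: "nat \<Rightarrow> nat \<Rightarrow> real set" where
  "arc k m = {(1 + 3 * real m) / (6 * real k)..<(2 + 3 * real m) / (6 * real k)}"

lemma arc_subset: assumes "k \<ge> 1" "m < 2 * k" shows "arc k m \<subseteq> {0..<1}"
proof
  fix x assume x: "x \<in> arc k m"
  have "real m + 1 \<le> 2 * real k" using assms(2) by linarith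
  then have "(2 + 3 * real m) / (6 * real k) \<le> 1" using assms(1) by (simp add: field_simps)
  moreover have "0 \<le> (1 + 3 * real m) / (6 * real k)" by simp
  moreover have "(1 + 3 * real m) / (6 * real k) \<le> x" "x < (2 + 3 * real m) / (6 * real k)"
    using x by (auto simp: arc_def)
  ultimately have "0 \<le> x" "x < 1" by linarith+
  then show "x \<in> {0..<1}" by simp
qed

lemma to_circle_in_image:
  assumes "Y \<subseteq> {0..<1}" shows "to_circle x \<in> to_circle ` Y \<longleftrightarrow> frac x \<in> Y"
proof
  assume "to_circle x \<in> to_circle ` Y"
  then obtain y where y: "y \<in> Y" "to_circle (frac x) = to_circle y" by (auto simp: to_circle_frac)
  then have "frac x = y" using inj_onD[OF inj_on_to_circle y(2)] assms by (auto simp: frac_lt_1)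
  then show "frac x \<in> Y" using y by simp
next
  assume "frac x \<in> Y"
  then show "to_circle x \<in> to_circle ` Y" using to_circle_frac[of x] by (metis imageI)
qed

text \<open>Modulo 1 the 2k-fold sums lie in [1/3, 2/3) and the 4k-fold sums in [2/3, 4/3). On the
  line this says that their difference lies strictly between -1 - m and -m, where there is no
  integer.\<close>

lemma sum_free_arc:
  assumes k: "k \<ge> 1" and m: "m < 2 * k"
  shows "sum_free (2 * k) (4 * k) (to_circle ` arc k m)"
  unfolding sum_free_def
proof
  assume "\<exists>x y. (\<forall>i<2 * k. x i \<in> to_circle ` arc k m) \<and> (\<forall>j<4 * k. y j \<in> to_circle ` arc k m) \<and>
    (\<Sum>i<2 * k. x i) = (\<Sum>j<4 * k. y j)"
  then obtain X Y where XY: "\<forall>i<2 * k. X i \<in> to_circle ` arc k m" "\<forall>j<4 * k. Y j \<in> to_circle ` arc k m"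
    "(\<Sum>i<2 * k. X i) = (\<Sum>j<4 * k. Y j)" by blast
  have "\<forall>i. \<exists>x. i < 2 * k \<longrightarrow> x \<in> arc k m \<and> X i = to_circle x" using XY(1) by blast
  then obtain x where x: "\<And>i. i < 2 * k \<Longrightarrow> x i \<in> arc k m" "\<And>i. i < 2 * k \<Longrightarrow> X i = to_circle (x i)" by metis
  have "\<forall>i. \<exists>y. i < 4 * k \<longrightarrow> y \<in> arc k m \<and> Y i = to_circle y" using XY(2) by blast
  then obtain y where y: "\<And>i. i < 4 * k \<Longrightarrow> y i \<in> arc k m" "\<And>i. i < 4 * k \<Longrightarrow> Y i = to_circle (y i)" by metis
  define a b where "a = (1 + 3 * real m) / (6 * real k)" and "b = (2 + 3 * real m) / (6 * real k)"
  have "to_circle (\<Sum>i<2 * k. x i) = to_circle (\<Sum>j<4 * k. y j)"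
    using XY(3) x(2) y(2) by (simp add: to_circle_sum)
  then have int: "(\<Sum>i<2 * k. x i) - (\<Sum>j<4 * k. y j) \<in> \<int>" by (simp add: to_circle_eq_iff)
  have ne: "{..<2 * k} \<noteq> {}" "{..<4 * k} \<noteq> {}" using k by (simp_all add: lessThan_empty_iff)
  have "(\<Sum>i<2 * k. a) \<le> (\<Sum>i<2 * k. x i)" using x(1) by (intro sum_mono) (auto simp: arc_def a_def)
  then have 1: "real (2 * k) * a \<le> (\<Sum>i<2 * k. x i)" by simp
  have "(\<Sum>i<2 * k. x i) < (\<Sum>i<2 * k. b)" using x(1) ne by (intro sum_strict_mono) (auto simp: arc_def b_def)
  then have 2: "(\<Sum>i<2 * k. x i) < real (2 * k) * b" by simp
  have "(\<Sum>i<4 * k. a) \<le> (\<Sum>i<4 * k. y i)" using y(1) by (intro sum_mono) (auto simp: arc_def a_def)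
  then have 3: "real (4 * k) * a \<le> (\<Sum>i<4 * k. y i)" by simp
  have "(\<Sum>i<4 * k. y i) < (\<Sum>i<4 * k. b)" using y(1) ne by (intro sum_strict_mono) (auto simp: arc_def b_def)
  then have 4: "(\<Sum>i<4 * k. y i) < real (4 * k) * b" by simp
  have e: "real (2 * k) * a = 1/3 + real m" "real (2 * k) * b = 2/3 + real m"
    "real (4 * k) * a = 2/3 + 2 * real m" "real (4 * k) * b = 4/3 + 2 * real m"
    using k by (simp_all add: a_def b_def field_simps)
  obtain j where j: "(\<Sum>i<2 * k. x i) - (\<Sum>j<4 * k. y j) = of_int j" using int by (auto elim: Ints_cases)
  have "- 1 - real m < of_int j" "of_int j < - real m" using 1 2 3 4 e j by linarith+
  then have "- 1 - int m < j" "j < - int m" by linarith+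
  then show False by linarith
qed

lemma maximal_arc:
  assumes k: "k \<ge> 1" and m: "m < 2 * k"
  shows "maximal_sum_free (2 * k) (4 * k) (to_circle ` arc k m)"
proof -
  have L: "arc k m \<in> sets lebesgue" by (simp add: arc_def)
  have "measure circle_measure (to_circle ` arc k m) = measure lebesgue (arc k m)"
    by (rule measure_circle_image[OF L arc_subset[OF k m]])
  also have "\<dots> = 1 / (6 * real k)"
    using k by (simp add: arc_def divide_right_mono flip: diff_divide_distrib)
  finally have "measure circle_measure (to_circle ` arc k m) = 1 / (6 * real k)" .
  then show ?thesis
    unfolding maximal_sum_free_def using sum_free_arc[OF k m] measure_sum_free_le[OF k] L arc_subset[OF k m] sets_circle_measure by metis
qed

definition arc_fun :: "nat \<Rightarrow> nat \<Rightarrow> real \<Rightarrow> real" where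
  "arc_fun k m y = (if frac y \<in> arc k m then 1 else 0) - 1 / (6 * real k)"

lemma circ_fun_arc_fun: "circ_fun (arc_fun k m)"
proof (rule circ_funI[where C="1 + 1 / (6 * real k)"])
  show "arc_fun k m \<in> borel_measurable borel"
    unfolding arc_fun_def[abs_def] arc_def frac_def atLeastLessThan_iff by measurable
  show "norm (arc_fun k m x) \<le> 1 + 1 / (6 * real k)" for x
    using divide_nonneg_nonneg[of 1 "6 * real k"] unfolding arc_fun_def real_norm_def by (auto simp: abs_le_iff)
qed (simp add: arc_fun_def frac_1_eq)

lemma mean_arc_fun:
  assumes k: "k \<ge> 1" and m: "m < 2 * k" shows "mean (arc_fun k m) = 0"
proof -
  have c: "circ_fun (\<lambda>y. arc_fun k m y + 1 / (6 * real k))" by (intro circ_fun_add circ_fun_arc_fun circ_fun_const)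
  have "mean (\<lambda>y. arc_fun k m y + 1 / (6 * real k)) = (LINT x|lborel. indicat_real (arc k m) x)"
    unfolding mean_def set_lebesgue_integral_def
    by (rule Bochner_Integration.integral_cong) (use arc_subset[OF k m] in \<open>auto simp: indicator_def arc_fun_def frac_eq\<close>)
  also have "\<dots> = measure lborel (arc k m)" by simp
  also have "\<dots> = 1 / (6 * real k)"
    using k by (simp add: arc_def divide_right_mono flip: diff_divide_distrib)
  finally show ?thesis by (simp add: mean_add circ_fun_arc_fun circ_fun_const)
qed

text \<open>Multiplication by 2k carries every arc onto the middle third modulo 1. Multiplication by
  k carries the arcs with even m onto [1/6, 1/3) and those with odd m onto [2/3, 5/6), so
  alternating signs give the odd wave, and the constants 1/6k cancel.\<close>

lemma sum_arc_fun:
  assumes k: "k \<ge> 1"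
  shows "(\<Sum>m<2 * k. arc_fun k m y) = third_wave (real (2 * k) * y)"
    "(\<Sum>m<2 * k. (-1) ^ m * arc_fun k m y) = sixth_wave (real k * y)"
proof -
  \<comment> \<open>In the scale 6k the period has length 6k, and z = 3 m0 + r singles out the only
    arc that can contain the point: it does so exactly for 1 \<le> r < 2.\<close>
  define z where "z = 6 * real k * frac y"
  have z: "0 \<le> z" "z < 6 * real k" using k frac_lt_1[of y] by (auto simp: z_def)
  define m0 where "m0 = nat \<lfloor>z / 3\<rfloor>"
  define r where "r = z - 3 * real m0"
  have m0: "real m0 \<le> z / 3" "z / 3 < real m0 + 1" using z unfolding m0_def by linarith+
  have r: "0 \<le> r" "r < 3" using m0 by (auto simp: r_def)
  have m0k: "m0 < 2 * k" using m0 z by linarith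
  have in_arc: "frac y \<in> arc k m \<longleftrightarrow> m = m0 \<and> 1 \<le> r \<and> r < 2" for m
  proof -
    have "frac y \<in> arc k m \<longleftrightarrow> 1 + 3 * real m \<le> z \<and> z < 2 + 3 * real m"
      using k by (auto simp: arc_def z_def field_simps)
    also have "\<dots> \<longleftrightarrow> m = m0 \<and> 1 \<le> r \<and> r < 2"
    proof
      assume a: "1 + 3 * real m \<le> z \<and> z < 2 + 3 * real m"
      then have "real m < real m0 + 1" "real m0 < real m + 1" using m0 by linarith+
      then have "m = m0" by linarith
      then show "m = m0 \<and> 1 \<le> r \<and> r < 2" using a by (simp add: r_def)
    qed (auto simp: r_def)
    finally show ?thesis .
  qed
  have gen: "(\<Sum>m<2 * k. c m * arc_fun k m y) = (if 1 \<le> r \<and> r < 2 then c m0 else 0) - (\<Sum>m<2 * k. c m) / (6 * real k)" for c :: "nat \<Rightarrow> real"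
  proof -
    have "(\<Sum>m<2 * k. c m * arc_fun k m y) = (\<Sum>m<2 * k. (if m = m0 then (if 1 \<le> r \<and> r < 2 then c m else 0) else 0) - c m / (6 * real k))"
      by (intro sum.cong refl) (auto simp: arc_fun_def in_arc right_diff_distrib)
    also have "\<dots> = (if 1 \<le> r \<and> r < 2 then c m0 else 0) - (\<Sum>m<2 * k. c m) / (6 * real k)"
      using m0k by (simp add: sum_subtractf sum_divide_distrib)
    finally show ?thesis .
  qed
  have y: "y = frac y + of_int \<lfloor>y\<rfloor>" by (simp add: frac_def)
  have per: "frac (real j * y) = frac (real j * frac y)" for j
  proof -
    have "real j * y = real j * frac y + of_int (int j * \<lfloor>y\<rfloor>)" by (subst y) (simp add: distrib_left)
    then show ?thesis by (simp only: frac_add_int)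
  qed
  have "real (2 * k) * frac y = r / 3 + of_int (int m0)" using k by (simp add: r_def z_def field_simps)
  then have "frac (real (2 * k) * y) = frac (r / 3)" by (simp only: per frac_add_int)
  also have "\<dots> = r / 3" using r by (simp add: frac_eq)
  finally have f3: "frac (real (2 * k) * y) = r / 3" .
  show "(\<Sum>m<2 * k. arc_fun k m y) = third_wave (real (2 * k) * y)"
    using gen[of "\<lambda>_. 1"] k unfolding third_wave_def f3 by (auto simp: field_simps)
  have alt: "(\<Sum>m<2 * k. (-1) ^ m) = (0::real)" by (induction k) auto
  have k6: "real k * frac y = (real m0 * 3 + r) / 6" by (simp add: r_def z_def)
  show "(\<Sum>m<2 * k. (-1) ^ m * arc_fun k m y) = sixth_wave (real k * y)"
  proof (cases "even m0")
    case True
    then obtain j where j: "m0 = 2 * j" by (elim evenE)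
    have "real k * frac y = r / 6 + of_int (int j)" unfolding k6 j by simp
    then have "frac (real k * y) = frac (r / 6)" by (simp only: per frac_add_int)
    also have "\<dots> = r / 6" using r by (simp add: frac_eq)
    finally show ?thesis using gen[of "\<lambda>m. (-1) ^ m"] True r alt unfolding sixth_wave_def by auto
  next
    case False
    then obtain j where j: "m0 = 2 * j + 1" by (elim oddE)
    have "real k * frac y = (r / 6 + 1 / 2) + of_int (int j)" unfolding k6 j by simp
    then have "frac (real k * y) = frac (r / 6 + 1 / 2)" by (simp only: per frac_add_int)
    also have "\<dots> = r / 6 + 1 / 2" using r by (simp add: frac_eq)
    finally show ?thesis using gen[of "\<lambda>m. (-1) ^ m"] False r alt unfolding sixth_wave_def by auto
  qed
qed

text \<open>Pointwise |f| \<le> 2K - f, because f \<le> K and, the mean being zero, K \<ge>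
  0.\<close>

lemma mean_abs_le_twice_max:
  fixes f :: "real \<Rightarrow> real"
  assumes f: "circ_fun f" "mean f = 0" and K: "\<And>x. f x \<le> K"
  shows "mean (\<lambda>x. \<bar>f x\<bar>) \<le> 2 * K"
proof -
  have "mean f \<le> mean (\<lambda>x. K)" by (intro mean_mono f(1) circ_fun_const K)
  then have K0: "0 \<le> K" using f(2) by simp
  have ca: "circ_fun (\<lambda>x. \<bar>f x\<bar>)" using circ_fun_norm[OF f(1)] by simp
  have "mean (\<lambda>x. \<bar>f x\<bar>) \<le> mean (\<lambda>x. 2 * K - f x)"
  proof (rule mean_mono[OF ca])
    show "\<bar>f x\<bar> \<le> 2 * K - f x" for x using K[of x] K0 by linarith
  qed (intro circ_fun_diff circ_fun_const f(1))
  also have "\<dots> = 2 * K" by (simp add: mean_diff circ_fun_const f)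
  finally show ?thesis .
qed

text \<open>The triangle inequality over 2k arcs, each of L^1 norm at most 2K; the dilations by k
  and 2k in \<open>sum_arc_fun\<close> do not change the mean.\<close>

lemma waves_le_arc_bound:
  assumes k: "k \<ge> 1" and A: "0 \<notin> A" and K: "\<And>m x. m < 2 * k \<Longrightarrow> (\<Sum>n\<in>A. arc_fun k m (real n * x)) \<le> K"
  shows "mean (\<lambda>x. \<bar>\<Sum>n\<in>A. sixth_wave (real n * x)\<bar>) \<le> 4 * real k * K"
    "mean (\<lambda>x. \<bar>\<Sum>n\<in>A. third_wave (real n * x)\<bar>) \<le> 4 * real k * K"
proof -
  define f where "f m x = (\<Sum>n\<in>A. arc_fun k m (real n * x))" for m x
  have f_circ: "circ_fun (f m)" for m unfolding f_def by (intro circ_fun_sum circ_fun_dilate circ_fun_arc_fun)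
  have fa: "circ_fun (\<lambda>x. \<bar>f m x\<bar>)" for m using circ_fun_norm[OF f_circ] by simp
  have mf: "mean (\<lambda>x. \<bar>f m x\<bar>) \<le> 2 * K" if m: "m < 2 * k" for m
  proof (rule mean_abs_le_twice_max[OF f_circ])
    have "mean (f m) = (\<Sum>n\<in>A. mean (\<lambda>x. arc_fun k m (real n * x)))"
      unfolding f_def by (rule mean_sum) (intro circ_fun_dilate circ_fun_arc_fun)
    also have "\<dots> = 0"
    proof (rule sum.neutral, rule ballI)
      fix n assume "n \<in> A"
      then have "n > 0" using A by (auto intro: gr0I)
      then show "mean (\<lambda>x. arc_fun k m (real n * x)) = 0"
        using mean_dilate[OF circ_fun_arc_fun, of n k m] mean_arc_fun[OF k m] by simp
    qed
    finally show "mean (f m) = 0" .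
    show "f m x \<le> K" for x unfolding f_def by (rule K[OF m])
  qed
  have gen: "mean (\<lambda>x. \<bar>g (real j * x)\<bar>) \<le> 4 * real k * K"
    if g: "\<And>x. g (real j * x) = (\<Sum>m<2 * k. c m * f m x)" "circ_fun g" "\<And>m. \<bar>c m\<bar> = 1" for g j and c :: "nat \<Rightarrow> real"
  proof -
    have "circ_fun (\<lambda>x. g (real j * x))" by (rule circ_fun_dilate[OF g(2)])
    then have ga: "circ_fun (\<lambda>x. \<bar>g (real j * x)\<bar>)" using circ_fun_norm by fastforce
    have "mean (\<lambda>x. \<bar>g (real j * x)\<bar>) \<le> mean (\<lambda>x. \<Sum>m<2 * k. \<bar>f m x\<bar>)"
    proof (rule mean_mono[OF ga])
      show "\<bar>g (real j * x)\<bar> \<le> (\<Sum>m<2 * k. \<bar>f m x\<bar>)" for x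
        unfolding g(1) by (rule order_trans[OF sum_abs]) (simp add: abs_mult g(3))
    qed (intro circ_fun_sum fa)
    also have "\<dots> = (\<Sum>m<2 * k. mean (\<lambda>x. \<bar>f m x\<bar>))" by (rule mean_sum) (rule fa)
    also have "\<dots> \<le> (\<Sum>m<2 * k. 2 * K)" by (intro sum_mono mf) simp
    finally show ?thesis by simp
  qed
  define S where "S x = (\<Sum>n\<in>A. sixth_wave (real n * x))" for x
  define T where "T x = (\<Sum>n\<in>A. third_wave (real n * x))" for x
  have Sc: "circ_fun S" and Tc: "circ_fun T" unfolding S_def T_def by (intro circ_fun_sum circ_fun_dilate circ_fun_waves)+
  have "S (real k * x) = (\<Sum>m<2 * k. (-1) ^ m * f m x)" for x
  proof -
    have "S (real k * x) = (\<Sum>n\<in>A. \<Sum>m<2 * k. (-1) ^ m * arc_fun k m (real n * x))"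
      unfolding S_def sum_arc_fun(2)[OF k] by (simp add: mult_ac)
    also have "\<dots> = (\<Sum>m<2 * k. (-1) ^ m * f m x)" unfolding f_def sum_distrib_left by (rule sum.swap)
    finally show ?thesis .
  qed
  from gen[OF this Sc] have "mean (\<lambda>x. \<bar>S (real k * x)\<bar>) \<le> 4 * real k * K" by (simp add: power_abs)
  moreover have "mean (\<lambda>x. \<bar>S (real k * x)\<bar>) = mean (\<lambda>x. \<bar>S x\<bar>)"
    using mean_dilate[OF circ_fun_norm[OF Sc], of k] k by simp
  ultimately show "mean (\<lambda>x. \<bar>\<Sum>n\<in>A. sixth_wave (real n * x)\<bar>) \<le> 4 * real k * K" by (simp add: S_def)
  have "T (real (2 * k) * x) = (\<Sum>m<2 * k. 1 * f m x)" for x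
  proof -
    have "T (real (2 * k) * x) = (\<Sum>n\<in>A. \<Sum>m<2 * k. arc_fun k m (real n * x))"
      unfolding T_def sum_arc_fun(1)[OF k] by (simp add: mult_ac)
    also have "\<dots> = (\<Sum>m<2 * k. 1 * f m x)" unfolding f_def mult_1 by (rule sum.swap)
    finally show ?thesis .
  qed
  from gen[OF this Tc] have "mean (\<lambda>x. \<bar>T (real (2 * k) * x)\<bar>) \<le> 4 * real k * K" by simp
  moreover have "mean (\<lambda>x. \<bar>T (real (2 * k) * x)\<bar>) = mean (\<lambda>x. \<bar>T x\<bar>)"
    using mean_dilate[OF circ_fun_norm[OF Tc], of "2 * k"] k by simp
  ultimately show "mean (\<lambda>x. \<bar>\<Sum>n\<in>A. third_wave (real n * x)\<bar>) \<le> 4 * real k * K" by (simp add: T_def)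
qed

text \<open>The cases are separated by N = s^12, where s is the size of the boundary. If N \<le>
  s^12, then ln s is a fixed proportion of ln N and the block bound applies. If not, s^3 is below
  N^{1/4}, and the moment bound sqrt N \<le> 640 s^3 K makes K as large as N^{1/4} / 640.\<close>

lemma waves_lower_bound:
  fixes A :: "nat set" and K :: real
  assumes A: "finite A" "0 \<notin> A" and N: "ln (real (card A)) \<ge> 34"
    and K: "mean (\<lambda>x. \<bar>\<Sum>n\<in>A. sixth_wave (real n * x)\<bar>) \<le> K" "mean (\<lambda>x. \<bar>\<Sum>n\<in>A. third_wave (real n * x)\<bar>) \<le> K"
  shows "omega (card A) / (34 * 9600 * 28 * exp 4) \<le> K"
proof -
  define N where "N = real (card A)"
  define L where "L = ln N"
  have L: "L \<ge> 34" using assms(3) by (simp add: L_def N_def)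
  have N0: "N > 0"
  proof (rule ccontr)
    assume "\<not> N > 0"
    then have "N = 0" by (simp add: N_def)
    then show False using L by (simp add: L_def)
  qed
  have NL: "N = exp L" using N0 by (simp add: L_def)
  have LL: "ln L \<ge> 1"
  proof -
    have "exp 1 \<le> L" using e_less_272 L by linarith
    then show ?thesis using L by (simp add: ln_ge_iff)
  qed
  have om: "omega (card A) = L / ln L" by (simp add: omega_def L_def N_def)
  have Ane: "A \<noteq> {}" using N0 by (auto simp: N_def)
  define s where "s = card (tripling_boundary A)"
  have third: "sqrt N \<le> 640 * (real s) ^ 3 * K"
  proof -
    have "sqrt N \<le> 640 * (real s) ^ 3 * mean (\<lambda>x. \<bar>third_sum A x\<bar>)"
      unfolding N_def by (rule mean_third_sum_ge[OF A Ane]) (simp add: s_def)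
    also have "\<dots> \<le> 640 * (real s) ^ 3 * K" using K(2) by (intro mult_left_mono) (simp_all add: third_sum_def)
    finally show ?thesis .
  qed
  have s0: "s > 0"
  proof (rule ccontr)
    assume "\<not> s > 0"
    then have "sqrt N \<le> 0" using third by simp
    then show False using N0 by simp
  qed
  show ?thesis
  proof (cases "N \<le> real s ^ 12")
    case True
    then have "ln N \<le> ln (real s ^ 12)" using N0 s0 by (subst ln_le_cancel_iff) auto
    then have lns: "L \<le> 12 * ln (real s)" using s0 by (simp add: L_def ln_realpow)
    \<comment> \<open>With ln 4 \<le> 1.4 the logarithm to base 4 of s is at least L/17, which is at
      least L/34 + 1 because L \<ge> 34; rounding down therefore leaves J \<ge> L/34.\<close>
    define J where "J = nat \<lfloor>log 4 (real s)\<rfloor>"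
    have ln4: "0 < ln (4::real)" "ln (4::real) \<le> 1.4"
    proof -
      have "ln (4::real) = 2 * ln 2" using ln_realpow[of 2 2] by simp
      then show "0 < ln (4::real)" "ln (4::real) \<le> 1.4" using ln2_le_25_over_36 ln_gt_zero[of "2::real"] by simp_all
    qed
    have "L / 17 \<le> log 4 (real s)"
    proof -
      have "L * ln 4 \<le> L * 1.4" using ln4 L by (intro mult_left_mono) auto
      also have "\<dots> \<le> 17 * ln (real s)" using lns L by linarith
      finally show ?thesis using ln4 by (simp add: log_def field_simps)
    qed
    then have lg: "L / 34 + 1 \<le> log 4 (real s)" using L by linarith
    have J1: "log 4 (real s) - 1 \<le> real J" "real J \<le> log 4 (real s)" using lg L unfolding J_def by linarith+
    have J0: "J > 0" and JL: "L / 34 \<le> real J" using J1 lg L by linarith+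
    have "(4::real) ^ J \<le> real s"
    proof -
      have "(4::real) ^ J = 4 powr real J" by (simp add: powr_realpow)
      also have "\<dots> \<le> 4 powr (log 4 (real s))" using J1 by (intro powr_mono) auto
      also have "\<dots> = real s" using s0 by simp
      finally show ?thesis .
    qed
    then have "4 ^ J \<le> s" by (metis of_nat_le_iff of_nat_numeral of_nat_power)
    moreover have "(\<Sum>i<J. (4::nat) ^ i) \<le> 4 ^ J" by (induction J) auto
    ultimately have Js: "(\<Sum>i<J. 4 ^ i) \<le> card (tripling_boundary A)" by (simp add: s_def)
    \<comment> \<open>Of size ln N, so that e^{2q} is at least 2N, a bound for the size of the
      boundary.\<close>
    define q where "q = nat \<lceil>L\<rceil>"
    have q: "L \<le> real q" "real q \<le> L + 1" using L unfolding q_def by linarith+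
    have q1: "q \<ge> 1" using q L by linarith
    have "2 * real (card A) \<le> exp (2 * real q)"
    proof -
      have "2 \<le> exp L" using exp_ge_add_one_self[of L] L by linarith
      then have "2 * N \<le> exp L * exp L" unfolding NL by (intro mult_right_mono) auto
      also have "\<dots> = exp (2 * L)" by (simp flip: exp_add)
      also have "\<dots> \<le> exp (2 * real q)" using q by simp
      finally show ?thesis by (simp add: N_def)
    qed
    from blocks_le_mean_waves[OF A K q1 this J0 Js]
    have "real J \<le> 9600 * exp 4 * ln (10 ^ 10 * (real q)\<^sup>2) * K" .
    moreover have "K \<ge> 0"
    proof -
      have "0 \<le> mean (\<lambda>x. norm (third_sum A x))" by (rule mean_nonneg[OF circ_fun_norm[OF circ_fun_third_sum]]) simp
      then show ?thesis using K(2) by (simp add: third_sum_def)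
    qed
    \<comment> \<open>This is the factor ln ln N that is lost: P is of order L^2.\<close>
    moreover have "ln (10 ^ 10 * (real q)\<^sup>2) \<le> 28 * ln L"
    proof -
      have "ln (10 ^ 10 * (real q)\<^sup>2) = 10 * ln 10 + 2 * ln (real q)"
      proof -
        have "ln (10 ^ 10 * (real q)\<^sup>2) = ln (10 ^ 10) + ln ((real q)\<^sup>2)"
          by (subst ln_mult) (use q1 in auto)
        also have "ln ((10::real) ^ 10) = 10 * ln 10" by (subst ln_realpow) simp_all
        also have "ln ((real q)\<^sup>2) = 2 * ln (real q)" using q1 by (subst ln_realpow) simp_all
        finally show ?thesis .
      qed
      also have "ln (10::real) \<le> 2.4"
      proof -
        have "ln (10::real) \<le> ln (2 ^ 3 * (1.25))" by simp
        also have "\<dots> = ln ((2::real) ^ 3) + ln 1.25" by (subst ln_mult) simp_all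
        also have "ln ((2::real) ^ 3) = 3 * ln 2" by (subst ln_realpow) simp_all
        also have "ln (1.25::real) \<le> 0.25" using ln_add_one_self_le_self[of "0.25::real"] by simp
        finally show ?thesis using ln2_le_25_over_36 by simp
      qed
      also have "ln (real q) \<le> ln (2 * L)" using q q1 L by (subst ln_le_cancel_iff) auto
      also have "ln (2 * L) = ln 2 + ln L" using L by (simp add: ln_mult)
      finally have "ln (10 ^ 10 * (real q)\<^sup>2) \<le> 24 + 2 * (ln 2 + ln L)" by simp
      then show ?thesis using LL ln2_le_25_over_36 by simp
    qed
    ultimately have "real J \<le> 9600 * exp 4 * (28 * ln L) * K"
      by (smt (verit) exp_gt_zero mult_left_mono mult_right_mono)
    then have "L \<le> 34 * (9600 * exp 4 * (28 * ln L) * K)" using JL by linarith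
    then have "L / ln L \<le> 34 * (9600 * exp 4 * 28 * K)" using LL by (simp add: divide_le_eq mult_ac)
    then have "L / ln L \<le> K * (34 * 9600 * 28 * exp 4)" by (simp add: mult_ac)
    moreover have "0 < 34 * 9600 * 28 * exp (4::real)" by simp
    ultimately show ?thesis unfolding om by (simp only: pos_divide_le_eq)
  next
    case False
    \<comment> \<open>The fourth root of N: the case assumption becomes s^3 \<le> y, while sqrt N =
      y^2.\<close>
    define y where "y = exp (L / 4)"
    have y0: "y > 0" and y4: "y ^ 4 = N" unfolding y_def NL by (simp_all flip: exp_of_nat_mult)
    have "(real s ^ 3) ^ 4 \<le> y ^ 4" using False y4 by (simp flip: power_mult)
    then have "real s ^ 3 \<le> y" by (rule power_mono_iff[THEN iffD1, rotated 3]) (use y0 in auto)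
    have K0: "K \<ge> 0"
    proof -
      have "0 \<le> mean (\<lambda>x. norm (third_sum A x))" by (rule mean_nonneg[OF circ_fun_norm[OF circ_fun_third_sum]]) simp
      then show ?thesis using K(2) by (simp add: third_sum_def)
    qed
    have "sqrt N = y\<^sup>2" using y0 y4 by (intro real_sqrt_unique) (auto simp flip: power_mult)
    then have "y * y \<le> 640 * real s ^ 3 * K" using third by (simp add: power2_eq_square)
    also have "\<dots> \<le> 640 * y * K" using \<open>real s ^ 3 \<le> y\<close> K0 by (intro mult_right_mono mult_left_mono) auto
    finally have "y * y \<le> y * (640 * K)" by (simp add: mult_ac)
    then have "y \<le> 640 * K" by (rule mult_left_le_imp_le) (rule y0)
    moreover have "L / 4 \<le> y" using exp_ge_add_one_self[of "L / 4"] unfolding y_def by linarith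
    ultimately have LK: "L \<le> 2560 * K" by linarith
    have "L / ln L \<le> L" using LL L by (simp add: divide_le_eq)
    also have "\<dots> \<le> 2560 * K" by (rule LK)
    also have "\<dots> \<le> K * (34 * 9600 * 28 * exp 4)"
    proof -
      have "2560 * K \<le> (34 * 9600 * 28 * exp 4) * K" using K0 exp_ge_add_one_self[of 4] by (intro mult_right_mono) linarith+
      then show ?thesis by (simp add: mult.commute)
    qed
    finally have "L / ln L \<le> K * (34 * 9600 * 28 * exp 4)" .
    moreover have "0 < 34 * 9600 * 28 * exp (4::real)" by simp
    ultimately show ?thesis unfolding om by (simp only: pos_divide_le_eq)
  qed
qed

section \<open>The main theorem\<close>

lemma sum_indicator_arc:
  assumes k: "k \<ge> 1" and m: "m < 2 * k"
  shows "(\<Sum>n\<in>A. (indicat_real (to_circle ` arc k m) (circle_nmult n (to_circle x)) - 1 / (6 * real k))) =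
    (\<Sum>n\<in>A. arc_fun k m (real n * x))"
  by (intro sum.cong refl)
     (simp add: arc_fun_def circle_nmult_to_circle indicator_def to_circle_in_image[OF arc_subset[OF k m]])

lemma sum_indicator_card:
  assumes "finite A"
  shows "(\<Sum>n\<in>A. (indicat_real \<Omega> (g n) - c)) = real (card {n\<in>A. g n \<in> \<Omega>}) - real (card A) * c"
proof -
  have "(\<Sum>n\<in>A. indicat_real \<Omega> (g n)) = (\<Sum>n\<in>{n\<in>A. g n \<in> \<Omega>}. 1)"
    using assms by (intro sum.mono_neutral_cong_right) (auto simp: indicator_def)
  then show ?thesis by (simp add: sum_subtractf)
qed

text \<open>The sum is a count shifted by a constant. Finiteness of the range is what makes
  \<open>Max\<close> in the main statement a true maximum.\<close>

lemma finite_range_indicator_sum: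
  assumes "finite A"
  shows "finite (range (\<lambda>x. \<Sum>n\<in>A. (indicat_real \<Omega> (circle_nmult n x) - c)))"
proof (rule finite_subset)
  show "range (\<lambda>x. \<Sum>n\<in>A. (indicat_real \<Omega> (circle_nmult n x) - c)) \<subseteq> (\<lambda>j. real j - real (card A) * c) ` {..card A}"
    unfolding sum_indicator_card[OF assms] using assms by (auto intro!: card_mono)
qed simp

text \<open>Which arc works depends on A and is not made explicit: if all 2k arcs stayed at or below
  K/4k, both waves would have L^1 norm at most K. The hypothesis says that the larger of these two
  norms exceeds K.\<close>

lemma exists_maximal_large:
  fixes A :: "nat set" and K :: real
  assumes k: "k \<ge> 1" and A: "finite A" "0 \<notin> A"
    and K: "\<And>K'. mean (\<lambda>x. \<bar>\<Sum>n\<in>A. sixth_wave (real n * x)\<bar>) \<le> K' \<Longrightarrow>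
      mean (\<lambda>x. \<bar>\<Sum>n\<in>A. third_wave (real n * x)\<bar>) \<le> K' \<Longrightarrow> K < K'"
  shows "\<exists>\<Omega>. maximal_sum_free (2 * k) (4 * k) \<Omega> \<and>
    Max (range (\<lambda>x. \<Sum>n\<in>A. (indicat_real \<Omega> (circle_nmult n x) - 1 / (6 * real k)))) > K / (4 * real k)"
proof (rule ccontr)
  assume neg: "\<not> ?thesis"
  let ?f = "\<lambda>m x. \<Sum>n\<in>A. (indicat_real (to_circle ` arc k m) (circle_nmult n x) - 1 / (6 * real k))"
  have "(\<Sum>n\<in>A. arc_fun k m (real n * x)) \<le> K / (4 * real k)" if m: "m < 2 * k" for m x
  proof -
    have "?f m (to_circle x) \<le> Max (range (?f m))"
      by (rule Max_ge[OF finite_range_indicator_sum[OF A(1)]]) blast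
    also have "\<dots> \<le> K / (4 * real k)" using neg maximal_arc[OF k m] not_less by blast
    finally show ?thesis unfolding sum_indicator_arc[OF k m] .
  qed
  from waves_le_arc_bound[OF k A(2) this]
  have "K < 4 * real k * (K / (4 * real k))" by (intro K)
  then show False using k by simp
qed

text \<open>Erdos's argument: the map from n to n x is additive, so the n in A that it sends into a
  sum-free set form a sum-free set.\<close>

lemma max_sum_free_size_ge:
  assumes A: "finite A" and \<Omega>: "sum_free k l \<Omega>"
  shows "real (card A) * c + (\<Sum>n\<in>A. (indicat_real \<Omega> (circle_nmult n x) - c)) \<le> real (max_sum_free_size k l A)"
proof -
  define B where "B = {n\<in>A. circle_nmult n x \<in> \<Omega>}"
  have "sum_free k l B"
    unfolding sum_free_def
  proof
    assume "\<exists>u v. (\<forall>i<k. u i \<in> B) \<and> (\<forall>j<l. v j \<in> B) \<and> (\<Sum>i<k. u i) = (\<Sum>j<l. v j)"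
    then obtain u v where uv: "\<forall>i<k. u i \<in> B" "\<forall>j<l. v j \<in> B" "(\<Sum>i<k. u i) = (\<Sum>j<l. v j)" by blast
    have "(\<Sum>i<k. circle_nmult (u i) x) = (\<Sum>j<l. circle_nmult (v j) x)"
      unfolding circle_nmult_sum[symmetric] uv(3) by (rule refl)
    moreover have "\<forall>i<k. circle_nmult (u i) x \<in> \<Omega>" "\<forall>j<l. circle_nmult (v j) x \<in> \<Omega>"
      using uv by (auto simp: B_def)
    ultimately show False
      using \<Omega> unfolding sum_free_def by (metis (no_types, lifting))
  qed
  then have "card B \<in> card ` {B. B \<subseteq> A \<and> sum_free k l B}" by (auto simp: B_def)
  moreover have "finite (card ` {B. B \<subseteq> A \<and> sum_free k l B})"
    using A by (intro finite_imageI) (auto intro: finite_subset[of _ "Pow A"])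
  ultimately have "card B \<le> max_sum_free_size k l A"
    unfolding max_sum_free_size_def by (intro Max_ge)
  then show ?thesis by (simp add: sum_indicator_card[OF A] B_def)
qed

lemma max_sum_free_size_ge_Max:
  assumes A: "finite A" and \<Omega>: "maximal_sum_free k l \<Omega>"
  shows "real (card A) * c + Max (range (\<lambda>x. \<Sum>n\<in>A. (indicat_real \<Omega> (circle_nmult n x) - c)))
    \<le> real (max_sum_free_size k l A)"
proof -
  let ?R = "range (\<lambda>x. \<Sum>n\<in>A. (indicat_real \<Omega> (circle_nmult n x) - c))"
  have "Max ?R \<in> ?R" by (rule Max_in[OF finite_range_indicator_sum[OF A]]) blast
  then obtain x where "Max ?R = (\<Sum>n\<in>A. (indicat_real \<Omega> (circle_nmult n x) - c))" by blast
  then show ?thesis using max_sum_free_size_ge[OF A, of k l \<Omega> c x] \<Omega> by (simp add: maximal_sum_free_def)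
qed

lemma min_max_sum_free_size_attained:
  obtains A where "A \<in> pos_int_sets N" "min_max_sum_free_size k l N = max_sum_free_size k l A"
proof -
  have "{1..N} \<in> pos_int_sets N" by (simp add: pos_int_sets_def)
  then have "max_sum_free_size k l ` pos_int_sets N \<noteq> {}" by blast
  then have "Inf (max_sum_free_size k l ` pos_int_sets N) \<in> max_sum_free_size k l ` pos_int_sets N"
    by (rule Inf_nat_def1)
  then show ?thesis using that unfolding min_max_sum_free_size_def by blast
qed

theorem theorem1p4:
  fixes k :: nat
  assumes "k \<ge> 1"
  shows
    "(\<exists>c::real. c > 0 \<and>
       (\<forall>\<^sub>F N in sequentially. \<forall>A \<in> pos_int_sets N.
          \<exists>\<Omega>. maximal_sum_free (2 * k) (4 * k) \<Omega> \<and>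
            Max (range (\<lambda>x. \<Sum>n\<in>A. (indicat_real \<Omega> (circle_nmult n x) - 1 / (6 * real k))))
              \<ge> c * omega N)) \<and>
     (\<exists>c::real. c > 0 \<and>
       (\<forall>N\<ge>2. real (min_max_sum_free_size (2 * k) (4 * k) N)
          \<ge> real N / (6 * real k) + c * omega N))"
proof -
  \<comment> \<open>The factor 2 makes the bound strict, as the argument by contradiction in
    \<open>exists_maximal_large\<close> asks; 4k comes from passing from the waves to the
    arcs.\<close>
  define c where "c = 1 / (2 * (34 * 9600 * 28 * exp 4) * (4 * real k))"
  have c: "c > 0" using assms by (simp add: c_def)
  define N0 where "N0 = nat \<lceil>exp (34::real)\<rceil>"
  have large: "\<exists>\<Omega>. maximal_sum_free (2 * k) (4 * k) \<Omega> \<and>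
      Max (range (\<lambda>x. \<Sum>n\<in>A. (indicat_real \<Omega> (circle_nmult n x) - 1 / (6 * real k)))) \<ge> c * omega N"
    if N: "N \<ge> N0" and A: "A \<in> pos_int_sets N" for N A
  proof -
    have A': "finite A" "0 \<notin> A" "card A = N" using A by (auto simp: pos_int_sets_def)
    have eN: "exp 34 \<le> real N" using N unfolding N0_def by linarith
    moreover have N0': "real N > 0" using eN by (rule less_le_trans[OF exp_gt_zero])
    ultimately have lnN: "ln (real (card A)) \<ge> 34" unfolding A'(3) by (simp add: ln_ge_iff)
    have om: "omega N > 0"
    proof -
      have "ln (real N) \<ge> 34" using lnN A'(3) by simp
      then show ?thesis by (simp add: omega_def)
    qed
    have "\<exists>\<Omega>. maximal_sum_free (2 * k) (4 * k) \<Omega> \<and>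
      Max (range (\<lambda>x. \<Sum>n\<in>A. (indicat_real \<Omega> (circle_nmult n x) - 1 / (6 * real k)))) >
        omega N / (2 * (34 * 9600 * 28 * exp 4)) / (4 * real k)"
    proof (rule exists_maximal_large[OF assms A'(1,2)])
      fix K' assume "mean (\<lambda>x. \<bar>\<Sum>n\<in>A. sixth_wave (real n * x)\<bar>) \<le> K'"
        "mean (\<lambda>x. \<bar>\<Sum>n\<in>A. third_wave (real n * x)\<bar>) \<le> K'"
      from waves_lower_bound[OF A'(1,2) lnN this]
      have "omega N / (34 * 9600 * 28 * exp 4) \<le> K'" unfolding A'(3) .
      moreover have "omega N / (2 * (34 * 9600 * 28 * exp 4)) < omega N / (34 * 9600 * 28 * exp 4)"
        using om by (intro divide_strict_left_mono) auto
      ultimately show "omega N / (2 * (34 * 9600 * 28 * exp 4)) < K'" by linarith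
    qed
    moreover have "omega N / (2 * (34 * 9600 * 28 * exp 4)) / (4 * real k) = c * omega N"
      by (simp add: c_def)
    ultimately show ?thesis by (auto intro: less_imp_le)
  qed
  \<comment> \<open>For every N \<ge> 1 the maximum is strictly positive, so a sum-free subset of
    size M has 6kM > N, that is 6kM \<ge> N + 1.\<close>
  have small: "real N / (6 * real k) + 1 / (6 * real k) \<le> real (max_sum_free_size (2 * k) (4 * k) A)"
    if N: "N \<ge> 1" and A: "A \<in> pos_int_sets N" for N A
  proof -
    have A': "finite A" "0 \<notin> A" "card A = N" using A by (auto simp: pos_int_sets_def)
    have ne: "A \<noteq> {}" using A' N by auto
    have "\<exists>\<Omega>. maximal_sum_free (2 * k) (4 * k) \<Omega> \<and>
      Max (range (\<lambda>x. \<Sum>n\<in>A. (indicat_real \<Omega> (circle_nmult n x) - 1 / (6 * real k)))) > 0 / (4 * real k)"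
    proof (rule exists_maximal_large[OF assms A'(1,2)])
      fix K' assume K': "mean (\<lambda>x. \<bar>\<Sum>n\<in>A. third_wave (real n * x)\<bar>) \<le> K'"
      define s where "s = card (tripling_boundary A)"
      have "0 < sqrt (real (card A))" using A' N by simp
      also have "\<dots> \<le> 640 * (real s) ^ 3 * mean (\<lambda>x. \<bar>third_sum A x\<bar>)"
        by (rule mean_third_sum_ge[OF A'(1,2) ne]) (simp add: s_def)
      also have "\<dots> \<le> 640 * (real s) ^ 3 * K'"
        using K' by (intro mult_left_mono) (simp_all add: third_sum_def)
      finally show "0 < K'" by (simp add: zero_less_mult_iff)
    qed
    then obtain \<Omega> where \<Omega>: "maximal_sum_free (2 * k) (4 * k) \<Omega>"
      "Max (range (\<lambda>x. \<Sum>n\<in>A. (indicat_real \<Omega> (circle_nmult n x) - 1 / (6 * real k)))) > 0" by auto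
    define M where "M = max_sum_free_size (2 * k) (4 * k) A"
    have "real N * (1 / (6 * real k)) < real M"
      using max_sum_free_size_ge_Max[OF A'(1) \<Omega>(1), of "1 / (6 * real k)"] \<Omega>(2) unfolding M_def A'(3) by linarith
    then have "real N < real (6 * k * M)" using assms by (simp add: field_simps)
    then have "N + 1 \<le> 6 * k * M" by linarith
    then have "real (N + 1) \<le> real (6 * k * M)" by (rule of_nat_mono)
    then have "(real N + 1) / (6 * real k) \<le> real M" using assms by (simp add: field_simps)
    then show ?thesis by (simp add: M_def add_divide_distrib)
  qed
  \<comment> \<open>Bounds \<open>omega\<close> on the finitely many N below N0, in absolute value
    since omega 2 is negative. A slope d with d w \<le> 1/6k is then covered by the gain from
    integrality.\<close>
  define w where "w = 1 + (\<Sum>N<N0. \<bar>omega N\<bar>)"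
  have w: "w > 0" unfolding w_def by (rule add_pos_nonneg) (auto intro: sum_nonneg)
  define d where "d = min c (1 / (6 * real k * w))"
  have d: "d > 0" "d \<le> c" "d \<le> 1 / (6 * real k * w)" using c w assms by (auto simp: d_def)
  have "real N / (6 * real k) + d * omega N \<le> real (min_max_sum_free_size (2 * k) (4 * k) N)" if N: "N \<ge> 2" for N
  proof -
    obtain A where A: "A \<in> pos_int_sets N"
      "min_max_sum_free_size (2 * k) (4 * k) N = max_sum_free_size (2 * k) (4 * k) A"
      by (rule min_max_sum_free_size_attained)
    have A': "finite A" "card A = N" using A(1) by (auto simp: pos_int_sets_def)
    have "real N / (6 * real k) + d * omega N \<le> real (max_sum_free_size (2 * k) (4 * k) A)"
    proof (cases "N \<ge> N0")
      case True
      obtain \<Omega> where \<Omega>: "maximal_sum_free (2 * k) (4 * k) \<Omega>"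
        "Max (range (\<lambda>x. \<Sum>n\<in>A. (indicat_real \<Omega> (circle_nmult n x) - 1 / (6 * real k)))) \<ge> c * omega N"
        using large[OF True A(1)] by blast
      have "exp 34 \<le> real N" using True unfolding N0_def by linarith
      moreover have "real N > 0" using N by simp
      ultimately have "ln (real N) \<ge> 34" by (simp add: ln_ge_iff)
      then have "omega N \<ge> 0" by (simp add: omega_def)
      then have "d * omega N \<le> c * omega N" using d(2) by (rule mult_right_mono[rotated])
      then have "real N * (1 / (6 * real k)) + d * omega N \<le> real (max_sum_free_size (2 * k) (4 * k) A)"
        using max_sum_free_size_ge_Max[OF A'(1) \<Omega>(1), of "1 / (6 * real k)"] \<Omega>(2) unfolding A'(2) by linarith
      then show ?thesis by simp
    next
      case False
      have "\<bar>omega N\<bar> \<le> (\<Sum>N<N0. \<bar>omega N\<bar>)" using False by (intro member_le_sum) auto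
      then have "omega N \<le> w" unfolding w_def by linarith
      then have "d * omega N \<le> d * w" using d(1) by (intro mult_left_mono) auto
      also have "\<dots> \<le> 1 / (6 * real k * w) * w" using d(3) w by (intro mult_right_mono) auto
      also have "\<dots> = 1 / (6 * real k)" using w by simp
      finally show ?thesis using small[of N A] N A(1) by linarith
    qed
    then show ?thesis using A(2) by simp
  qed
  moreover have "\<forall>\<^sub>F N in sequentially. \<forall>A \<in> pos_int_sets N.
          \<exists>\<Omega>. maximal_sum_free (2 * k) (4 * k) \<Omega> \<and>
            Max (range (\<lambda>x. \<Sum>n\<in>A. (indicat_real \<Omega> (circle_nmult n x) - 1 / (6 * real k)))) \<ge> c * omega N"
    using large unfolding eventually_sequentially by blast
  ultimately show ?thesis using c d(1) by blast
qed

end
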